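(* The density fingerprint map $A \mapsto \Psi(A) = (\psi_0^A, \psi_1^A, \psi_2^A, \ldots)$ on periodic sets in $\mathbb{R}^3$ satisfies the following properties. 1. (Invariance) If $A \subseteq \mathbb{R}^3$ is a periodic set and $Q = \iota(A)$ for an isometry $\iota \colon \mathbb{R}^3 \to \mathbb{R}^3$ (a rigid motion, possibly composed with a reflection), then $\Psi(A) = \Psi(Q)$. 2. (Lipschitz continuity with respect to small perturbations) For every periodic set $A \subseteq \mathbb{R}^3$ there exist $\varepsilon > 0$ and $C > 0$, depending only on the packing radius and the covering radius of $A$, such that $d_\infty(\Psi(A), \Psi(Q)) \leq C \cdot d_B(A,Q)$ for every periodic set $Q \subseteq \mathbb{R}^3$ with $d_B(A,Q) < \varepsilon$. 3. (Generic completeness) There is an open and dense subset $\mathcal{G}$ of the space $\mathcal{P}$ of periodic sets in $\mathbb{R}^3$ such that, for all $A, Q \in \mathcal{G}$, if $\Psi(A) = \Psi(Q)$ then $A$ and $Q$ are isometric.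
   Context: A basis is a triple $v_1,v_2,v_3$ of linearly independent vectors in $\mathbb{R}^3$. It defines the lattice $\Lambda = \{n_1v_1+n_2v_2+n_3v_3 \mid n_i \in \mathbb{Z}\}$ and the unit cell $U = \{r_1v_1+r_2v_2+r_3v_3 \mid 0 \leq r_i < 1\}$. A motif is a finite nonempty set $M \subseteq U$, and a periodic set is a set of the form $A = M + \Lambda = \{x+v \mid x \in M, v \in \Lambda\}$. The packing radius of $A$ is the largest $r$ such that every open ball of radius $r$ contains at most one point of $A$; the covering radius is the smallest $R$ such that every closed ball of radius $R$ contains at least one point of $A$. For $t \geq 0$ let $B(a;t)$ be the closed ball of radius $t$ centered at $a$. For an integer $k \geq 0$, $\varphi_k^A(t)$ is the volume of the set of points $x \in U$ that belong to $B(a;t)$ for $k$ or more points $a \in A$, divided by $\mathrm{Vol}[U]$. The $k$-th density function is $\psi_k^A \colon [0,\infty) \to [0,1]$, $\psi_k^A(t) = \varphi_k^A(t) - \varphi_{k+1}^A(t)$, i.e. the probability that a uniformly random point of $U$ lies in exactly $k$ of the balls $B(a;t)$, $a \in A$. (This does not depend on the choice of lattice, basis, and motif representing $A$.) The density fingerprint of $A$ is the sequence $\Psi(A) = (\psi_0^A, \psi_1^A, \ldots)$. Distances: $d_B(A,Q) = \inf_{\gamma} \sup_{a \in A} \|a - \gamma(a)\|_2$, the infimum being over all bijections $\gamma \colon A \to Q$, and $d_\infty(\Psi(A),\Psi(Q)) = \sup_{k \geq 0} (k+1)^{-2/3}\, \|\psi_k^A - \psi_k^Q\|_\infty$. Space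 of periodic sets: for $m \geq 1$ let $\mathcal{P}_m$ be the set of tuples $(v_1,v_2,v_3;x_1,\ldots,x_m)$ with $v_1,v_2,v_3 \in \mathbb{R}^3$ linearly independent and $x_1,\ldots,x_m$ pairwise distinct points in the unit cell of $v_1,v_2,v_3$, with the topology induced from $(\mathbb{R}^3)^{3+m}$; such a tuple represents the periodic set $\{x_1,\ldots,x_m\}+\Lambda$. The space $\mathcal{P}$ is the disjoint union of the $\mathcal{P}_m$, $m \geq 1$; elements of $\mathcal{P}$ are identified in the notation with the periodic sets they represent. *)

theory Defs
  imports "HOL-Analysis.Analysis"
begin

text \<open>A triple of vectors \<open>v\<^sub>1, v\<^sub>2, v\<^sub>3\<close> is a term \<open>v :: real^3^3\<close> with members \<open>v $ i\<close>.
  Injectivity is needed because \<^const>\<open>independent\<close> applies to the set of members, which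
  does not see repetitions.\<close>

definition is_basis :: "real^3^3 \<Rightarrow> bool" where
  "is_basis v \<longleftrightarrow> inj (\<lambda>i. v $ i) \<and> independent (range (\<lambda>i. v $ i))"

definition lattice_of :: "real^3^3 \<Rightarrow> (real^3) set" where
  "lattice_of v = {(\<Sum>i\<in>UNIV. real_of_int (n i) *\<^sub>R v $ i) | n :: 3 \<Rightarrow> int. True}"

definition unit_cell :: "real^3^3 \<Rightarrow> (real^3) set" where
  "unit_cell v = {(\<Sum>i\<in>UNIV. r i *\<^sub>R v $ i) | r :: 3 \<Rightarrow> real. \<forall>i. 0 \<le> r i \<and> r i < 1}"

definition is_motif :: "real^3^3 \<Rightarrow> (real^3) set \<Rightarrow> bool" where
  "is_motif v M \<longleftrightarrow> finite M \<and> M \<noteq> {} \<and> M \<subseteq> unit_cell v"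

definition motif_translates :: "real^3^3 \<Rightarrow> (real^3) set \<Rightarrow> (real^3) set" where
  "motif_translates v M = {x + w | x w. x \<in> M \<and> w \<in> lattice_of v}"

definition represents :: "real^3^3 \<Rightarrow> (real^3) set \<Rightarrow> (real^3) set \<Rightarrow> bool" where
  "represents v M A \<longleftrightarrow> is_basis v \<and> is_motif v M \<and> A = motif_translates v M"

definition periodic_set :: "(real^3) set \<Rightarrow> bool" where
  "periodic_set A \<longleftrightarrow> (\<exists>v M. represents v M A)"

text \<open>Radii range over all reals; balls of negative radius (and open balls of radius 0)
  are empty. Both extrema are attained when \<open>A\<close> is a periodic set.\<close>

definition packing_radius :: "(real^3) set \<Rightarrow> real" where
  "packing_radius A =
     (GREATEST r. \<forall>c. \<forall>a\<in>A \<inter> ball c r. \<forall>b\<in>A \<inter> ball c r. a = b)"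

definition covering_radius :: "(real^3) set \<Rightarrow> real" where
  "covering_radius A = (LEAST r. \<forall>c. A \<inter> cball c r \<noteq> {})"

text \<open>For a periodic set \<open>A\<close> and a point \<open>x\<close>, the set of \<open>a \<in> A\<close> whose ball contains \<open>x\<close>
  is finite, so \<^const>\<open>card\<close> is not its default value 0 for infinite sets.\<close>

definition coverage_fraction :: "real^3^3 \<Rightarrow> (real^3) set \<Rightarrow> nat \<Rightarrow> real \<Rightarrow> real" where
  "coverage_fraction v A k t =
     measure lebesgue {x \<in> unit_cell v. card {a \<in> A. x \<in> cball a t} \<ge> k}
       / measure lebesgue (unit_cell v)"

text \<open>The value does not depend on which basis is used to represent \<open>A\<close>; the choice operator
  picks one of them.\<close>

definition coverage :: "(real^3) set \<Rightarrow> nat \<Rightarrow> real \<Rightarrow> real" where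
  "coverage A = coverage_fraction (SOME v. \<exists>M. represents v M A) A"

text \<open>The density functions have domain \<open>[0, \<infinity>)\<close>, so equality of fingerprints is
  equality at all nonnegative radii.\<close>

definition density_function :: "(real^3) set \<Rightarrow> nat \<Rightarrow> real \<Rightarrow> real" where
  "density_function A k = (\<lambda>t\<in>{0..}. coverage A k t - coverage A (k + 1) t)"

definition density_fingerprint :: "(real^3) set \<Rightarrow> (nat \<Rightarrow> real \<Rightarrow> real)" where
  "density_fingerprint A = (\<lambda>k. density_function A k)"

text \<open>Both distances are extended nonnegative reals, so that no supremum or infimum is taken
  of an unbounded or empty set of reals.\<close>

definition bottleneck_dist :: "(real^3) set \<Rightarrow> (real^3) set \<Rightarrow> ennreal" where
  "bottleneck_dist A Q =
     (INF \<gamma>\<in>{\<gamma>. bij_betw \<gamma> A Q}. SUP a\<in>A. ennreal (norm (a - \<gamma> a)))"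

definition fingerprint_dist ::
    "(nat \<Rightarrow> real \<Rightarrow> real) \<Rightarrow> (nat \<Rightarrow> real \<Rightarrow> real) \<Rightarrow> ennreal" where
  "fingerprint_dist f g =
     (SUP k. ennreal (real (k + 1) powr (- (2 / 3))) *
        (SUP t\<in>{0..}. ennreal \<bar>f k t - g k t\<bar>))"

text \<open>Distance-preserving self-maps of Euclidean space are automatically surjective.\<close>

definition is_isometry :: "(real^3 \<Rightarrow> real^3) \<Rightarrow> bool" where
  "is_isometry \<iota> \<longleftrightarrow> (\<forall>x y. dist (\<iota> x) (\<iota> y) = dist x y)"

definition isometric_sets :: "(real^3) set \<Rightarrow> (real^3) set \<Rightarrow> bool" where
  "isometric_sets A Q \<longleftrightarrow> (\<exists>\<iota>. is_isometry \<iota> \<and> Q = \<iota> ` A)"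

text \<open>The points \<open>x\<^sub>1, \<dots>, x\<^sub>m\<close> are indexed by \<open>{..<m}\<close>, as an extensional function.\<close>

definition config_tuples :: "nat \<Rightarrow> ((real^3^3) \<times> (nat \<Rightarrow> real^3)) set" where
  "config_tuples m =
     {(v, x). is_basis v \<and> x \<in> {..<m} \<rightarrow>\<^sub>E unit_cell v \<and> inj_on x {..<m}}"

definition config_topology :: "nat \<Rightarrow> ((real^3^3) \<times> (nat \<Rightarrow> real^3)) topology" where
  "config_topology m =
     subtopology
       (prod_topology euclidean (product_topology (\<lambda>_. euclidean) {..<m}))
       (config_tuples m)"

definition periodic_space :: "(nat \<times> ((real^3^3) \<times> (nat \<Rightarrow> real^3))) topology" where
  "periodic_space = sum_topology config_topology {1..}"

definition set_of_config :: "nat \<times> ((real^3^3) \<times> (nat \<Rightarrow> real^3)) \<Rightarrow> (real^3) set" where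
  "set_of_config = (\<lambda>(m, v, x). motif_translates v (x ` {..<m}))"

end

theory Submission
  imports Defs "HOL-Computational_Algebra.Polynomial"
begin

text \<open>Invariance. The coverage functions are densities of lattice-invariant sets, which are limits over
  large balls; hence they do not depend on the basis and are preserved by isometries.

  Lipschitz continuity. A bijection moving points by at most \<open>\<delta>\<close> traps the \<open>k\<close>-fold coverage of \<open>Q\<close> at
  radius \<open>t\<close> between those of \<open>A\<close> at \<open>t - \<delta>\<close> and \<open>t + \<delta>\<close>. These differ only inside spherical shells
  around the points of \<open>A\<close>, and only for \<open>t\<close> of order \<open>k\<close> to the power \<open>1/3\<close>, which gives the exponent
  \<open>2/3\<close>. The packing radius bounds the point density and the covering radius bounds \<open>t\<close>.

  Generic completeness. The second moment of the number of balls containing a random point is a sum of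
  lens volumes over pairs of points, so the fingerprint determines the distances between points. If the
  inner products of all vectors of a configuration \<open>p\<close> are linearly independent over the rationals, a
  configuration \<open>q\<close> with the same distances satisfies the same linear relations between squared
  distances. As these relations express that certain integer matrices of rank one depend quadratically
  on lattice vectors, they make the assignment of difference vectors linear, and \<open>q\<close> is embedded
  isometrically into \<open>p\<close>. Only finitely many distances are needed, so the argument persists for
  configurations near \<open>p\<close> and \<open>q\<close>. The open dense set is a union of small neighbourhoods of a
  dense sequence of such \<open>p\<close>, chosen one after the other by compactness.\<close>

section \<open>Integer combinations and rank one matrices\<close>

text \<open>Independence is asked of the inner products of \<open>3 + m\<close> vectors in dimension
  3. This is possible because the relations forced on a Gram matrix by its small rank are
  polynomial, not linear with rational coefficients. In return, a length determines the integer
  coefficients of a vector up to sign. That sign is the main obstacle: each distance of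
  \<open>q\<close> yields coefficients in \<open>p\<close> separately, and no single length chooses
  between \<open>c\<close> and \<open>- c\<close>. Two facts make the signs coherent: an integer
  quadratic with only square values has discriminant zero, and the third difference of a quadratic
  form vanishes. Independence fails on a dense set, so the generic configurations cannot themselves
  form the open set. What survives perturbation is a finite list of length equations, since lengths
  below a bound involve finitely many coefficient vectors. Rigidity is proved near a pair with
  \<open>p\<close> generic and \<open>q\<close> arbitrary, as the compactness argument requires:
  compact neighbourhoods contain configurations that are not generic. Distances enter only as a set,
  without multiplicities, so they give an embedding; that it is onto follows from the volume covered
  by small balls.\<close>

definition gram_independent :: "'i set \<Rightarrow> ('i \<Rightarrow> 'v::real_inner) \<Rightarrow> bool" where
  "gram_independent I h \<longleftrightarrow>
     (\<forall>M :: 'i \<Rightarrow> 'i \<Rightarrow> int. (\<forall>a\<in>I. \<forall>b\<in>I. M a b = M b a) \<longrightarrow>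
        (\<Sum>a\<in>I. \<Sum>b\<in>I. of_int (M a b) * (h a \<bullet> h b)) = 0 \<longrightarrow> (\<forall>a\<in>I. \<forall>b\<in>I. M a b = 0))"

definition int_comb :: "'i set \<Rightarrow> ('i \<Rightarrow> 'v::real_vector) \<Rightarrow> ('i \<Rightarrow> int) \<Rightarrow> 'v" where
  "int_comb I h c = (\<Sum>a\<in>I. of_int (c a) *\<^sub>R h a)"

lemma inner_int_comb:
  fixes h :: "'i \<Rightarrow> 'v::real_inner"
  shows "int_comb I h c \<bullet> int_comb I h d = (\<Sum>a\<in>I. \<Sum>b\<in>I. of_int (c a * d b) * (h a \<bullet> h b))"
  unfolding int_comb_def inner_sum_left inner_sum_right sum_distrib_left
  by (subst sum.swap) (simp add: mult.assoc mult.left_commute)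

lemma norm_int_comb_sq:
  fixes h :: "'i \<Rightarrow> 'v::real_inner"
  shows "(norm (int_comb I h c))\<^sup>2 = (\<Sum>a\<in>I. \<Sum>b\<in>I. of_int (c a * c b) * (h a \<bullet> h b))"
  unfolding power2_norm_eq_inner inner_int_comb ..

lemma int_comb_cong: "(\<And>a. a \<in> I \<Longrightarrow> c a = d a) \<Longrightarrow> int_comb I h c = int_comb I h d"
  by (simp add: int_comb_def)

lemma int_comb_minus: "int_comb I h (\<lambda>a. - c a) = - int_comb I h c"
  by (simp add: int_comb_def sum_negf)

lemma int_comb_diff: "int_comb I h (\<lambda>a. c a - d a) = int_comb I h c - int_comb I h d"
  by (simp add: int_comb_def sum_subtractf scaleR_left_diff_distrib)

lemma int_comb_add: "int_comb I h (\<lambda>a. c a + d a) = int_comb I h c + int_comb I h d"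
  by (simp add: int_comb_def sum.distrib scaleR_left_distrib)

lemma int_comb_scale: "int_comb I h (\<lambda>a. s * c a) = of_int s *\<^sub>R int_comb I h c"
  by (simp add: int_comb_def scaleR_sum_right)

text \<open>Expanded by bilinearity, the relation between squared lengths has the entries of the
  symmetric integer matrix \<open>M\<close> as its coefficients at the inner products, so
  \<open>M\<close> vanishes. Relations between lengths thus become relations between rank one
  matrices.\<close>

lemma gram_independent_relation:
  fixes h :: "'i \<Rightarrow> 'v::real_inner" and t :: "'j \<Rightarrow> int"
  assumes "gram_independent I h"
    and "(\<Sum>j\<in>J. of_int (t j) * (norm (int_comb I h (c j)))\<^sup>2) = 0"
    and "a \<in> I" "b \<in> I"
  shows "(\<Sum>j\<in>J. t j * (c j a * c j b)) = 0"
proof -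
  define M where "M = (\<lambda>a b. \<Sum>j\<in>J. t j * (c j a * c j b))"
  have "(\<Sum>a\<in>I. \<Sum>b\<in>I. of_int (M a b) * (h a \<bullet> h b)) =
        (\<Sum>a\<in>I. \<Sum>b\<in>I. \<Sum>j\<in>J. of_int (t j) * (of_int (c j a * c j b) * (h a \<bullet> h b)))"
    by (simp add: M_def sum_distrib_right mult.assoc)
  also have "\<dots> = (\<Sum>a\<in>I. \<Sum>j\<in>J. \<Sum>b\<in>I. of_int (t j) * (of_int (c j a * c j b) * (h a \<bullet> h b)))"
    by (rule sum.cong[OF refl], rule sum.swap)
  also have "\<dots> = (\<Sum>j\<in>J. \<Sum>a\<in>I. \<Sum>b\<in>I. of_int (t j) * (of_int (c j a * c j b) * (h a \<bullet> h b)))"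
    by (rule sum.swap)
  also have "\<dots> = 0"
    using assms(2) by (simp add: norm_int_comb_sq sum_distrib_left)
  finally have "(\<Sum>a\<in>I. \<Sum>b\<in>I. of_int (M a b) * (h a \<bullet> h b)) = 0" .
  moreover have "M a b = M b a" for a b
    unfolding M_def by (simp add: mult_ac)
  ultimately have "M a b = 0"
    using assms(1,3,4) unfolding gram_independent_def by blast
  then show ?thesis by (simp add: M_def)
qed

text \<open>The sign is read off at one index where \<open>d\<close> is nonzero; cancelling that
  entry carries it to all other indices.\<close>

lemma rank_one_eq_imp_eq_or_minus:
  fixes c d :: "'i \<Rightarrow> 'r::idom"
  assumes "\<And>a b. a \<in> I \<Longrightarrow> b \<in> I \<Longrightarrow> c a * c b = d a * d b"
  shows "(\<forall>a\<in>I. c a = d a) \<or> (\<forall>a\<in>I. c a = - d a)"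
proof (cases "\<exists>a\<in>I. d a \<noteq> 0")
  case True
  then obtain a where a: "a \<in> I" "d a \<noteq> 0" by auto
  have "c a = d a \<or> c a = - d a"
    using assms[OF a(1) a(1)] by (simp add: square_eq_iff)
  then show ?thesis
  proof
    assume "c a = d a"
    then show ?thesis using assms[OF a(1)] a(2) by auto
  next
    assume "c a = - d a"
    then have "c b = - d b" if "b \<in> I" for b
    proof -
      have "- (d a * c b) = d a * d b" using assms[OF a(1) that] \<open>c a = - d a\<close> by simp
      then have "d a * (c b + d b) = 0" unfolding distrib_left by (metis neg_eq_iff_add_eq_0)
      then show ?thesis using a(2) by (simp add: eq_neg_iff_add_eq_0)
    qed
    then show ?thesis by blast
  qed
next
  case False
  then have "c a = d a" if "a \<in> I" for a
    using assms[OF that that] that by auto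
  then show ?thesis by blast
qed

lemma gram_independent_norm_eq:
  fixes h :: "'i \<Rightarrow> 'v::real_inner"
  assumes "gram_independent I h"
    and "norm (int_comb I h c) = norm (int_comb I h d)"
  shows "(\<forall>a\<in>I. c a = d a) \<or> (\<forall>a\<in>I. c a = - d a)"
proof (rule rank_one_eq_imp_eq_or_minus)
  fix a b assume "a \<in> I" "b \<in> I"
  with gram_independent_relation[OF assms(1), of "\<lambda>j. if j then 1 else -1" "\<lambda>j. if j then c else d" UNIV a b]
  show "c a * c b = d a * d b"
    using assms(2) by (simp add: UNIV_bool)
qed

text \<open>Completing the square gives \<open>X\<^sup>2 = Y\<^sup>2 + K\<close>, where
  \<open>K\<close> is minus the discriminant and \<open>Y\<close> grows with \<open>s\<close>.
  Different squares \<open>X\<^sup>2\<close> and \<open>Y\<^sup>2\<close> are at least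
  \<open>Y\<close> apart, so \<open>K\<close> is 0 once \<open>Y\<close> exceeds its absolute value.
  For \<open>b = 0\<close> the values are linear in \<open>s\<close>, and a linear function without
  negative values is constant.\<close>

lemma square_values_discriminant:
  fixes c e b :: int
  assumes sq: "\<And>s. \<exists>k. k\<^sup>2 = c + e * s + b\<^sup>2 * s\<^sup>2"
  shows "e\<^sup>2 = 4 * c * b\<^sup>2"
proof (cases "b = 0")
  case True
  have nonneg: "c + e * s \<ge> 0" for s
    using sq[of s] True by (metis add.right_neutral mult_zero_left zero_le_power2 zero_power2)
  have "c \<ge> 0" using nonneg[of 0] by simp
  have "e = 0"
  proof (rule ccontr)
    assume "e \<noteq> 0"
    then have "e * e \<ge> 1" by (smt (verit) mult_le_0_iff mult_neg_neg mult_pos_pos)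
    \<comment> \<open>At \<open>s = - e * (c + 1)\<close> the linear function would be at most
      -1.\<close>
    then have "(c + 1) * (e * e) \<ge> c + 1" using \<open>c \<ge> 0\<close> by (simp add: mult_le_cancel_left1)
    moreover have "c + e * (- (e * (c + 1))) \<ge> 0" by (rule nonneg)
    ultimately show False by (simp add: algebra_simps)
  qed
  with True show ?thesis by simp
next
  case False
  define K where "K = 4 * b\<^sup>2 * c - e\<^sup>2"
  have b1: "b\<^sup>2 \<ge> 1" using False by (simp add: int_one_le_iff_zero_less)
  define s where "s = \<bar>e\<bar> + \<bar>K\<bar> + 1"
  define Y where "Y = 2 * b\<^sup>2 * s + e"
  obtain k where k: "k\<^sup>2 = c + e * s + b\<^sup>2 * s\<^sup>2" using sq by blast
  define X where "X = 2 * b * k"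
  have XY: "X\<^sup>2 = Y\<^sup>2 + K"
    unfolding X_def Y_def K_def using k by (simp add: power2_eq_square) algebra
  have "b\<^sup>2 * s \<ge> s" using b1 s_def by (simp add: mult_le_cancel_right1)
  then have Y: "Y > \<bar>K\<bar>" unfolding Y_def s_def by linarith
  have "K = 0"
  proof (rule ccontr)
    assume "K \<noteq> 0"
    then have ne: "\<bar>X\<bar> \<noteq> Y" using XY by (metis add_cancel_left_right power2_abs)
    have "(\<bar>X\<bar> - Y) * (\<bar>X\<bar> + Y) = K"
      using XY by (simp add: algebra_simps power2_eq_square)
    then have "\<bar>K\<bar> = \<bar>\<bar>X\<bar> - Y\<bar> * (\<bar>X\<bar> + Y)" using Y by (metis abs_mult abs_of_nonneg abs_ge_zero add_nonneg_nonneg less_imp_le order_trans)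
    moreover have "\<bar>\<bar>X\<bar> - Y\<bar> \<ge> 1" using ne by simp
    ultimately have "\<bar>K\<bar> \<ge> \<bar>X\<bar> + Y" using Y by (smt (verit) mult_le_cancel_right1)
    then show False using Y by simp
  qed
  then show ?thesis by (simp add: K_def mult_ac)
qed

section \<open>Quadratic forms of integer matrices\<close>

definition sym_prod :: "('i \<Rightarrow> 'r::comm_ring_1) \<Rightarrow> ('i \<Rightarrow> 'r) \<Rightarrow> 'i \<Rightarrow> 'i \<Rightarrow> 'r" where
  "sym_prod P Q a b = P a * Q b + P b * Q a"

definition quad_form :: "'i set \<Rightarrow> ('i \<Rightarrow> 'i \<Rightarrow> 'r::comm_ring_1) \<Rightarrow> ('i \<Rightarrow> 'r) \<Rightarrow> 'r" where
  "quad_form I M x = (\<Sum>a\<in>I. \<Sum>b\<in>I. M a b * (x a * x b))"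

lemma quad_form_line:
  "\<exists>m. \<forall>t. quad_form I M (\<lambda>a. x a + t * y a) = quad_form I M x + t * m + t\<^sup>2 * quad_form I M y"
proof -
  have "quad_form I M (\<lambda>a. x a + t * y a) = quad_form I M x
      + t * (\<Sum>a\<in>I. \<Sum>b\<in>I. M a b * (x a * y b + y a * x b)) + t\<^sup>2 * quad_form I M y" for t
    unfolding quad_form_def sum_distrib_left sum.distrib[symmetric]
    by (intro sum.cong refl) (simp add: algebra_simps power2_eq_square)
  then show ?thesis by blast
qed

text \<open>Integer polynomials have no zero divisors. On the line through a point where one form is
  nonzero, in a direction where the other is nonzero, both restrict to polynomials: \<open>p\<close>
  has a nonzero constant term and \<open>q\<close> a nonzero leading coefficient, although
  \<open>p * q\<close> vanishes at every integer.\<close>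

lemma quad_form_product_zero:
  fixes M N :: "'i \<Rightarrow> 'i \<Rightarrow> int"
  assumes "\<And>x. quad_form I M x * quad_form I N x = 0"
  shows "(\<forall>x. quad_form I M x = 0) \<or> (\<forall>x. quad_form I N x = 0)"
proof (rule ccontr)
  assume "\<not> ?thesis"
  then obtain x y where x: "quad_form I M x \<noteq> 0" and y: "quad_form I N y \<noteq> 0" by blast
  obtain m where m: "\<And>t. quad_form I M (\<lambda>a. x a + t * y a) = quad_form I M x + t * m + t\<^sup>2 * quad_form I M y"
    using quad_form_line by blast
  obtain n where n: "\<And>t. quad_form I N (\<lambda>a. x a + t * y a) = quad_form I N x + t * n + t\<^sup>2 * quad_form I N y"
    using quad_form_line by blast
  define p where "p = [:quad_form I M x, m, quad_form I M y:]"
  define q where "q = [:quad_form I N x, n, quad_form I N y:]"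
  have "poly p t = quad_form I M (\<lambda>a. x a + t * y a)" for t
    by (simp add: p_def m power2_eq_square algebra_simps)
  moreover have "poly q t = quad_form I N (\<lambda>a. x a + t * y a)" for t
    by (simp add: q_def n power2_eq_square algebra_simps)
  ultimately have "poly (p * q) t = 0" for t using assms by simp
  then have "p * q = 0" by (simp only: poly_all_0_iff_0[symmetric]) blast
  moreover have "p \<noteq> 0" using x by (simp add: p_def)
  moreover have "q \<noteq> 0" using y by (simp add: q_def)
  ultimately show False by simp
qed

lemma quad_form_single:
  assumes "finite I" "a \<in> I"
  shows "quad_form I M (\<lambda>i. if i = a then 1 else 0) = M a a"
proof -
  have "quad_form I M (\<lambda>i. if i = a then 1 else 0) = (\<Sum>i\<in>I. if i = a then (\<Sum>j\<in>I. if j = a then M i j else 0) else 0)"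
    unfolding quad_form_def by (intro sum.cong refl) (simp add: mult.commute if_distrib cong: if_cong)
  then show ?thesis using assms by simp
qed

lemma quad_form_pair:
  assumes "finite I" "a \<in> I" "b \<in> I" "a \<noteq> b"
  shows "quad_form I M (\<lambda>i. if i = a \<or> i = b then 1 else 0) = M a a + M a b + M b a + M b b"
proof -
  have "quad_form I M (\<lambda>i. if i = a \<or> i = b then 1 else 0) =
     (\<Sum>i\<in>I. \<Sum>j\<in>I. if i \<in> {a,b} \<and> j \<in> {a,b} then M i j else 0)"
    unfolding quad_form_def by (intro sum.cong refl) auto
  also have "\<dots> = (\<Sum>i\<in>I. if i \<in> {a,b} then (\<Sum>j\<in>I. if j \<in> {a,b} then M i j else 0) else 0)"
    by (intro sum.cong refl) auto
  also have "\<dots> = (\<Sum>i\<in>I \<inter> {a,b}. \<Sum>j\<in>I \<inter> {a,b}. M i j)"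
    using assms(1) by (simp only: sum.inter_restrict)
  also have "I \<inter> {a,b} = {a,b}" using assms by auto
  finally show ?thesis using assms(4) by simp
qed

text \<open>Polarisation on indicator vectors: single indices give the diagonal, pairs of indices
  give twice the entry off the diagonal.\<close>

lemma quad_form_zero_imp:
  fixes M :: "'i \<Rightarrow> 'i \<Rightarrow> int"
  assumes "finite I" and sym: "\<And>a b. a \<in> I \<Longrightarrow> b \<in> I \<Longrightarrow> M a b = M b a"
    and "\<And>x. quad_form I M x = 0" and ab: "a \<in> I" "b \<in> I"
  shows "M a b = 0"
proof (cases "a = b")
  case True
  then show ?thesis using quad_form_single[OF assms(1) ab(1), of M] assms(3) by simp
next
  case False
  then show ?thesis using quad_form_pair[OF assms(1) ab False, of M] assms(3) sym[OF ab]
      quad_form_single[OF assms(1) ab(1), of M] quad_form_single[OF assms(1) ab(2), of M] by simp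
qed

lemma quad_form_rank_one:
  "quad_form I (\<lambda>a b. P a * Q b) x = (\<Sum>a\<in>I. P a * x a) * (\<Sum>b\<in>I. Q b * x b)"
  by (simp add: quad_form_def sum_product mult_ac)

lemma quad_form_add: "quad_form I (\<lambda>a b. M a b + N a b) x = quad_form I M x + quad_form I N x"
  by (simp add: quad_form_def sum.distrib algebra_simps)

lemma quad_form_diff: "quad_form I (\<lambda>a b. M a b - N a b) x = quad_form I M x - quad_form I N x"
  by (simp add: quad_form_def sum_subtractf algebra_simps)

lemma quad_form_scale: "quad_form I (\<lambda>a b. s * M a b) x = s * quad_form I M x"
  by (simp add: quad_form_def sum_distrib_left mult_ac)

lemma quad_form_cong:
  "(\<And>a b. a \<in> I \<Longrightarrow> b \<in> I \<Longrightarrow> M a b = N a b) \<Longrightarrow> quad_form I M x = quad_form I N x"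
  by (simp add: quad_form_def)

lemma quad_form_sym_prod:
  "quad_form I (sym_prod P Q) x = 2 * (\<Sum>a\<in>I. P a * x a) * (\<Sum>b\<in>I. Q b * x b)"
proof -
  have "quad_form I (sym_prod P Q) x = quad_form I (\<lambda>a b. P a * Q b + Q a * P b) x"
    by (rule quad_form_cong) (simp add: sym_prod_def mult.commute)
  then show ?thesis by (simp add: quad_form_add quad_form_rank_one)
qed

text \<open>Pairing with a vector \<open>x\<close> turns the rank one matrices into squares that are
  quadratic in \<open>s\<close>, so the vanishing discriminant gives \<open>E\<close> up to sign at
  each \<open>x\<close>. The sign cannot vary with \<open>x\<close>: the product of the forms of
  \<open>E - sym_prod P B\<close> and \<open>E + sym_prod P B\<close> is zero, hence one of the two
  forms is zero.\<close>

lemma rank_one_progression: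
  fixes P B :: "'i \<Rightarrow> int"
  assumes fin: "finite I" and sym: "\<And>a b. a \<in> I \<Longrightarrow> b \<in> I \<Longrightarrow> E a b = E b a"
    and rank1: "\<And>s. \<exists>C. \<forall>a\<in>I. \<forall>b\<in>I. C a * C b = P a * P b + s * E a b + s\<^sup>2 * (B a * B b)"
  shows "\<exists>\<epsilon>. \<bar>\<epsilon>\<bar> = 1 \<and> (\<forall>a\<in>I. \<forall>b\<in>I. E a b = \<epsilon> * sym_prod P B a b)"
proof -
  have "(quad_form I E x)\<^sup>2 = (quad_form I (sym_prod P B) x)\<^sup>2" for x
  proof -
    define p where "p = (\<Sum>a\<in>I. P a * x a)"
    define q where "q = (\<Sum>a\<in>I. B a * x a)"
    have "\<exists>k. k\<^sup>2 = p\<^sup>2 + quad_form I E x * s + q\<^sup>2 * s\<^sup>2" for s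
    proof -
      obtain C where C: "\<forall>a\<in>I. \<forall>b\<in>I. C a * C b = P a * P b + s * E a b + s\<^sup>2 * (B a * B b)"
        using rank1 by blast
      have "(\<Sum>a\<in>I. C a * x a)\<^sup>2 = quad_form I (\<lambda>a b. C a * C b) x"
        by (simp add: quad_form_rank_one power2_eq_square)
      also have "\<dots> = quad_form I (\<lambda>a b. P a * P b + s * E a b + s\<^sup>2 * (B a * B b)) x"
        using C by (intro quad_form_cong) auto
      also have "\<dots> = p\<^sup>2 + quad_form I E x * s + q\<^sup>2 * s\<^sup>2"
        by (simp only: quad_form_add quad_form_scale quad_form_rank_one p_def q_def)
           (simp add: power2_eq_square)
      finally show ?thesis by blast
    qed
    from square_values_discriminant[OF this] show ?thesis
      by (simp add: quad_form_sym_prod p_def q_def power_mult_distrib)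
  qed
  then have *: "quad_form I (\<lambda>a b. E a b - sym_prod P B a b) x * quad_form I (\<lambda>a b. E a b + sym_prod P B a b) x = 0" for x
    by (simp only: quad_form_add quad_form_diff) (simp add: algebra_simps power2_eq_square)
  have sp: "sym_prod P B a b = sym_prod P B b a" for a b by (simp add: sym_prod_def)
  from quad_form_product_zero[OF *] show ?thesis
  proof
    assume "\<forall>x. quad_form I (\<lambda>a b. E a b - sym_prod P B a b) x = 0"
    then have "E a b - sym_prod P B a b = 0" if "a \<in> I" "b \<in> I" for a b
      using that by (intro quad_form_zero_imp[OF fin, of "\<lambda>a b. E a b - sym_prod P B a b"]) (metis sym sp, blast+)
    then show ?thesis by (intro exI[of _ 1]) simp
  next
    assume "\<forall>x. quad_form I (\<lambda>a b. E a b + sym_prod P B a b) x = 0"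
    then have "E a b + sym_prod P B a b = 0" if "a \<in> I" "b \<in> I" for a b
      using that by (intro quad_form_zero_imp[OF fin, of "\<lambda>a b. E a b + sym_prod P B a b"]) (metis sym sp, blast+)
    then show ?thesis by (intro exI[of _ "-1"]) (simp add: eq_neg_iff_add_eq_0)
  qed
qed

lemma sym_prod_nonzero:
  fixes P Q :: "'i \<Rightarrow> int"
  assumes "\<exists>a\<in>I. P a \<noteq> 0" "\<exists>a\<in>I. Q a \<noteq> 0"
  shows "\<exists>a\<in>I. \<exists>b\<in>I. sym_prod P Q a b \<noteq> 0"
proof (rule ccontr)
  assume "\<not> ?thesis"
  then have z: "P a * Q b + P b * Q a = 0" if "a \<in> I" "b \<in> I" for a b
    using that by (auto simp: sym_prod_def)
  obtain a b where a: "a \<in> I" "P a \<noteq> 0" and b: "b \<in> I" "Q b \<noteq> 0" using assms by blast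
  have "P a * Q a + P a * Q a = 0" using z[OF a(1) a(1)] .
  then have "Q a = 0" using a(2) by simp
  then show False using z[OF a(1) b(1)] a b by simp
qed

text \<open>This is the cocycle rule for the signs between three vectors. If \<open>e = e13\<close>,
  the terms with \<open>P\<close> cancel and the rest forces \<open>e23 = e * e12\<close>. Otherwise
  the terms with \<open>P\<close> do not cancel, which forces \<open>e23 = - e * e12\<close>. Both
  cases give the claim.\<close>

lemma sign_triple:
  fixes P Q R :: "'i \<Rightarrow> int" and e12 e13 e23 e :: int
  assumes "\<exists>a\<in>I. P a \<noteq> 0" "\<exists>a\<in>I. Q a \<noteq> 0" "\<exists>a\<in>I. R a \<noteq> 0"
    and "\<bar>e12\<bar> = 1" "\<bar>e13\<bar> = 1" "\<bar>e23\<bar> = 1" "\<bar>e\<bar> = 1"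
    and eq: "\<And>a b. a \<in> I \<Longrightarrow> b \<in> I \<Longrightarrow>
       e * (sym_prod P R a b + e12 * sym_prod Q R a b) = e13 * sym_prod P R a b + e23 * sym_prod Q R a b"
  shows "e13 = e12 * e23"
proof -
  obtain a b where ab: "a \<in> I" "b \<in> I" "sym_prod P R a b \<noteq> 0"
    using sym_prod_nonzero[OF assms(1,3)] by blast
  obtain c d where cd: "c \<in> I" "d \<in> I" "sym_prod Q R c d \<noteq> 0"
    using sym_prod_nonzero[OF assms(2,3)] by blast
  have *: "e12 = 1 \<or> e12 = -1" "e13 = 1 \<or> e13 = -1" "e23 = 1 \<or> e23 = -1" "e = 1 \<or> e = -1"
    using assms(4-7) by linarith+
  show ?thesis
    using * eq[OF ab(1,2)] eq[OF cd(1,2)] ab(3) cd(3)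
    by (elim disjE) (simp_all add: algebra_simps)
qed

text \<open>Indexing by list positions lets explicit relations be written entry by entry, even if
  some of the coefficient vectors coincide.\<close>

lemma gram_independent_list_relation:
  fixes h :: "'i \<Rightarrow> 'v::real_inner" and ts :: "(int \<times> ('i \<Rightarrow> int)) list"
  assumes "gram_independent I h"
    and "(\<Sum>p\<leftarrow>ts. of_int (fst p) * (norm (int_comb I h (snd p)))\<^sup>2) = 0"
    and "a \<in> I" "b \<in> I"
  shows "(\<Sum>p\<leftarrow>ts. fst p * (snd p a * snd p b)) = 0"
proof -
  have "(\<Sum>j\<in>{0..<length ts}. fst (ts ! j) * (snd (ts ! j) a * snd (ts ! j) b)) = 0"
    using assms(2) by (intro gram_independent_relation[OF assms(1) _ assms(3,4)]) (simp add: sum_list_sum_nth)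
  then show ?thesis by (simp add: sum_list_sum_nth)
qed

text \<open>Polarising the lengths: the length of every \<open>z + s \<mu>\<close> is that of an integer combination, so
  by independence the rank one matrix of its coefficient vector is a quadratic polynomial in \<open>s\<close>.\<close>

lemma distance_structure:
  fixes h :: "'i \<Rightarrow> 'v::real_inner" and \<Delta> L :: "'w::real_inner set" and w :: "'k \<Rightarrow> 'w"
  assumes fin: "finite I" and gi: "gram_independent I h"
    and sub: "L \<subseteq> \<Delta>" and addD: "\<And>z \<mu>. z \<in> \<Delta> \<Longrightarrow> \<mu> \<in> L \<Longrightarrow> z + \<mu> \<in> \<Delta>"
    and addL: "\<And>\<mu> \<nu>. \<mu> \<in> L \<Longrightarrow> \<nu> \<in> L \<Longrightarrow> \<mu> + \<nu> \<in> L"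
    and scaleL: "\<And>\<mu> s. \<mu> \<in> L \<Longrightarrow> real_of_int s *\<^sub>R \<mu> \<in> L"
    and typ_neg: "\<And>c. Typ c \<Longrightarrow> Typ (\<lambda>a. - c a)"
    and dist: "\<And>z. z \<in> \<Delta> \<Longrightarrow> \<exists>c. Typ c \<and> norm z = norm (int_comb I h c)"
    and w: "\<And>k. w k \<in> L" "\<And>k. w k \<noteq> 0"
  shows "\<exists>B c. (\<forall>k. Typ (B k) \<and> (\<exists>c'. Typ c' \<and> (\<forall>a\<in>I. c' a = 2 * B k a))) \<and>
     (\<forall>k l. w k \<bullet> w l = int_comb I h (B k) \<bullet> int_comb I h (B l)) \<and>
     (\<forall>z\<in>\<Delta>. Typ (c z) \<and> norm z = norm (int_comb I h (c z)) \<and>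
        (\<forall>k. z \<bullet> w k = int_comb I h (c z) \<bullet> int_comb I h (B k)))"
proof -
  obtain C where C: "\<And>z. z \<in> \<Delta> \<Longrightarrow> Typ (C z)" "\<And>z. z \<in> \<Delta> \<Longrightarrow> norm (int_comb I h (C z)) = norm z"
    using dist by metis
  \<comment> \<open>The mixed part of the rank one matrix of \<open>z + \<mu>\<close>; paired with
    the inner products of \<open>h\<close> it gives \<open>2 * (z \<bullet> \<mu>)\<close>.\<close>
  define E where "E = (\<lambda>z \<mu> a b. C (z + \<mu>) a * C (z + \<mu>) b - C z a * C z b - C \<mu> a * C \<mu> b)"
  have inD: "\<mu> \<in> \<Delta>" if "\<mu> \<in> L" for \<mu> using that sub by blast
  have progression: "C (z + real_of_int s *\<^sub>R \<mu>) a * C (z + real_of_int s *\<^sub>R \<mu>) b =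
      C z a * C z b + s * E z \<mu> a b + s\<^sup>2 * (C \<mu> a * C \<mu> b)"
    if z: "z \<in> \<Delta>" and \<mu>: "\<mu> \<in> L" and ab: "a \<in> I" "b \<in> I" for z \<mu> s a b
  proof -
    \<comment> \<open>Interpolation: a quadratic in \<open>s\<close> with known leading coefficient,
      the squared length of \<open>\<mu>\<close>, is determined by its values at 0 and 1.\<close>
    have "(norm (z + real_of_int s *\<^sub>R \<mu>))\<^sup>2 + (of_int s - 1) * (norm z)\<^sup>2 - of_int s * (norm (z + \<mu>))\<^sup>2
        + (of_int s - (of_int s)\<^sup>2) * (norm \<mu>)\<^sup>2 = 0"
      unfolding power2_norm_eq_inner
      by (simp add: inner_add_left inner_add_right algebra_simps power2_eq_square inner_commute)
    then have "(\<Sum>p\<leftarrow>[(1, C (z + real_of_int s *\<^sub>R \<mu>)), (s - 1, C z), (- s, C (z + \<mu>)), (s - s\<^sup>2, C \<mu>)].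
        of_int (fst p) * (norm (int_comb I h (snd p)))\<^sup>2) = 0"
      unfolding list.map sum_list.Cons fst_conv snd_conv C(2)[OF z] C(2)[OF addD[OF z \<mu>]] C(2)[OF inD[OF \<mu>]]
        C(2)[OF addD[OF z scaleL[OF \<mu>]]] by simp
    from gram_independent_list_relation[OF gi this ab]
    show ?thesis by (simp add: E_def algebra_simps)
  qed
  have E_sym: "E z \<mu> a b = E z \<mu> b a" for z \<mu> a b by (simp add: E_def mult.commute)
  have "\<exists>e. \<bar>e\<bar> = 1 \<and> (\<forall>a\<in>I. \<forall>b\<in>I. E z \<mu> a b = e * sym_prod (C z) (C \<mu>) a b)"
    if z: "z \<in> \<Delta>" and \<mu>: "\<mu> \<in> L" for z \<mu>
  proof (rule rank_one_progression[OF fin])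
    show "E z \<mu> a b = E z \<mu> b a" for a b by (rule E_sym)
    show "\<exists>D. \<forall>a\<in>I. \<forall>b\<in>I. D a * D b = C z a * C z b + s * E z \<mu> a b + s\<^sup>2 * (C \<mu> a * C \<mu> b)" for s
      using progression[OF z \<mu>] by blast
  qed
  then obtain e where e1: "\<And>z \<mu>. z \<in> \<Delta> \<Longrightarrow> \<mu> \<in> L \<Longrightarrow> \<bar>e z \<mu>\<bar> = 1"
    and e2: "\<And>z \<mu> a b. z \<in> \<Delta> \<Longrightarrow> \<mu> \<in> L \<Longrightarrow> a \<in> I \<Longrightarrow> b \<in> I \<Longrightarrow> E z \<mu> a b = e z \<mu> * sym_prod (C z) (C \<mu>) a b"
    by metis
  have C_nz: "\<exists>a\<in>I. C z a \<noteq> 0" if "z \<in> \<Delta>" "z \<noteq> 0" for z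
  proof (rule ccontr)
    assume "\<not> ?thesis"
    then have "int_comb I h (C z) = 0" by (simp add: int_comb_def)
    then show False using C(2)[OF that(1)] that(2) by simp
  qed
  have triple: "e z \<nu> = e z \<mu> * e \<mu> \<nu>"
    if z: "z \<in> \<Delta>" "z \<noteq> 0" and \<mu>: "\<mu> \<in> L" "\<mu> \<noteq> 0" and \<nu>: "\<nu> \<in> L" "\<nu> \<noteq> 0" for z \<mu> \<nu>
  proof -
    have z\<mu>: "z + \<mu> \<in> \<Delta>" using addD z \<mu> by blast
    have sq: "C (z + \<mu>) a * C (z + \<mu>) b = (C z a + e z \<mu> * C \<mu> a) * (C z b + e z \<mu> * C \<mu> b)"
      if "a \<in> I" "b \<in> I" for a b
    proof -
      have "e z \<mu> * e z \<mu> = 1" using e1[OF z(1) \<mu>(1)] by (metis abs_mult_self_eq mult_1)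
      then have "e z \<mu> * (e z \<mu> * x) = x" for x by (simp add: mult.assoc[symmetric])
      then show ?thesis
        using e2[OF z(1) \<mu>(1) that] by (simp add: E_def sym_prod_def algebra_simps)
    qed
    \<comment> \<open>\<open>C (z + \<mu>)\<close> was chosen independently of \<open>C z\<close>
      and \<open>C \<mu>\<close>, so it is their signed sum only up to a further sign, absorbed into
      the auxiliary sign \<open>e\<close> of \<open>sign_triple\<close>.\<close>
    obtain \<sigma> :: int where \<sigma>: "\<bar>\<sigma>\<bar> = 1" "\<And>a. a \<in> I \<Longrightarrow> C (z + \<mu>) a = \<sigma> * (C z a + e z \<mu> * C \<mu> a)"
      using rank_one_eq_imp_eq_or_minus[of I "C (z + \<mu>)" "\<lambda>a. C z a + e z \<mu> * C \<mu> a", OF sq]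
      by (metis abs_1 abs_minus mult_1 mult_minus1)
    \<comment> \<open>The third difference of the squared length is zero. In terms of matrices,
      \<open>E\<close> is additive in its first argument.\<close>
    have "(norm (z + \<mu> + \<nu>))\<^sup>2 - (norm (z + \<mu>))\<^sup>2 - (norm (z + \<nu>))\<^sup>2 - (norm (\<mu> + \<nu>))\<^sup>2
        + (norm z)\<^sup>2 + (norm \<mu>)\<^sup>2 + (norm \<nu>)\<^sup>2 = 0"
      unfolding power2_norm_eq_inner
      by (simp add: inner_add_left inner_add_right algebra_simps inner_commute)
    then have *: "(\<Sum>p\<leftarrow>[(1, C (z + \<mu> + \<nu>)), (-1, C (z + \<mu>)), (-1, C (z + \<nu>)), (-1, C (\<mu> + \<nu>)),
        (1, C z), (1, C \<mu>), (1, C \<nu>)]. of_int (fst p) * (norm (int_comb I h (snd p)))\<^sup>2) = 0"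
      using C(2) z \<mu> \<nu> addD addL inD by simp
    have EE: "E (z + \<mu>) \<nu> a b = E z \<nu> a b + E \<mu> \<nu> a b" if "a \<in> I" "b \<in> I" for a b
      using gram_independent_list_relation[OF gi * that] by (simp add: E_def)
    show ?thesis
    proof (rule sign_triple[OF C_nz[OF z] C_nz[OF inD[OF \<mu>(1)] \<mu>(2)] C_nz[OF inD[OF \<nu>(1)] \<nu>(2)]])
      show "\<bar>e (z + \<mu>) \<nu> * \<sigma>\<bar> = 1" using \<sigma> e1[OF z\<mu> \<nu>(1)] by (simp add: abs_mult)
      show "e (z + \<mu>) \<nu> * \<sigma> * (sym_prod (C z) (C \<nu>) a b + e z \<mu> * sym_prod (C \<mu>) (C \<nu>) a b) =
          e z \<nu> * sym_prod (C z) (C \<nu>) a b + e \<mu> \<nu> * sym_prod (C \<mu>) (C \<nu>) a b"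
        if ab: "a \<in> I" "b \<in> I" for a b
        using EE[OF ab] e2[OF z\<mu> \<nu>(1) ab] e2[OF z(1) \<nu>(1) ab] e2[OF inD[OF \<mu>(1)] \<nu>(1) ab] \<sigma>(2) ab
        by (simp add: sym_prod_def algebra_simps)
    qed (use e1 z \<mu> \<nu> inD in auto)
  qed
  have inner_E: "2 * (z \<bullet> \<mu>) = (\<Sum>a\<in>I. \<Sum>b\<in>I. of_int (E z \<mu> a b) * (h a \<bullet> h b))"
    if "z \<in> \<Delta>" "\<mu> \<in> L" for z \<mu>
  proof -
    have "2 * (z \<bullet> \<mu>) = (norm (z + \<mu>))\<^sup>2 - (norm z)\<^sup>2 - (norm \<mu>)\<^sup>2"
      unfolding power2_norm_eq_inner by (simp add: inner_add_left inner_add_right inner_commute)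
    also have "\<dots> = (norm (int_comb I h (C (z + \<mu>))))\<^sup>2 - (norm (int_comb I h (C z)))\<^sup>2
        - (norm (int_comb I h (C \<mu>)))\<^sup>2"
      using that C(2) addD inD by simp
    finally show ?thesis
      by (simp add: norm_int_comb_sq E_def sum_subtractf[symmetric] left_diff_distrib)
  qed
  have inner_sym_prod: "(\<Sum>a\<in>I. \<Sum>b\<in>I. of_int (sym_prod P Q a b) * (h a \<bullet> h b))
      = 2 * (int_comb I h P \<bullet> int_comb I h Q)" for P Q
  proof -
    have "(\<Sum>a\<in>I. \<Sum>b\<in>I. of_int (sym_prod P Q a b) * (h a \<bullet> h b)) =
        int_comb I h P \<bullet> int_comb I h Q + int_comb I h Q \<bullet> int_comb I h P"
      unfolding inner_int_comb sum.distrib[symmetric] sym_prod_def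
      by (intro sum.cong refl) (simp add: algebra_simps)
    then show ?thesis by (simp add: inner_commute)
  qed
  have inner_e: "z \<bullet> \<mu> = of_int (e z \<mu>) * (int_comb I h (C z) \<bullet> int_comb I h (C \<mu>))"
    if "z \<in> \<Delta>" "\<mu> \<in> L" for z \<mu>
  proof -
    have "2 * (z \<bullet> \<mu>) = of_int (e z \<mu>) * (\<Sum>a\<in>I. \<Sum>b\<in>I. of_int (sym_prod (C z) (C \<mu>) a b) * (h a \<bullet> h b))"
      using inner_E[OF that] e2[OF that] by (simp add: sum_distrib_left mult.assoc)
    then show ?thesis by (simp add: inner_sym_prod)
  qed
  fix k0 :: 'k
  \<comment> \<open>Each coefficient vector is multiplied by its sign relative to the fixed vector
    \<open>w k0\<close>. By the cocycle rule \<open>triple\<close>, the inner products with all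
    \<open>w k\<close> then need no signs any more.\<close>
  define B where "B = (\<lambda>k a. e (w k0) (w k) * C (w k) a)"
  define c where "c = (\<lambda>z a. e z (w k0) * C z a)"
  have sq1: "x * x = 1" if "\<bar>x\<bar> = 1" for x :: int
    using that by (metis abs_mult_self_eq mult_1)
  have typ_sign: "Typ (\<lambda>a. s * d a)" if "Typ d" "\<bar>s\<bar> = 1" for s :: int and d
    using that typ_neg[of d] by (cases "s = 1") (auto simp: abs_if split: if_splits)
  have h_sign: "int_comb I h (\<lambda>a. s * d a) = of_int s *\<^sub>R int_comb I h d" for s d
    by (rule int_comb_scale)
  have wD: "w k \<in> \<Delta>" for k using w inD by blast
  have ww: "e (w k) (w l) = e (w k0) (w k) * e (w k0) (w l)" for k l
  proof -
    have "e (w k0) (w l) = e (w k0) (w k) * e (w k) (w l)"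
      using triple[OF wD w(2) w w] by blast
    then show ?thesis using sq1[OF e1[OF wD w(1)], of k0 k] by (metis mult.assoc mult_1)
  qed
  have e00: "e (w k0) (w k0) = 1"
    using ww[of k0 k0] sq1[OF e1[OF wD w(1)], of k0 k0] by simp
  have "Typ (B k)" for k
    unfolding B_def by (rule typ_sign[OF C(1)[OF wD] e1[OF wD w(1)]])
  moreover have "\<exists>c'. Typ c' \<and> (\<forall>a\<in>I. c' a = 2 * B k a)" for k
  proof -
    \<comment> \<open>The double of \<open>w k\<close> lies in \<open>L\<close> again, so its length
      is attained by admissible coefficients, which must be \<open>2 * B k\<close> up to sign. This
      is what later excludes a motif part in \<open>B k\<close>.\<close>
    have 2: "real_of_int 2 *\<^sub>R w k \<in> \<Delta>" using scaleL[OF w(1)] inD by blast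
    have "C (real_of_int 2 *\<^sub>R w k) a * C (real_of_int 2 *\<^sub>R w k) b = (2 * B k a) * (2 * B k b)"
      if "a \<in> I" "b \<in> I" for a b
    proof -
      have "(\<Sum>p\<leftarrow>[(1, C (real_of_int 2 *\<^sub>R w k)), (-4, C (w k))].
          of_int (fst p) * (norm (int_comb I h (snd p)))\<^sup>2) = 0"
        using C(2)[OF 2] C(2)[OF wD] by (simp add: power_mult_distrib)
      from gram_independent_list_relation[OF gi this that] show ?thesis
        unfolding B_def using sq1[OF e1[OF wD w(1)], of k0 k]
        by (simp add: algebra_simps)
    qed
    then have "(\<forall>a\<in>I. C (real_of_int 2 *\<^sub>R w k) a = 2 * B k a) \<or>
        (\<forall>a\<in>I. C (real_of_int 2 *\<^sub>R w k) a = - (2 * B k a))"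
      by (rule rank_one_eq_imp_eq_or_minus)
    then show ?thesis
    proof
      assume "\<forall>a\<in>I. C (real_of_int 2 *\<^sub>R w k) a = 2 * B k a"
      then show ?thesis using C(1)[OF 2] by blast
    next
      assume "\<forall>a\<in>I. C (real_of_int 2 *\<^sub>R w k) a = - (2 * B k a)"
      then show ?thesis using typ_neg[OF C(1)[OF 2]]
        by (intro exI[of _ "\<lambda>a. - C (real_of_int 2 *\<^sub>R w k) a"]) simp
    qed
  qed
  moreover have "w k \<bullet> w l = int_comb I h (B k) \<bullet> int_comb I h (B l)" for k l
    using inner_e[OF wD w(1), of k l] ww[of k l] by (simp add: B_def h_sign)
  moreover have "Typ (c z)" if "z \<in> \<Delta>" for z
    unfolding c_def by (rule typ_sign[OF C(1)[OF that] e1[OF that w(1)]])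
  moreover have "norm z = norm (int_comb I h (c z))" if "z \<in> \<Delta>" for z
  proof -
    have "\<bar>real_of_int (e z (w k0))\<bar> = 1" using e1[OF that w(1), of k0] by (metis of_int_1 of_int_abs)
    then show ?thesis unfolding c_def h_sign using C(2)[OF that] by simp
  qed
  moreover have "z \<bullet> w k = int_comb I h (c z) \<bullet> int_comb I h (B k)" if "z \<in> \<Delta>" for z k
  proof (cases "z = 0")
    case True
    then have "int_comb I h (C z) = 0" using C(2)[OF that] by simp
    then show ?thesis using True by (simp add: c_def h_sign)
  next
    case False
    have "e z (w k) = e z (w k0) * e (w k0) (w k)"
      by (rule triple[OF that False w w])
    then show ?thesis using inner_e[OF that w(1), of k] by (simp add: c_def B_def h_sign)
  qed
  ultimately show ?thesis by blast
qed

section \<open>Lattices and unit cells\<close>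

text \<open>Coefficients are collected in a vector, so that being a basis becomes injectivity of a
  linear map between equal spaces and the usual linear algebra applies.\<close>

definition basis_comb :: "real^3^3 \<Rightarrow> real^3 \<Rightarrow> real^3" where
  "basis_comb v r = (\<Sum>i\<in>UNIV. r $ i *\<^sub>R v $ i)"

definition lattice_vec :: "real^3^3 \<Rightarrow> (3 \<Rightarrow> int) \<Rightarrow> real^3" where
  "lattice_vec v n = (\<Sum>i\<in>UNIV. real_of_int (n i) *\<^sub>R v $ i)"

lemma lattice_vec_eq: "lattice_vec v n = basis_comb v (\<chi> i. real_of_int (n i))"
  by (simp add: lattice_vec_def basis_comb_def)

lemma linear_basis_comb: "linear (basis_comb v)"
  by (rule linearI) (simp_all add: basis_comb_def scaleR_left_distrib sum.distrib scaleR_sum_right)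

lemma inj_basis_comb:
  assumes "is_basis v" shows "inj (basis_comb v)"
proof -
  have ind: "independent (range (\<lambda>i. v $ i))" and inj: "inj (\<lambda>i. v $ i)"
    using assms by (auto simp: is_basis_def)
  show ?thesis unfolding linear_injective_0[OF linear_basis_comb]
  proof (intro allI impI)
    fix r assume "basis_comb v r = 0"
    define u where "u = (\<lambda>x. r $ (inv (\<lambda>i. v $ i) x))"
    have "(\<Sum>x\<in>range (\<lambda>i. v $ i). u x *\<^sub>R x) = basis_comb v r"
      unfolding basis_comb_def u_def by (subst sum.reindex[OF inj]) (simp add: inj)
    then have "u x = 0" if "x \<in> range (\<lambda>i. v $ i)" for x
      using independentD[OF ind, of "range (\<lambda>i. v $ i)" u x] that \<open>basis_comb v r = 0\<close> by simp
    then have "r $ i = 0" for i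
      using inj by (metis inv_f_f rangeI u_def)
    then show "r = 0" by (simp add: vec_eq_iff)
  qed
qed

lemma is_basis_if_inj:
  assumes "inj (basis_comb v)" shows "is_basis v"
proof -
  have bc: "basis_comb v (axis i 1) = v $ i" for i
    by (simp add: basis_comb_def axis_def if_distrib[of "\<lambda>a. a *\<^sub>R _"] cong: if_cong)
  have inj: "inj (\<lambda>i. v $ i)"
    by (rule injI) (metis assms bc axis_eq_axis injD zero_neq_one)
  have "independent (basis_comb v ` Basis)"
    using assms by (intro linear_independent_injective_image[OF linear_basis_comb])
       (auto simp: independent_Basis intro: inj_on_subset)
  moreover have "basis_comb v ` Basis = range (\<lambda>i. v $ i)"
    by (auto simp: Basis_vec_def bc image_iff)
  ultimately show ?thesis using inj by (simp add: is_basis_def)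
qed

lemma surj_basis_comb: "is_basis v \<Longrightarrow> surj (basis_comb v)"
  using linear_inj_imp_surj[OF linear_basis_comb inj_basis_comb] .

lemma basis_comb_lower_bound:
  assumes "is_basis v"
  obtains c where "c > 0" "\<And>r. norm (basis_comb v r) \<ge> c * norm r"
  using linear_inj_bounded_below_pos[OF linear_basis_comb inj_basis_comb[OF assms]] by metis

definition coords :: "real^3^3 \<Rightarrow> real^3 \<Rightarrow> real^3" where
  "coords v = inv (basis_comb v)"

lemma basis_comb_coords [simp]: "is_basis v \<Longrightarrow> basis_comb v (coords v x) = x"
  by (simp add: coords_def surj_f_inv_f surj_basis_comb)

lemma coords_basis_comb [simp]: "is_basis v \<Longrightarrow> coords v (basis_comb v r) = r"
  by (simp add: coords_def inj_basis_comb)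

lemma linear_coords: assumes "is_basis v" shows "linear (coords v)"
proof -
  obtain g where g: "linear g" "g \<circ> basis_comb v = id"
    using linear_injective_left_inverse[OF linear_basis_comb inj_basis_comb[OF assms]] by blast
  have "coords v x = g x" for x
    using g(2) basis_comb_coords[OF assms, of x] by (metis comp_apply id_apply)
  then have "coords v = g" by auto
  then show ?thesis using g(1) by simp
qed

lemma coords_lattice_vec [simp]: "is_basis v \<Longrightarrow> coords v (lattice_vec v n) = (\<chi> i. real_of_int (n i))"
  by (simp add: lattice_vec_eq)

lemma lattice_of_eq: "lattice_of v = range (lattice_vec v)"
  by (auto simp: lattice_of_def lattice_vec_def)

lemma lattice_vec_add: "lattice_vec v n + lattice_vec v n' = lattice_vec v (\<lambda>i. n i + n' i)"
  by (simp add: lattice_vec_def sum.distrib scaleR_left_distrib)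

lemma lattice_vec_minus: "- lattice_vec v n = lattice_vec v (\<lambda>i. - n i)"
  by (simp add: lattice_vec_def sum_negf)

lemma lattice_vec_scale: "real_of_int s *\<^sub>R lattice_vec v n = lattice_vec v (\<lambda>i. s * n i)"
  by (simp add: lattice_vec_def scaleR_sum_right)

lemma lattice_add: "x \<in> lattice_of v \<Longrightarrow> y \<in> lattice_of v \<Longrightarrow> x + y \<in> lattice_of v"
  by (auto simp: lattice_of_eq lattice_vec_add)

lemma lattice_minus: "x \<in> lattice_of v \<Longrightarrow> - x \<in> lattice_of v"
  by (auto simp: lattice_of_eq lattice_vec_minus)

lemma lattice_scale: "x \<in> lattice_of v \<Longrightarrow> real_of_int s *\<^sub>R x \<in> lattice_of v"
  by (auto simp: lattice_of_eq lattice_vec_scale)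

lemma lattice_0 [simp]: "0 \<in> lattice_of v"
  unfolding lattice_of_eq by (rule range_eqI[of _ _ "\<lambda>_. 0"]) (simp add: lattice_vec_def)

lemma lattice_vec_basis: "v $ k = lattice_vec v (\<lambda>i. if i = k then 1 else 0)"
proof -
  have "real_of_int (if i = k then 1 else 0) *\<^sub>R v $ i = (if i = k then v $ i else 0)" for i by simp
  then show ?thesis by (simp add: lattice_vec_def)
qed

lemma basis_in_lattice: "v $ k \<in> lattice_of v"
  unfolding lattice_of_eq by (subst lattice_vec_basis) blast

lemma basis_vec_nonzero: assumes "is_basis v" shows "v $ k \<noteq> 0"
  using assms dependent_zero[of "range (\<lambda>i. v $ i)"] unfolding is_basis_def by (metis rangeI)

lemma countable_lattice: "countable (lattice_of v)"
  unfolding lattice_of_eq by simp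

lemma unit_cell_eq:
  assumes "is_basis v"
  shows "unit_cell v = {x. \<forall>i. 0 \<le> coords v x $ i \<and> coords v x $ i < 1}"
proof (intro set_eqI iffI)
  fix x assume "x \<in> unit_cell v"
  then obtain r where r: "\<forall>i. 0 \<le> r i \<and> r i < 1" "x = basis_comb v (\<chi> i. r i)"
    by (auto simp: unit_cell_def basis_comb_def)
  then show "x \<in> {x. \<forall>i. 0 \<le> coords v x $ i \<and> coords v x $ i < 1}" using assms by simp
next
  fix x assume x: "x \<in> {x. \<forall>i. 0 \<le> coords v x $ i \<and> coords v x $ i < 1}"
  have "x = (\<Sum>i\<in>UNIV. (coords v x $ i) *\<^sub>R v $ i)"
    using basis_comb_coords[OF assms, of x] by (simp add: basis_comb_def)
  then show "x \<in> unit_cell v" unfolding unit_cell_def using x by blast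
qed

text \<open>The floors of the coordinates give the translation, and two integer shifts of a real
  number into \<open>[0, 1)\<close> coincide.\<close>

lemma lattice_translate_unique:
  assumes "is_basis v"
  shows "\<exists>!w. w \<in> lattice_of v \<and> x + w \<in> unit_cell v"
proof (rule ex_ex1I)
  define n where "n = (\<lambda>i. - \<lfloor>coords v x $ i\<rfloor>)"
  have *: "coords v (x + lattice_vec v n) $ i = coords v x $ i + real_of_int (n i)" for i
    using assms by (simp add: linear_add[OF linear_coords])
  then have "0 \<le> coords v (x + lattice_vec v n) $ i \<and> coords v (x + lattice_vec v n) $ i < 1" for i
    using *[of i] unfolding n_def of_int_minus by linarith
  then have "x + lattice_vec v n \<in> unit_cell v"
    unfolding unit_cell_eq[OF assms] by blast
  then show "\<exists>w. w \<in> lattice_of v \<and> x + w \<in> unit_cell v" by (auto simp: lattice_of_eq)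
next
  fix w w' assume w: "w \<in> lattice_of v \<and> x + w \<in> unit_cell v" and w': "w' \<in> lattice_of v \<and> x + w' \<in> unit_cell v"
  then obtain n n' where n: "w = lattice_vec v n" "w' = lattice_vec v n'" by (auto simp: lattice_of_eq)
  have "n i = n' i" for i
  proof -
    have *: "0 \<le> coords v x $ i + real_of_int (m i) \<and> coords v x $ i + real_of_int (m i) < 1"
      if "x + lattice_vec v m \<in> unit_cell v" for m
    proof -
      have "coords v (x + lattice_vec v m) $ i = coords v x $ i + real_of_int (m i)"
        using assms by (simp add: linear_add[OF linear_coords])
      moreover have "0 \<le> coords v (x + lattice_vec v m) $ i \<and> coords v (x + lattice_vec v m) $ i < 1"
        using that unfolding unit_cell_eq[OF assms] by blast
      ultimately show ?thesis by linarith
    qed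
    have cell: "x + lattice_vec v n \<in> unit_cell v" "x + lattice_vec v n' \<in> unit_cell v"
      using w w' n by simp_all
    have "0 \<le> coords v x $ i + real_of_int (n i) \<and> coords v x $ i + real_of_int (n i) < 1"
      "0 \<le> coords v x $ i + real_of_int (n' i) \<and> coords v x $ i + real_of_int (n' i) < 1"
      using *[OF cell(1)] *[OF cell(2)] by blast+
    then show ?thesis by linarith
  qed
  then show "w = w'" using n by (metis ext)
qed

lemma lattice_translate_unique2:
  assumes "is_basis v" "x \<in> unit_cell v" "y \<in> unit_cell v" "x - y \<in> lattice_of v"
  shows "x = y"
proof -
  have "x = y + (x - y)" by simp
  then have "x - y = 0"
    using lattice_translate_unique[OF assms(1), of y] assms lattice_0[of v] by (metis add.right_neutral)
  then show ?thesis by simp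
qed

lemma unit_cell_subset_ball:
  obtains c where "c > 0" "unit_cell v \<subseteq> ball 0 c"
proof
  show "(\<Sum>i\<in>UNIV. norm (v $ i)) + 1 > 0" by (simp add: add_nonneg_pos sum_nonneg)
  show "unit_cell v \<subseteq> ball 0 ((\<Sum>i\<in>UNIV. norm (v $ i)) + 1)"
  proof
    fix x assume "x \<in> unit_cell v"
    then obtain r where r: "\<forall>i. 0 \<le> r i \<and> r i < 1" and x: "x = (\<Sum>i\<in>UNIV. r i *\<^sub>R v $ i)"
      by (auto simp: unit_cell_def)
    have "norm x \<le> (\<Sum>i\<in>UNIV. norm (r i *\<^sub>R v $ i))" unfolding x by (rule norm_sum)
    also have "\<dots> \<le> (\<Sum>i\<in>UNIV. norm (v $ i))"
      using r by (intro sum_mono) (simp add: mult_left_le_one_le abs_of_nonneg less_imp_le)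
    finally show "x \<in> ball 0 ((\<Sum>i\<in>UNIV. norm (v $ i)) + 1)" by simp
  qed
qed

lemma continuous_coords: "is_basis v \<Longrightarrow> continuous_on S (coords v)"
  by (simp add: linear_continuous_on linear_coords linear_linear)

lemma unit_cell_borel [measurable]:
  assumes "is_basis v" shows "unit_cell v \<in> sets borel"
proof -
  have [measurable]: "(\<lambda>x. coords v x $ i) \<in> borel_measurable borel" for i
    using continuous_coords[OF assms] by (intro borel_measurable_continuous_onI continuous_intros)
  have "unit_cell v = {x \<in> space borel. \<forall>i. 0 \<le> coords v x $ i \<and> coords v x $ i < 1}"
    using unit_cell_eq[OF assms] by simp
  also have "\<dots> \<in> sets borel" by measurable
  finally show ?thesis .
qed

lemma finite_int_box: "finite {n :: 3 \<Rightarrow> int. \<forall>i. \<bar>n i\<bar> \<le> N}"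
proof -
  have "{n :: 3 \<Rightarrow> int. \<forall>i. \<bar>n i\<bar> \<le> N} \<subseteq> PiE UNIV (\<lambda>_. {-N..N})"
    by (auto simp: abs_le_iff) (metis minus_le_iff)
  then show ?thesis by (rule finite_subset) (intro finite_PiE, auto)
qed

lemma finite_lattice_ball:
  assumes "is_basis v" shows "finite (lattice_of v \<inter> cball c R)"
proof -
  obtain e where e: "e > 0" "\<And>r. norm (basis_comb v r) \<ge> e * norm r"
    using basis_comb_lower_bound[OF assms] by blast
  define N where "N = \<lceil>(norm c + R) / e\<rceil>"
  have "lattice_of v \<inter> cball c R \<subseteq> lattice_vec v ` {n. \<forall>i. \<bar>n i\<bar> \<le> N}"
  proof
    fix x assume x: "x \<in> lattice_of v \<inter> cball c R"
    then obtain n where n: "x = lattice_vec v n" by (auto simp: lattice_of_eq)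
    have "norm x \<le> norm c + R" using x
      by simp (metis add_left_mono dist_norm norm_minus_commute norm_triangle_sub order_trans)
    then have "e * norm (\<chi> i. real_of_int (n i)) \<le> norm c + R"
      using e(2) n unfolding lattice_vec_eq by (metis order_trans)
    then have *: "norm (\<chi> i. real_of_int (n i)) \<le> (norm c + R) / e"
      using e(1) by (simp add: field_simps)
    have "\<bar>n i\<bar> \<le> N" for i
    proof -
      have "\<bar>real_of_int (n i)\<bar> \<le> norm (\<chi> i. real_of_int (n i))"
        using component_le_norm_cart[of "\<chi> i. real_of_int (n i)" i] by simp
      then show ?thesis using * unfolding N_def by linarith
    qed
    then show "x \<in> lattice_vec v ` {n. \<forall>i. \<bar>n i\<bar> \<le> N}" using n by blast
  qed
  then show ?thesis using finite_int_box finite_surj by blast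
qed

section \<open>Lattice-invariant sets and changes of lattice\<close>

definition lattice_invariant :: "real^3^3 \<Rightarrow> (real^3) set \<Rightarrow> bool" where
  "lattice_invariant v S \<longleftrightarrow> (\<forall>w\<in>lattice_of v. \<forall>x. x + w \<in> S \<longleftrightarrow> x \<in> S)"

lemma lattice_invariantI:
  assumes "\<And>x w. x \<in> S \<Longrightarrow> w \<in> lattice_of v \<Longrightarrow> x + w \<in> S"
  shows "lattice_invariant v S"
  unfolding lattice_invariant_def
proof (intro ballI allI iffI)
  fix w x assume w: "w \<in> lattice_of v" and "x + w \<in> S"
  then have "(x + w) + (- w) \<in> S" using assms lattice_minus by blast
  then show "x \<in> S" by simp
qed (use assms in blast)

lemma lattice_invariantD: "lattice_invariant v S \<Longrightarrow> w \<in> lattice_of v \<Longrightarrow> x + w \<in> S \<longleftrightarrow> x \<in> S"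
  by (simp add: lattice_invariant_def)

lemma lattice_invariant_motif_translates: "lattice_invariant v (motif_translates v M)"
  by (rule lattice_invariantI) (auto simp: motif_translates_def add.assoc, use lattice_add in blast)

lemma represents_invariant: "represents v M A \<Longrightarrow> lattice_invariant v A"
  by (auto simp: represents_def lattice_invariant_motif_translates)

lemma finite_motif_translates_ball:
  assumes "is_basis v" "finite M"
  shows "finite (motif_translates v M \<inter> cball c R)"
proof -
  have "motif_translates v M \<inter> cball c R \<subseteq> (\<Union>x\<in>M. (\<lambda>w. x + w) ` (lattice_of v \<inter> cball (c - x) R))"
  proof
    fix y assume "y \<in> motif_translates v M \<inter> cball c R"
    then obtain x w where "x \<in> M" "w \<in> lattice_of v" "y = x + w" "dist c y \<le> R"
      by (auto simp: motif_translates_def)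
    moreover from this have "dist (c - x) w \<le> R" by (simp add: dist_norm algebra_simps)
    ultimately show "y \<in> (\<Union>x\<in>M. (\<lambda>w. x + w) ` (lattice_of v \<inter> cball (c - x) R))"
      unfolding mem_cball[symmetric] by blast
  qed
  then show ?thesis using assms finite_lattice_ball by (auto intro: finite_subset)
qed

lemma represents_finite_ball: "represents v M A \<Longrightarrow> finite (A \<inter> cball c R)"
  using finite_motif_translates_ball by (auto simp: represents_def is_motif_def)

lemma represents_basis: "represents v M A \<Longrightarrow> is_basis v"
  by (simp add: represents_def)

lemma motif_translates_Int_cell:
  assumes "is_basis v" "M \<subseteq> unit_cell v"
  shows "motif_translates v M \<inter> unit_cell v = M"
proof (intro equalityI subsetI)
  fix y assume "y \<in> motif_translates v M \<inter> unit_cell v"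
  then obtain x w where xw: "x \<in> M" "w \<in> lattice_of v" "y = x + w" "y \<in> unit_cell v"
    by (auto simp: motif_translates_def)
  have "y = x" by (rule lattice_translate_unique2[OF assms(1)]) (use xw assms in auto)
  then show "y \<in> M" using xw by simp
next
  fix y assume "y \<in> M"
  then show "y \<in> motif_translates v M \<inter> unit_cell v"
    using assms(2) lattice_0[of v] by (force simp: motif_translates_def)
qed

text \<open>This permits a change of lattice: any lattice under which the set is invariant
  represents it, with whatever the new cell cuts out as motif.\<close>

lemma represents_if_invariant:
  assumes v: "is_basis v" and inv: "lattice_invariant v A" and ne: "A \<noteq> {}"
    and fin: "\<And>R. finite (A \<inter> cball 0 R)"
  shows "represents v (A \<inter> unit_cell v) A"
  unfolding represents_def is_motif_def
proof (intro conjI v)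
  obtain c where "unit_cell v \<subseteq> ball 0 c" using unit_cell_subset_ball by blast
  then have "A \<inter> unit_cell v \<subseteq> A \<inter> cball 0 c" by auto
  then show "finite (A \<inter> unit_cell v)" using fin finite_subset by blast
  have dec: "\<exists>w\<in>lattice_of v. x + w \<in> A \<inter> unit_cell v" if "x \<in> A" for x
    using lattice_translate_unique[OF v, of x] lattice_invariantD[OF inv] that by blast
  then show "A \<inter> unit_cell v \<noteq> {}" using ne by blast
  show "A = motif_translates v (A \<inter> unit_cell v)"
  proof (intro equalityI subsetI)
    fix x assume "x \<in> A"
    then obtain w where w: "w \<in> lattice_of v" "x + w \<in> A \<inter> unit_cell v" using dec by blast
    have "x = (x + w) + (- w)" by simp
    then show "x \<in> motif_translates v (A \<inter> unit_cell v)"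
      unfolding motif_translates_def using w lattice_minus by blast
  next
    fix x assume "x \<in> motif_translates v (A \<inter> unit_cell v)"
    then show "x \<in> A" using lattice_invariantD[OF inv] by (auto simp: motif_translates_def)
  qed
qed auto

text \<open>The linear extension of the assignment of basis vectors preserves inner products because
  the Gram matrices agree. The last conclusion evaluates \<open>L\<close> at a vector known only
  through its inner products with the basis.\<close>

lemma orthogonal_map_of_gram:
  fixes b :: "3 \<Rightarrow> real^3"
  assumes v: "is_basis v" and gram: "\<And>i j. v $ i \<bullet> v $ j = b i \<bullet> b j"
  obtains L where "orthogonal_transformation L" "\<And>i. L (v $ i) = b i"
    "\<And>z z'. (\<And>i. z \<bullet> v $ i = z' \<bullet> b i) \<Longrightarrow> L z = z'"
proof -
  define L where "L = (\<lambda>x. \<Sum>i\<in>UNIV. (coords v x $ i) *\<^sub>R b i)"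
  have lin: "linear L"
    unfolding L_def by (rule linearI)
      (simp_all add: linear_add[OF linear_coords[OF v]] linear_scale[OF linear_coords[OF v]]
        scaleR_left_distrib sum.distrib scaleR_sum_right)
  have Lv: "L (v $ i) = b i" for i
  proof -
    have "coords v (v $ i) = (\<chi> j. if j = i then 1 else 0)"
      using v by (simp add: lattice_vec_basis[of v i] vec_eq_iff)
    then show ?thesis by (simp add: L_def if_distrib[of "\<lambda>a. a *\<^sub>R _"] cong: if_cong)
  qed
  have exp: "x = (\<Sum>i\<in>UNIV. (coords v x $ i) *\<^sub>R v $ i)" for x
    using basis_comb_coords[OF v, of x] by (simp add: basis_comb_def)
  have inner: "L x \<bullet> L y = x \<bullet> y" for x y
  proof -
    have "L x \<bullet> L y = (\<Sum>i\<in>UNIV. \<Sum>j\<in>UNIV. (coords v x $ i) * ((coords v y $ j) * (b i \<bullet> b j)))"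
      unfolding L_def inner_sum_left unfolding inner_sum_right by (simp add: mult.left_commute)
    also have "\<dots> = (\<Sum>i\<in>UNIV. (coords v x $ i) *\<^sub>R v $ i) \<bullet> (\<Sum>i\<in>UNIV. (coords v y $ i) *\<^sub>R v $ i)"
      unfolding inner_sum_left unfolding inner_sum_right by (simp add: gram mult.left_commute)
    finally show ?thesis using exp[of x] exp[of y] by simp
  qed
  have orth: "orthogonal_transformation L"
    using lin inner by (simp add: orthogonal_transformation_def)
  have "L z = z'" if z: "\<And>i. z \<bullet> v $ i = z' \<bullet> b i" for z z'
  proof -
    \<comment> \<open>The defect \<open>L z - z'\<close> is pulled back to a vector orthogonal to
      the whole basis, which is therefore 0.\<close>
    obtain y where y: "L y = L z - z'"
      using orthogonal_transformation_surj[OF orth] by (metis surjD)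
    have "y \<bullet> v $ i = 0" for i
    proof -
      have "y \<bullet> v $ i = (L z - z') \<bullet> b i" using inner[of y "v $ i"] by (simp add: y Lv)
      also have "\<dots> = 0" using inner[of z "v $ i"] z[of i] by (simp add: Lv inner_diff_left)
      finally show ?thesis .
    qed
    then have "y \<bullet> (\<Sum>i\<in>UNIV. (coords v y $ i) *\<^sub>R v $ i) = 0" by (simp add: inner_sum_right)
    then have "y \<bullet> y = 0" using exp[of y] by simp
    then show ?thesis using y linear_0[OF lin] by simp
  qed
  with orth Lv show ?thesis using that by blast
qed

section \<open>Mean densities of lattice-invariant sets\<close>

lemma nn_integral_translate:
  fixes f :: "real^3 \<Rightarrow> ennreal"
  assumes [measurable]: "f \<in> borel_measurable borel"
  shows "(\<integral>\<^sup>+x. f (x + w) \<partial>lborel) = (\<integral>\<^sup>+x. f x \<partial>lborel)"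
proof -
  have "(\<integral>\<^sup>+x. f x \<partial>lborel) = (\<integral>\<^sup>+x. f x \<partial>distr lborel borel ((+) w))"
    by (simp add: lborel_distr_plus)
  also have "\<dots> = (\<integral>\<^sup>+x. f (w + x) \<partial>lborel)"
    by (rule nn_integral_distr) auto
  finally show ?thesis by (simp add: add.commute)
qed

text \<open>Unfolding: the translates of the cell tile the space, so after exchanging sum and
  integral and translating, the indicators of the translates add up to 1.\<close>

lemma nn_integral_lattice_unfold:
  fixes g :: "real^3 \<Rightarrow> ennreal"
  assumes v: "is_basis v" and [measurable]: "g \<in> borel_measurable borel"
  shows "(\<integral>\<^sup>+x. (\<integral>\<^sup>+w. g (x + w) \<partial>count_space (lattice_of v)) * indicator (unit_cell v) x \<partial>lborel) =
         (\<integral>\<^sup>+x. g x \<partial>lborel)"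
proof -
  note [measurable] = unit_cell_borel[OF v]
  have "(\<integral>\<^sup>+x. (\<integral>\<^sup>+w. g (x + w) \<partial>count_space (lattice_of v)) * indicator (unit_cell v) x \<partial>lborel)
      = (\<integral>\<^sup>+x. (\<integral>\<^sup>+w. g (x + w) * indicator (unit_cell v) x \<partial>count_space (lattice_of v)) \<partial>lborel)"
    by (simp add: nn_integral_multc)
  also have "\<dots> = (\<integral>\<^sup>+w. (\<integral>\<^sup>+x. g (x + w) * indicator (unit_cell v) x \<partial>lborel) \<partial>count_space (lattice_of v))"
    by (rule nn_integral_count_space_nn_integral[where f = "\<lambda>w x. g (x + w) * indicator (unit_cell v) x"])
      (simp_all add: countable_lattice)
  also have "\<dots> = (\<integral>\<^sup>+w. (\<integral>\<^sup>+x. g x * indicator (unit_cell v) (x - w) \<partial>lborel) \<partial>count_space (lattice_of v))"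
  proof (rule nn_integral_cong)
    fix w
    show "(\<integral>\<^sup>+x. g (x + w) * indicator (unit_cell v) x \<partial>lborel) = (\<integral>\<^sup>+x. g x * indicator (unit_cell v) (x - w) \<partial>lborel)"
      using nn_integral_translate[of "\<lambda>x. g x * indicator (unit_cell v) (x - w)" w] by simp
  qed
  also have "\<dots> = (\<integral>\<^sup>+x. (\<integral>\<^sup>+w. g x * indicator (unit_cell v) (x - w) \<partial>count_space (lattice_of v)) \<partial>lborel)"
    by (rule nn_integral_count_space_nn_integral[where f = "\<lambda>w x. g x * indicator (unit_cell v) (x - w)", symmetric])
      (simp_all add: countable_lattice)
  also have "\<dots> = (\<integral>\<^sup>+x. g x \<partial>lborel)"
  proof (rule nn_integral_cong)
    fix x
    obtain w0 where w0: "w0 \<in> lattice_of v" "x + w0 \<in> unit_cell v"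
      "\<And>w. w \<in> lattice_of v \<Longrightarrow> x + w \<in> unit_cell v \<Longrightarrow> w = w0"
      using lattice_translate_unique[OF v, of x] by auto
    \<comment> \<open>As \<open>w0\<close> is the only lattice vector that moves \<open>x\<close>
      into the cell, \<open>- w0\<close> is the only summand that contributes.\<close>
    have "indicator (unit_cell v) (x - w) = (indicator {- w0} w :: ennreal)" if "w \<in> lattice_of v" for w
      using w0(2) w0(3)[of "- w"] lattice_minus[OF that] by (auto simp: indicator_def)
    then have "(\<integral>\<^sup>+w. indicator (unit_cell v) (x - w) \<partial>count_space (lattice_of v))
        = (\<integral>\<^sup>+w. indicator {- w0} w \<partial>count_space (lattice_of v))"
      by (intro nn_integral_cong) simp
    also have "\<dots> = 1"
      using lattice_minus[OF w0(1)] by (subst nn_integral_indicator) auto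
    finally show "(\<integral>\<^sup>+w. g x * indicator (unit_cell v) (x - w) \<partial>count_space (lattice_of v)) = g x"
      by (simp add: nn_integral_cmult)
  qed
  finally show ?thesis .
qed

text \<open>If the cell were a null set, unfolding the constant 1 would give the whole space measure
  0.\<close>

lemma emeasure_unit_cell:
  assumes "is_basis v"
  shows "emeasure lborel (unit_cell v) \<noteq> 0" "emeasure lborel (unit_cell v) < \<infinity>"
proof -
  show "emeasure lborel (unit_cell v) \<noteq> 0"
  proof
    assume z: "emeasure lborel (unit_cell v) = 0"
    then have ae: "AE x in lborel. x \<notin> unit_cell v"
      using unit_cell_borel[OF assms] by (intro AE_I[of _ _ "unit_cell v"]) auto
    have "(\<integral>\<^sup>+x. (\<integral>\<^sup>+w. 1 \<partial>count_space (lattice_of v)) * indicator (unit_cell v) x \<partial>lborel) = (\<integral>\<^sup>+(x::real^3). 0 \<partial>lborel)"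
    proof (rule nn_integral_cong_AE)
      show "AE x in lborel. (\<integral>\<^sup>+w. 1 \<partial>count_space (lattice_of v)) * indicator (unit_cell v) x = (0::ennreal)"
        using ae by eventually_elim simp
    qed
    then have "(\<integral>\<^sup>+(x::real^3). 1 \<partial>lborel) = 0"
      using nn_integral_lattice_unfold[OF assms, of "\<lambda>_. 1"] by simp
    then show False by simp
  qed
  obtain c where "unit_cell v \<subseteq> ball 0 c" using unit_cell_subset_ball by blast
  then have "emeasure lborel (unit_cell v) \<le> emeasure lborel (ball (0::real^3) c)"
    by (rule emeasure_mono) simp
  then show "emeasure lborel (unit_cell v) < \<infinity>"
    using emeasure_lborel_ball_finite[of "0::real^3" c] by (rule order_le_less_trans)
qed

lemma measure_unit_cell_pos:
  assumes "is_basis v" shows "measure lborel (unit_cell v) > 0"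
proof -
  have "emeasure lborel (unit_cell v) > 0"
    using emeasure_unit_cell(1)[OF assms] by (simp add: zero_less_iff_neq_zero)
  then show ?thesis
    using emeasure_unit_cell(2)[OF assms] unfolding measure_def enn2real_positive_iff by simp
qed

lemma fmeasurable_lborel_imp_lmeasurable:
  assumes "S \<in> fmeasurable lborel" shows "S \<in> lmeasurable"
proof (rule fmeasurableI)
  show "S \<in> sets lebesgue" using fmeasurableD[OF assms] by (rule sets_completionI_sets)
  show "emeasure lebesgue S < \<infinity>"
    using fmeasurableD2[OF assms] fmeasurableD[OF assms] by (simp add: sets_completionI_sets top.not_eq_extremum)
qed

lemma fmeasurable_Int_unit_cell:
  assumes "is_basis v" "S \<in> sets borel"
  shows "S \<inter> unit_cell v \<in> fmeasurable lborel"
proof (rule fmeasurableI2)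
  show "unit_cell v \<in> fmeasurable lborel"
    using emeasure_unit_cell[OF assms(1)] unit_cell_borel[OF assms(1)] by (simp add: fmeasurable_def)
  show "S \<inter> unit_cell v \<in> sets lborel"
    using assms(2) unit_cell_borel[OF assms(1)] by simp
qed simp

lemma fmeasurable_Int_cball:
  assumes "S \<in> sets borel"
  shows "S \<inter> cball (c::real^3) R \<in> fmeasurable lborel"
proof (rule fmeasurableI2[OF fmeasurable_compact[OF compact_cball[of c R]]])
  show "S \<inter> cball c R \<in> sets lborel" using assms by simp
qed simp

definition mean_density :: "real^3^3 \<Rightarrow> (real^3) set \<Rightarrow> real" where
  "mean_density v S = measure lborel (S \<inter> unit_cell v) / measure lborel (unit_cell v)"

text \<open>Unfolding the indicator of \<open>S\<close> in a ball weights each \<open>x\<close> of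
  \<open>S\<close> in the cell by the number of lattice vectors \<open>w\<close> with
  \<open>x + w\<close> in that ball. Since \<open>norm x < c\<close>, this number lies between the
  lattice counts at radius \<open>R - c\<close> and \<open>R + c\<close>.\<close>

lemma measure_Int_cball_lattice_count:
  assumes v: "is_basis v" and c: "unit_cell v \<subseteq> ball 0 c"
    and inv: "lattice_invariant v S" and S [measurable]: "S \<in> sets borel"
  shows "measure lborel (S \<inter> cball 0 R) \<le> card (lattice_of v \<inter> cball 0 (R + c)) * measure lborel (S \<inter> unit_cell v)"
    and "card (lattice_of v \<inter> cball 0 (R - c)) * measure lborel (S \<inter> unit_cell v) \<le> measure lborel (S \<inter> cball 0 R)"
proof -
  note [measurable] = unit_cell_borel[OF v]
  have fin: "finite {w \<in> lattice_of v. x + w \<in> cball 0 R}" for x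
  proof -
    have "{w \<in> lattice_of v. x + w \<in> cball 0 R} \<subseteq> lattice_of v \<inter> cball (- x) R"
      by (auto simp: dist_norm norm_minus_commute algebra_simps)
    then show ?thesis using finite_lattice_ball[OF v] finite_subset by blast
  qed
  have count: "(\<integral>\<^sup>+w. indicator (S \<inter> cball 0 R) (x + w) \<partial>count_space (lattice_of v))
     = indicator S x * of_nat (card {w \<in> lattice_of v. x + w \<in> cball 0 R})" for x
  proof -
    have "(\<integral>\<^sup>+w. indicator (S \<inter> cball 0 R) (x + w) \<partial>count_space (lattice_of v))
      = (\<integral>\<^sup>+w. indicator S x * indicator {w \<in> lattice_of v. x + w \<in> cball 0 R} w \<partial>count_space (lattice_of v))"
      by (rule nn_integral_cong) (auto simp: indicator_def lattice_invariantD[OF inv])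
    also have "\<dots> = indicator S x * of_nat (card {w \<in> lattice_of v. x + w \<in> cball 0 R})"
      using fin[of x] by (simp add: nn_integral_cmult emeasure_count_space_finite)
    finally show ?thesis .
  qed
  have eq: "emeasure lborel (S \<inter> cball 0 R) =
     (\<integral>\<^sup>+x. indicator (S \<inter> unit_cell v) x * of_nat (card {w \<in> lattice_of v. x + w \<in> cball 0 R}) \<partial>lborel)"
  proof -
    have "emeasure lborel (S \<inter> cball 0 R) = (\<integral>\<^sup>+x. indicator (S \<inter> cball 0 R) x \<partial>lborel)" by simp
    also have "\<dots> = (\<integral>\<^sup>+x. (\<integral>\<^sup>+w. indicator (S \<inter> cball 0 R) (x + w) \<partial>count_space (lattice_of v)) * indicator (unit_cell v) x \<partial>lborel)"
      by (rule nn_integral_lattice_unfold[OF v, symmetric]) (rule borel_measurable_indicator, use S in simp)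
    also have "\<dots> = (\<integral>\<^sup>+x. indicator (S \<inter> unit_cell v) x * of_nat (card {w \<in> lattice_of v. x + w \<in> cball 0 R}) \<partial>lborel)"
      unfolding count by (intro nn_integral_cong) (auto simp: indicator_def)
    finally show ?thesis .
  qed
  have ub: "card {w \<in> lattice_of v. x + w \<in> cball 0 R} \<le> card (lattice_of v \<inter> cball 0 (R + c))"
    and lb: "card (lattice_of v \<inter> cball 0 (R - c)) \<le> card {w \<in> lattice_of v. x + w \<in> cball 0 R}"
    if "x \<in> unit_cell v" for x
  proof -
    have nx: "norm x < c" using c that by auto
    have "{w \<in> lattice_of v. x + w \<in> cball 0 R} \<subseteq> lattice_of v \<inter> cball 0 (R + c)"
    proof clarify
      fix w assume "x + w \<in> cball 0 R"
      then have "norm w \<le> R + c" using nx norm_triangle_ineq4[of "x + w" x] by simp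
      then show "w \<in> cball 0 (R + c)" by simp
    qed
    then show "card {w \<in> lattice_of v. x + w \<in> cball 0 R} \<le> card (lattice_of v \<inter> cball 0 (R + c))"
      using finite_lattice_ball[OF v] by (intro card_mono) auto
    have "lattice_of v \<inter> cball 0 (R - c) \<subseteq> {w \<in> lattice_of v. x + w \<in> cball 0 R}"
    proof
      fix w assume "w \<in> lattice_of v \<inter> cball 0 (R - c)"
      then show "w \<in> {w \<in> lattice_of v. x + w \<in> cball 0 R}" using nx norm_triangle_ineq[of x w] by simp
    qed
    then show "card (lattice_of v \<inter> cball 0 (R - c)) \<le> card {w \<in> lattice_of v. x + w \<in> cball 0 R}"
      using fin by (intro card_mono) auto
  qed
  have fmU: "S \<inter> unit_cell v \<in> fmeasurable lborel" and fmB: "S \<inter> cball 0 R \<in> fmeasurable lborel"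
    using fmeasurable_Int_unit_cell[OF v S] fmeasurable_Int_cball[OF S] by auto
  have const: "(\<integral>\<^sup>+x. indicator (S \<inter> unit_cell v) x * of_nat n \<partial>lborel) = ennreal (real n * measure lborel (S \<inter> unit_cell v))" for n
  proof -
    have "(\<integral>\<^sup>+x. indicator (S \<inter> unit_cell v) x * of_nat n \<partial>lborel) = emeasure lborel (S \<inter> unit_cell v) * of_nat n"
      using fmU by (subst nn_integral_multc) (auto simp: fmeasurableD)
    then show ?thesis
      unfolding emeasure_eq_measure2[OF fmU]
      by (simp add: ennreal_mult'' ennreal_of_nat_eq_real_of_nat mult.commute)
  qed
  have "emeasure lborel (S \<inter> cball 0 R) \<le> (\<integral>\<^sup>+x. indicator (S \<inter> unit_cell v) x * of_nat (card (lattice_of v \<inter> cball 0 (R + c))) \<partial>lborel)"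
    unfolding eq using ub by (intro nn_integral_mono) (auto simp: indicator_def)
  then show "measure lborel (S \<inter> cball 0 R) \<le> card (lattice_of v \<inter> cball 0 (R + c)) * measure lborel (S \<inter> unit_cell v)"
    using fmB unfolding const by (simp add: emeasure_eq_measure2)
  have "(\<integral>\<^sup>+x. indicator (S \<inter> unit_cell v) x * of_nat (card (lattice_of v \<inter> cball 0 (R - c))) \<partial>lborel) \<le> emeasure lborel (S \<inter> cball 0 R)"
    unfolding eq using lb by (intro nn_integral_mono) (auto simp: indicator_def)
  then show "card (lattice_of v \<inter> cball 0 (R - c)) * measure lborel (S \<inter> unit_cell v) \<le> measure lborel (S \<inter> cball 0 R)"
    using fmB unfolding const by (simp add: emeasure_eq_measure2)
qed

text \<open>The lattice counts are eliminated by applying the preceding estimate also to the whole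
  space; this costs a second shift of the radius by \<open>c\<close>.\<close>

lemma mean_density_cball_bounds:
  assumes v: "is_basis v" and c: "unit_cell v \<subseteq> ball 0 c"
    and inv: "lattice_invariant v S" and S: "S \<in> sets borel"
  shows "measure lborel (S \<inter> cball 0 R) \<le> mean_density v S * measure lborel (cball (0::real^3) (R + 2 * c))"
    and "mean_density v S * measure lborel (cball (0::real^3) (R - 2 * c)) \<le> measure lborel (S \<inter> cball 0 R)"
proof -
  have U: "measure lborel (unit_cell v) > 0" using measure_unit_cell_pos[OF v] .
  have invU: "lattice_invariant v UNIV" by (simp add: lattice_invariant_def)
  note count = measure_Int_cball_lattice_count[OF v c]
  have "card (lattice_of v \<inter> cball 0 (R + c)) * measure lborel (unit_cell v) \<le> measure lborel (cball (0::real^3) (R + 2 * c))"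
    using count(2)[OF invU, of "R + 2 * c"] by (simp add: algebra_simps)
  then have "real (card (lattice_of v \<inter> cball 0 (R + c))) \<le> measure lborel (cball (0::real^3) (R + 2 * c)) / measure lborel (unit_cell v)"
    using U by (simp add: field_simps)
  from mult_right_mono[OF this, of "measure lborel (S \<inter> unit_cell v)"]
  show "measure lborel (S \<inter> cball 0 R) \<le> mean_density v S * measure lborel (cball (0::real^3) (R + 2 * c))"
    using count(1)[OF inv S, of R] by (simp add: mean_density_def mult.commute)
  have "measure lborel (cball (0::real^3) (R - 2 * c)) \<le> card (lattice_of v \<inter> cball 0 (R - c)) * measure lborel (unit_cell v)"
    using count(1)[OF invU, of "R - 2 * c"] by (simp add: algebra_simps)
  then have "measure lborel (cball (0::real^3) (R - 2 * c)) / measure lborel (unit_cell v) \<le> real (card (lattice_of v \<inter> cball 0 (R - c)))"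
    using U by (simp add: field_simps)
  from mult_right_mono[OF this, of "measure lborel (S \<inter> unit_cell v)"]
  show "mean_density v S * measure lborel (cball (0::real^3) (R - 2 * c)) \<le> measure lborel (S \<inter> cball 0 R)"
    using count(2)[OF inv S, of R] by (simp add: mean_density_def mult.commute)
qed

lemma is_isometry_decompose:
  assumes "is_isometry \<iota>"
  obtains L where "orthogonal_transformation L" "\<And>x. \<iota> x = L x + \<iota> 0"
proof -
  have "orthogonal_transformation (\<lambda>x. \<iota> x - \<iota> 0)"
    unfolding orthogonal_transformation_isometry using assms by (simp add: is_isometry_def dist_norm)
  then show ?thesis using that[of "\<lambda>x. \<iota> x - \<iota> 0"] by simp
qed

lemma measure_isometry_image:
  assumes "is_isometry \<iota>" "S \<in> fmeasurable lborel"
  shows "\<iota> ` S \<in> lmeasurable" "measure lebesgue (\<iota> ` S) = measure lborel S"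
proof -
  obtain L where L: "orthogonal_transformation L" "\<And>x. \<iota> x = L x + \<iota> 0"
    using is_isometry_decompose[OF assms(1)] by blast
  have eq: "\<iota> ` S = (+) (\<iota> 0) ` L ` S"
    unfolding image_image by (intro image_cong refl) (metis L(2) add.commute)
  have S: "S \<in> lmeasurable" using assms(2) by (simp add: fmeasurable_lborel_imp_lmeasurable)
  have L: "L ` S \<in> lmeasurable" "measure lebesgue (L ` S) = measure lebesgue S"
    using measurable_orthogonal_image[OF L(1) S] measure_orthogonal_image[OF L(1) S] by auto
  show "\<iota> ` S \<in> lmeasurable" unfolding eq using L by (simp add: measurable_translation)
  show "measure lebesgue (\<iota> ` S) = measure lborel S"
    unfolding eq using L assms(2) by (simp add: measure_translation measure_completion fmeasurable_def)
qed

text \<open>Comparing the two sets on balls of radius tending to infinity needs no relation between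
  the two lattices.\<close>

lemma mean_density_le_isometry:
  assumes v: "is_basis v" "lattice_invariant v S" and S: "S \<in> sets borel"
    and v': "is_basis v'" "lattice_invariant v' S'" and S': "S' \<in> sets borel"
    and \<iota>: "is_isometry \<iota>" "\<iota> ` S \<subseteq> S'"
  shows "mean_density v S \<le> mean_density v' S'"
proof -
  obtain c where c: "c > 0" "unit_cell v \<subseteq> ball 0 c" using unit_cell_subset_ball by blast
  obtain c' where c': "c' > 0" "unit_cell v' \<subseteq> ball 0 c'" using unit_cell_subset_ball by blast
  define d where "d = norm (\<iota> 0) + 2 * c'"
  have cb: "measure lborel (cball (0::real^3) r) = unit_ball_vol 3 * r ^ 3" if "r \<ge> 0" for r
    using content_cball[OF that, of "0::real^3"] by simp
  \<comment> \<open>The changes of the radius, by the sizes of both cells and by the displacement of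
    the origin, do not depend on \<open>R\<close>; dividing by the cube of \<open>R\<close> removes
    them in the limit.\<close>
  have key: "mean_density v S * (R - 2 * c) ^ 3 \<le> mean_density v' S' * (R + d) ^ 3" if R: "R \<ge> 2 * c" for R
  proof -
    have sub: "\<iota> ` (S \<inter> cball 0 R) \<subseteq> S' \<inter> cball 0 (R + norm (\<iota> 0))"
    proof clarify
      fix x assume "x \<in> S" "x \<in> cball 0 R"
      have "dist (\<iota> 0) (\<iota> x) = dist 0 x" using \<iota>(1) by (simp add: is_isometry_def)
      then have "norm (\<iota> x) \<le> R + norm (\<iota> 0)"
        using \<open>x \<in> cball 0 R\<close> norm_triangle_sub[of "\<iota> x" "\<iota> 0"] by (simp add: dist_norm norm_minus_commute)
      then show "\<iota> x \<in> S' \<inter> cball 0 (R + norm (\<iota> 0))" using \<open>x \<in> S\<close> \<iota>(2) by auto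
    qed
    note fm = fmeasurable_Int_cball[OF S, of 0 R] fmeasurable_Int_cball[OF S', of 0 "R + norm (\<iota> 0)"]
    have "mean_density v S * measure lborel (cball (0::real^3) (R - 2 * c)) \<le> measure lborel (S \<inter> cball 0 R)"
      by (rule mean_density_cball_bounds(2)[OF v(1) c(2) v(2) S])
    also have "\<dots> = measure lebesgue (\<iota> ` (S \<inter> cball 0 R))"
      using measure_isometry_image[OF \<iota>(1) fm(1)] by simp
    also have "\<dots> \<le> measure lebesgue (S' \<inter> cball 0 (R + norm (\<iota> 0)))"
      using measure_isometry_image[OF \<iota>(1) fm(1)] fm(2)
      by (intro measure_mono_fmeasurable sub) (auto simp: fmeasurable_lborel_imp_lmeasurable)
    also have "\<dots> = measure lborel (S' \<inter> cball 0 (R + norm (\<iota> 0)))"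
      using fm(2) by (simp add: measure_completion fmeasurable_def)
    also have "\<dots> \<le> mean_density v' S' * measure lborel (cball (0::real^3) (R + norm (\<iota> 0) + 2 * c'))"
      by (rule mean_density_cball_bounds(1)[OF v'(1) c'(2) v'(2) S'])
    finally have "unit_ball_vol 3 * (mean_density v S * (R - 2 * c) ^ 3) \<le> unit_ball_vol 3 * (mean_density v' S' * (R + d) ^ 3)"
      using R c(1) c'(1) unfolding d_def by (subst (asm) (1 2) cb) (simp_all add: mult.left_commute add.assoc)
    moreover have "unit_ball_vol 3 > 0" by simp
    ultimately show ?thesis by (metis mult_le_cancel_left_pos)
  qed
  have 1: "(\<lambda>n. mean_density v S * (1 - 2 * c / real n) ^ 3) \<longlonglongrightarrow> mean_density v S * (1 - 0) ^ 3"
    by (intro tendsto_intros lim_const_over_n)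
  have 2: "(\<lambda>n. mean_density v' S' * (1 + d / real n) ^ 3) \<longlonglongrightarrow> mean_density v' S' * (1 + 0) ^ 3"
    by (intro tendsto_intros lim_const_over_n)
  have "\<forall>n\<ge>max 1 (nat \<lceil>2 * c\<rceil>). mean_density v S * (1 - 2 * c / real n) ^ 3 \<le> mean_density v' S' * (1 + d / real n) ^ 3"
  proof (intro allI impI)
    fix n assume n: "n \<ge> max 1 (nat \<lceil>2 * c\<rceil>)"
    then have n1: "real n > 0" "real n \<ge> 2 * c" by linarith+
    have "mean_density v S * (real n - 2 * c) ^ 3 / real n ^ 3 \<le> mean_density v' S' * (real n + d) ^ 3 / real n ^ 3"
      using key[OF n1(2)] n1(1) by (intro divide_right_mono) auto
    moreover have "1 - 2 * c / real n = (real n - 2 * c) / real n" "1 + d / real n = (real n + d) / real n"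
      using n1(1) by (simp_all add: field_simps)
    ultimately show "mean_density v S * (1 - 2 * c / real n) ^ 3 \<le> mean_density v' S' * (1 + d / real n) ^ 3"
      by (simp add: power_divide)
  qed
  then have "mean_density v S * (1 - 0) ^ 3 \<le> mean_density v' S' * (1 + 0) ^ 3"
    by (intro LIMSEQ_le[OF 1 2]) blast
  then show ?thesis by simp
qed

section \<open>Invariance under isometries\<close>

definition cover_set :: "(real^3) set \<Rightarrow> nat \<Rightarrow> real \<Rightarrow> (real^3) set" where
  "cover_set A k t = {x. k \<le> card {a \<in> A. x \<in> cball a t}}"

lemma near_points_eq: "{a \<in> A. x \<in> cball a t} = A \<inter> cball (x::real^3) t"
  by (auto simp: dist_commute)

lemma represents_near_finite: "represents v M A \<Longrightarrow> finite {a \<in> A. x \<in> cball a t}"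
  unfolding near_points_eq by (rule represents_finite_ball)

lemma represents_countable:
  assumes "represents v M A" shows "countable A"
proof -
  have "A = (\<Union>n::nat. A \<inter> cball 0 (real n))"
    by (auto simp: real_arch_simple)
  moreover have "countable (\<Union>n::nat. A \<inter> cball 0 (real n))"
    using represents_finite_ball[OF assms] by (intro countable_UN) (auto intro: countable_finite)
  ultimately show ?thesis by simp
qed

text \<open>A point is covered at least \<open>k\<close> times iff it lies in the balls around some
  \<open>k\<close> points of \<open>A\<close>, and the countable set \<open>A\<close> has countably
  many such subsets. For \<open>k = 0\<close> the only subset is empty and its intersection is the
  whole space.\<close>

lemma cover_set_borel:
  assumes "represents v M A" shows "cover_set A k t \<in> sets borel"
proof -
  have "cover_set A k t = (\<Union>F\<in>{F. F \<subseteq> A \<and> finite F \<and> card F = k}. \<Inter>a\<in>F. cball a t)"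
  proof (intro set_eqI iffI)
    fix x assume "x \<in> cover_set A k t"
    then have "k \<le> card {a \<in> A. x \<in> cball a t}" by (simp add: cover_set_def)
    then obtain F where "F \<subseteq> {a \<in> A. x \<in> cball a t}" "card F = k" "finite F"
      by (rule obtain_subset_with_card_n)
    then show "x \<in> (\<Union>F\<in>{F. F \<subseteq> A \<and> finite F \<and> card F = k}. \<Inter>a\<in>F. cball a t)" by blast
  next
    fix x assume "x \<in> (\<Union>F\<in>{F. F \<subseteq> A \<and> finite F \<and> card F = k}. \<Inter>a\<in>F. cball a t)"
    then obtain F where F: "F \<subseteq> A" "card F = k" "\<forall>a\<in>F. x \<in> cball a t" by blast
    then have "card F \<le> card {a \<in> A. x \<in> cball a t}"
      by (intro card_mono represents_near_finite[OF assms]) blast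
    then show "x \<in> cover_set A k t" using F by (simp add: cover_set_def)
  qed
  also have "\<dots> \<in> sets borel"
  proof (rule sets.countable_UN'')
    show "countable {F. F \<subseteq> A \<and> finite F \<and> card F = k}"
      by (rule countable_subset[OF _ countable_Collect_finite_subset[OF represents_countable[OF assms]]]) blast
    show "(\<Inter>a\<in>F. cball a t) \<in> sets borel" if "F \<in> {F. F \<subseteq> A \<and> finite F \<and> card F = k}" for F
      by (intro borel_closed closed_INT) auto
  qed
  finally show ?thesis .
qed

lemma card_near_translate:
  assumes inv: "lattice_invariant v A" and w: "w \<in> lattice_of v"
  shows "card {a \<in> A. x + w \<in> cball a t} = card {a \<in> A. x \<in> cball a t}"
proof -
  have "{a \<in> A. x + w \<in> cball a t} = (\<lambda>a. a + w) ` {a \<in> A. x \<in> cball a t}"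
  proof (intro set_eqI iffI)
    fix a assume a: "a \<in> {a \<in> A. x + w \<in> cball a t}"
    then have "a - w \<in> A" using lattice_invariantD[OF inv w, of "a - w"] by simp
    moreover have "x \<in> cball (a - w) t" using a by (simp add: dist_norm algebra_simps)
    ultimately show "a \<in> (\<lambda>a. a + w) ` {a \<in> A. x \<in> cball a t}"
      by (intro image_eqI[of _ _ "a - w"]) auto
  next
    fix a assume "a \<in> (\<lambda>a. a + w) ` {a \<in> A. x \<in> cball a t}"
    then show "a \<in> {a \<in> A. x + w \<in> cball a t}" using lattice_invariantD[OF inv w] by auto
  qed
  then show ?thesis by (simp add: card_image)
qed

lemma cover_set_invariant:
  assumes "lattice_invariant v A" shows "lattice_invariant v (cover_set A k t)"
proof (rule lattice_invariantI)
  fix x w assume "x \<in> cover_set A k t" "w \<in> lattice_of v"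
  then show "x + w \<in> cover_set A k t"
    unfolding cover_set_def using card_near_translate[OF assms, of w x t] by simp
qed

lemma is_isometry_id: "is_isometry (\<lambda>x. x)"
  by (simp add: is_isometry_def)

text \<open>The basis picked by the choice operator and any other are compared through the identity,
  in both directions. From here on every argument may use a convenient basis.\<close>

lemma coverage_eq_mean_density:
  assumes "represents v M A"
  shows "coverage A k t = mean_density v (cover_set A k t)"
proof -
  define v' where "v' = (SOME v. \<exists>M. represents v M A)"
  have "\<exists>M. represents v' M A" unfolding v'_def by (rule someI_ex) (use assms in blast)
  then obtain M' where v': "represents v' M' A" by blast
  have "coverage A k t = coverage_fraction v' A k t" by (simp add: coverage_def v'_def)
  also have "\<dots> = mean_density v' (cover_set A k t)"
  proof -
    have "{x \<in> unit_cell v'. k \<le> card {a \<in> A. x \<in> cball a t}} = cover_set A k t \<inter> unit_cell v'"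
      by (auto simp: cover_set_def)
    moreover have "cover_set A k t \<inter> unit_cell v' \<in> sets lborel" "unit_cell v' \<in> sets lborel"
      using cover_set_borel[OF v'] unit_cell_borel[OF represents_basis[OF v']] by simp_all
    ultimately show ?thesis
      unfolding coverage_fraction_def mean_density_def by (simp only: measure_completion)
  qed
  also have "\<dots> = mean_density v (cover_set A k t)"
    using mean_density_le_isometry[OF represents_basis[OF v'] cover_set_invariant[OF represents_invariant[OF v']]
        cover_set_borel[OF v'] represents_basis[OF assms] cover_set_invariant[OF represents_invariant[OF assms]]
        cover_set_borel[OF assms] is_isometry_id, of k t k t]
      mean_density_le_isometry[OF represents_basis[OF assms] cover_set_invariant[OF represents_invariant[OF assms]]
        cover_set_borel[OF assms] represents_basis[OF v'] cover_set_invariant[OF represents_invariant[OF v']]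
        cover_set_borel[OF v'] is_isometry_id, of k t k t]
    by simp
  finally show ?thesis .
qed

text \<open>All comparisons of coverages go through this rule: with an isometry for invariance, with
  the identity for monotonicity and for perturbations.\<close>

lemma coverage_le_isometry:
  assumes A: "represents v M A" and Q: "represents v' M' Q" and "is_isometry \<iota>"
    and "\<iota> ` cover_set A k t \<subseteq> cover_set Q k' t'"
  shows "coverage A k t \<le> coverage Q k' t'"
  unfolding coverage_eq_mean_density[OF A] coverage_eq_mean_density[OF Q]
  by (rule mean_density_le_isometry[OF represents_basis[OF A] cover_set_invariant[OF represents_invariant[OF A]]
        cover_set_borel[OF A] represents_basis[OF Q] cover_set_invariant[OF represents_invariant[OF Q]]
        cover_set_borel[OF Q] assms(3,4)])

lemma is_isometry_surj:
  assumes "is_isometry \<iota>" shows "surj \<iota>"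
proof -
  obtain L where L: "orthogonal_transformation L" "\<And>x. \<iota> x = L x + \<iota> 0"
    using is_isometry_decompose[OF assms] by blast
  have "\<exists>x. y = \<iota> x" for y
  proof -
    obtain x where "L x = y - \<iota> 0" using orthogonal_transformation_surj[OF L(1)] by (metis surjD)
    then have "\<iota> x = y" using L(2)[of x] by simp
    then show ?thesis by blast
  qed
  then show ?thesis by (auto simp: surj_def)
qed

lemma is_isometry_inj: "is_isometry \<iota> \<Longrightarrow> inj \<iota>"
  by (rule injI) (metis dist_eq_0_iff is_isometry_def)

lemma is_isometry_inv:
  assumes "is_isometry \<iota>" shows "is_isometry (inv \<iota>)"
  unfolding is_isometry_def
proof (intro allI)
  fix x y
  have "dist (\<iota> (inv \<iota> x)) (\<iota> (inv \<iota> y)) = dist (inv \<iota> x) (inv \<iota> y)"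
    using assms by (simp add: is_isometry_def)
  then show "dist (inv \<iota> x) (inv \<iota> y) = dist x y"
    by (simp add: surj_f_inv_f[OF is_isometry_surj[OF assms]])
qed

text \<open>The linear part of the isometry carries the basis along. The image of the motif need not
  lie in the new cell, so the new motif is what the image set has in that cell.\<close>

lemma represents_isometry_image:
  assumes A: "represents v M A" and \<iota>: "is_isometry \<iota>"
  shows "\<exists>v' M'. represents v' M' (\<iota> ` A)"
proof -
  obtain L where L: "orthogonal_transformation L" "\<And>x. \<iota> x = L x + \<iota> 0"
    using is_isometry_decompose[OF \<iota>] by blast
  have lin: "linear L" using L(1) by (rule orthogonal_transformation_linear)
  define v' :: "real^3^3" where "v' = (\<chi> i. L (v $ i))"
  have bc: "basis_comb v' r = L (basis_comb v r)" for r
    by (simp add: basis_comb_def v'_def linear_sum[OF lin] linear_scale[OF lin])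
  have "inj (basis_comb v')"
  proof (rule injI)
    fix r s assume "basis_comb v' r = basis_comb v' s"
    then have "basis_comb v r = basis_comb v s"
      using orthogonal_transformation_inj[OF L(1)] unfolding bc by (metis injD)
    then show "r = s" using inj_basis_comb[OF represents_basis[OF A]] by (metis injD)
  qed
  then have basis: "is_basis v'" by (rule is_basis_if_inj)
  have \<iota>add: "\<iota> (x + u) = \<iota> x + L u" for x u
    using L(2)[of "x + u"] L(2)[of x] linear_add[OF lin] by (simp add: algebra_simps)
  have "represents v' (\<iota> ` A \<inter> unit_cell v') (\<iota> ` A)"
  proof (rule represents_if_invariant[OF basis])
    show "lattice_invariant v' (\<iota> ` A)"
    proof (rule lattice_invariantI)
      fix x w assume "x \<in> \<iota> ` A" and w: "w \<in> lattice_of v'"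
      then obtain a where a: "a \<in> A" "x = \<iota> a" by blast
      obtain n where "w = basis_comb v' (\<chi> i. real_of_int (n i))"
        using w by (auto simp: lattice_of_eq lattice_vec_eq)
      then have "w = L (lattice_vec v n)" by (simp add: bc lattice_vec_eq)
      then have "x + w = \<iota> (a + lattice_vec v n)" using a \<iota>add by simp
      moreover have "a + lattice_vec v n \<in> A"
        using lattice_invariantD[OF represents_invariant[OF A]] a(1) lattice_of_eq by blast
      ultimately show "x + w \<in> \<iota> ` A" by blast
    qed
    show "\<iota> ` A \<noteq> {}"
    proof -
      have "M \<noteq> {}" and "M \<subseteq> A"
        using A motif_translates_Int_cell[of v M] by (auto simp: represents_def is_motif_def)
      then show ?thesis by blast
    qed
    show "finite (\<iota> ` A \<inter> cball 0 R)" for R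
    proof -
      have "\<iota> ` A \<inter> cball 0 R \<subseteq> \<iota> ` (A \<inter> cball (inv \<iota> 0) R)"
      proof clarify
        fix a assume a: "a \<in> A" "\<iota> a \<in> cball 0 R"
        have "dist (\<iota> (inv \<iota> 0)) (\<iota> a) = dist (inv \<iota> 0) a" using \<iota> by (simp add: is_isometry_def)
        then have "dist (inv \<iota> 0) a \<le> R" using a(2) by (simp add: surj_f_inv_f[OF is_isometry_surj[OF \<iota>]])
        then show "\<iota> a \<in> \<iota> ` (A \<inter> cball (inv \<iota> 0) R)" using a(1) by simp
      qed
      then show ?thesis using represents_finite_ball[OF A] finite_surj by blast
    qed
  qed
  then show ?thesis by blast
qed

lemma cover_set_isometry:
  assumes \<iota>: "is_isometry \<iota>"
  shows "\<iota> ` cover_set A k t = cover_set (\<iota> ` A) k t"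
proof -
  have card: "card {b \<in> \<iota> ` A. \<iota> x \<in> cball b t} = card {a \<in> A. x \<in> cball a t}" for x
  proof -
    have "{b \<in> \<iota> ` A. \<iota> x \<in> cball b t} = \<iota> ` {a \<in> A. x \<in> cball a t}"
      using \<iota> by (auto simp: is_isometry_def)
    then show ?thesis
      using card_image[OF inj_on_subset[OF is_isometry_inj[OF \<iota>] subset_UNIV]] by simp
  qed
  show ?thesis
  proof (intro set_eqI iffI)
    fix y assume "y \<in> cover_set (\<iota> ` A) k t"
    then have "k \<le> card {b \<in> \<iota> ` A. y \<in> cball b t}" by (simp add: cover_set_def)
    moreover obtain x where x: "y = \<iota> x" using surjD[OF is_isometry_surj[OF \<iota>]] by blast
    ultimately have "x \<in> cover_set A k t" unfolding cover_set_def using card[of x] by simp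
    then show "y \<in> \<iota> ` cover_set A k t" using x by blast
  next
    fix y assume "y \<in> \<iota> ` cover_set A k t"
    then obtain x where x: "y = \<iota> x" "x \<in> cover_set A k t" by blast
    then show "y \<in> cover_set (\<iota> ` A) k t" unfolding cover_set_def using card[of x] by simp
  qed
qed

lemma coverage_isometry:
  assumes "periodic_set A" and \<iota>: "is_isometry \<iota>"
  shows "coverage (\<iota> ` A) k t = coverage A k t"
proof (rule antisym)
  obtain v M where A: "represents v M A" using assms(1) by (auto simp: periodic_set_def)
  obtain v' M' where Q: "represents v' M' (\<iota> ` A)" using represents_isometry_image[OF A \<iota>] by blast
  have inv: "inv \<iota> ` (\<iota> ` S) = S" for S by (simp add: image_inv_f_f is_isometry_inj[OF \<iota>])
  show "coverage A k t \<le> coverage (\<iota> ` A) k t"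
    by (rule coverage_le_isometry[OF A Q \<iota>]) (simp add: cover_set_isometry[OF \<iota>])
  have "inv \<iota> ` cover_set (\<iota> ` A) k t \<subseteq> cover_set A k t"
    by (simp add: inv cover_set_isometry[OF \<iota>, symmetric])
  then show "coverage (\<iota> ` A) k t \<le> coverage A k t"
    by (rule coverage_le_isometry[OF Q A is_isometry_inv[OF \<iota>]])
qed

theorem density_fingerprint_isometry:
  assumes "periodic_set A" "is_isometry \<iota>"
  shows "density_fingerprint (\<iota> ` A) = density_fingerprint A"
  unfolding density_fingerprint_def density_function_def coverage_isometry[OF assms] ..

section \<open>Lipschitz continuity\<close>

lemma motif_ne: "represents v M A \<Longrightarrow> M \<noteq> {}" and motif_finite: "represents v M A \<Longrightarrow> finite M"
  and motif_cell: "represents v M A \<Longrightarrow> M \<subseteq> unit_cell v"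
  by (auto simp: represents_def is_motif_def)

lemma motif_subset: "represents v M A \<Longrightarrow> M \<subseteq> A"
  using motif_translates_Int_cell[of v M] by (auto simp: represents_def is_motif_def)

lemma represents_separated:
  assumes A: "represents v M A"
  obtains e where "e > 0" "\<And>a b. a \<in> A \<Longrightarrow> b \<in> A \<Longrightarrow> dist a b < e \<Longrightarrow> a = b"
proof -
  obtain c where c: "c > 0" "unit_cell v \<subseteq> ball 0 c" using unit_cell_subset_ball by blast
  define F where "F = A \<inter> cball 0 (c + 1)"
  define D where "D = (\<lambda>(a, b). dist a b) ` {(a, b). a \<in> F \<and> b \<in> F \<and> a \<noteq> b}"
  have "finite F" unfolding F_def by (rule represents_finite_ball[OF A])
  then have "finite {(a, b). a \<in> F \<and> b \<in> F \<and> a \<noteq> b}"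
    by (intro finite_subset[OF _ finite_cartesian_product[of F F]]) auto
  then have fD: "finite (insert 1 D)" by (simp add: D_def)
  \<comment> \<open>Inserting 1 makes the minimum exist and keeps \<open>e \<le> 1\<close>: once
    \<open>a\<close> is translated into the cell, a point closer than \<open>e\<close> lies within
    \<open>c + 1\<close> of the origin and so in the finite set \<open>F\<close>.\<close>
  define e where "e = Min (insert 1 D)"
  have "e \<in> insert 1 D" unfolding e_def by (rule Min_in[OF fD]) simp
  then have "e > 0" by (auto simp: D_def)
  moreover have "a = b" if ab: "a \<in> A" "b \<in> A" and d: "dist a b < e" for a b
  proof (rule ccontr)
    assume ne: "a \<noteq> b"
    have "e \<le> 1" unfolding e_def by (rule Min_le[OF fD]) simp
    obtain w where w: "w \<in> lattice_of v" "a + w \<in> unit_cell v"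
      using lattice_translate_unique[OF represents_basis[OF A], of a] by blast
    have A': "a + w \<in> A" "b + w \<in> A"
      using ab lattice_invariantD[OF represents_invariant[OF A] w(1)] by blast+
    have n: "norm (a + w) < c" using c(2) w(2) by auto
    have "norm (b + w) \<le> norm (a + w) + dist a b"
      using norm_triangle_sub[of "b + w" "a + w"] by (simp add: dist_norm norm_minus_commute)
    then have "norm (b + w) \<le> c + 1" using n d \<open>e \<le> 1\<close> by linarith
    then have "a + w \<in> F" "b + w \<in> F" using A' n unfolding F_def by auto
    then have "dist (a + w) (b + w) \<in> D" unfolding D_def using ne by (intro image_eqI[of _ _ "(a + w, b + w)"]) auto
    then have "e \<le> dist (a + w) (b + w)" unfolding e_def by (intro Min_le[OF fD]) blast
    then show False using d by simp
  qed
  ultimately show ?thesis using that by blast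
qed

text \<open>The admissible radii are bounded by the length of a lattice vector. Their supremum is
  admissible because the balls are open: two points in a ball of that radius already lie in a
  concentric ball of some admissible radius.\<close>

lemma packing_radius_properties:
  assumes A: "represents v M A"
  shows "packing_radius A > 0"
    and "\<And>c a b. a \<in> A \<inter> ball c (packing_radius A) \<Longrightarrow> b \<in> A \<inter> ball c (packing_radius A) \<Longrightarrow> a = b"
proof -
  define P where "P = (\<lambda>r. \<forall>c. \<forall>a\<in>A \<inter> ball c r. \<forall>b\<in>A \<inter> ball c r. a = b)"
  define r0 where "r0 = Sup {r. P r}"
  obtain m where m: "m \<in> A" using motif_ne[OF A] motif_subset[OF A] by blast
  have m': "m + v $ 1 \<in> A" "m + v $ 1 \<noteq> m"
    using lattice_invariantD[OF represents_invariant[OF A] basis_in_lattice] m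
      basis_vec_nonzero[OF represents_basis[OF A]] by auto
  have ub: "r \<le> dist m (m + v $ 1)" if "P r" for r
  proof (rule ccontr)
    assume "\<not> ?thesis"
    then have r: "m \<in> A \<inter> ball m r" "m + v $ 1 \<in> A \<inter> ball m r"
      using m m' by (auto simp: not_le intro: le_less_trans[OF zero_le_dist])
    have "m = m + v $ 1" using that[unfolded P_def, rule_format, OF r] .
    then show False using m' by simp
  qed
  then have bdd: "bdd_above {r. P r}" by (intro bdd_aboveI) auto
  obtain e where e: "e > 0" "\<And>a b. a \<in> A \<Longrightarrow> b \<in> A \<Longrightarrow> dist a b < e \<Longrightarrow> a = b"
    using represents_separated[OF A] by blast
  have "P (e / 2)" unfolding P_def
  proof (intro allI ballI)
    fix c a b assume "a \<in> A \<inter> ball c (e / 2)" "b \<in> A \<inter> ball c (e / 2)"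
    then have "a \<in> A" "b \<in> A" "dist c a < e / 2" "dist c b < e / 2" by auto
    moreover have "dist a b \<le> dist c a + dist c b" by (metis dist_commute dist_triangle)
    ultimately show "a = b" using e(2)[of a b] by linarith
  qed
  have "P r0" unfolding P_def
  proof (intro allI ballI)
    fix c a b assume a: "a \<in> A \<inter> ball c r0" and b: "b \<in> A \<inter> ball c r0"
    then have "max (dist c a) (dist c b) < Sup {r. P r}" by (auto simp: r0_def)
    then obtain r where "P r" "max (dist c a) (dist c b) < r"
      using less_cSup_iff[of "{r. P r}"] bdd \<open>P (e / 2)\<close> by blast
    then show "a = b" using a b unfolding P_def by (metis IntD1 IntI max_less_iff_conj mem_ball)
  qed
  have eq: "packing_radius A = r0"
    unfolding packing_radius_def P_def[symmetric]
  proof (rule Greatest_equality)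
    show "P r0" by fact
    show "y \<le> r0" if "P y" for y unfolding r0_def using that by (intro cSup_upper bdd) auto
  qed
  have "r0 \<ge> e / 2" unfolding r0_def using \<open>P (e / 2)\<close> by (intro cSup_upper bdd) auto
  then show "packing_radius A > 0" using e(1) eq by simp
  show "\<And>c a b. a \<in> A \<inter> ball c (packing_radius A) \<Longrightarrow> b \<in> A \<inter> ball c (packing_radius A) \<Longrightarrow> a = b"
    using \<open>P r0\<close> eq unfolding P_def by blast
qed

text \<open>The infimum of the admissible radii is attained because balls contain finitely many
  points of \<open>A\<close>. If no point were within the infimum of \<open>c\<close>, the least
  distance from \<open>c\<close> would exceed it by a positive amount, against the choice of an
  admissible radius in between.\<close>

lemma covering_radius_properties:
  assumes A: "represents v M A"
  shows "\<exists>a\<in>A. dist c a \<le> covering_radius A"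
proof -
  define P where "P = (\<lambda>r. \<forall>c. A \<inter> cball c r \<noteq> {})"
  define r0 where "r0 = Inf {r. P r}"
  obtain d where d: "d > 0" "unit_cell v \<subseteq> ball 0 d" using unit_cell_subset_ball by blast
  obtain m where m: "m \<in> M" using motif_ne[OF A] by blast
  have "P (2 * d)" unfolding P_def
  proof
    fix c
    obtain w where w: "w \<in> lattice_of v" "c + w \<in> unit_cell v"
      using lattice_translate_unique[OF represents_basis[OF A], of c] by blast
    have "norm (c + w) < d" "norm m < d" using w(2) d(2) m motif_cell[OF A] by auto
    then have "dist c (m + - w) \<le> 2 * d"
      using norm_triangle_ineq4[of "c + w" m] by (simp add: dist_norm algebra_simps)
    moreover have "m + - w \<in> A"
      using lattice_invariantD[OF represents_invariant[OF A] lattice_minus[OF w(1)]] m motif_subset[OF A] by blast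
    ultimately have "m + - w \<in> A \<inter> cball c (2 * d)" by simp
    then show "A \<inter> cball c (2 * d) \<noteq> {}" by blast
  qed
  have lb: "r \<ge> 0" if "P r" for r
  proof (rule ccontr)
    assume "\<not> r \<ge> 0"
    then have "cball (0::real^3) r = {}" by simp
    then show False using that unfolding P_def by blast
  qed
  then have bdd: "bdd_below {r. P r}" by (intro bdd_belowI) auto
  have "P r0" unfolding P_def
  proof (rule allI, rule notI)
    fix c assume empty: "A \<inter> cball c r0 = {}"
    define D where "D = dist c ` (A \<inter> cball c (r0 + 1))"
    have fD: "finite (insert (r0 + 1) D)" unfolding D_def using represents_finite_ball[OF A] by simp
    define \<mu> where "\<mu> = Min (insert (r0 + 1) D)"
    have "\<mu> \<in> insert (r0 + 1) D" unfolding \<mu>_def by (rule Min_in[OF fD]) simp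
    moreover have "x > r0" if "x \<in> D" for x
    proof -
      obtain a where "a \<in> A" "x = dist c a" using \<open>x \<in> D\<close> by (auto simp: D_def)
      then show ?thesis using empty by (metis disjoint_iff mem_cball not_le)
    qed
    ultimately have "\<mu> > r0" by auto
    then obtain r where r: "P r" "r < \<mu>"
      using cInf_less_iff[of "{r. P r}" \<mu>] bdd \<open>P (2 * d)\<close> unfolding r0_def by blast
    then obtain a where a: "a \<in> A" "dist c a \<le> r" unfolding P_def by (metis IntE ex_in_conv mem_cball)
    have "\<mu> \<le> r0 + 1" unfolding \<mu>_def by (rule Min_le[OF fD]) simp
    then have "dist c a \<in> D" unfolding D_def using a r(2) by simp
    then have "\<mu> \<le> dist c a" unfolding \<mu>_def by (intro Min_le[OF fD]) blast
    then show False using a(2) r(2) by simp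
  qed
  have "covering_radius A = r0"
    unfolding covering_radius_def P_def[symmetric]
  proof (rule Least_equality)
    show "P r0" by fact
    show "r0 \<le> y" if "P y" for y unfolding r0_def using that by (intro cInf_lower bdd) auto
  qed
  then have "A \<inter> cball c (covering_radius A) \<noteq> {}" using \<open>P r0\<close> unfolding P_def by blast
  then show ?thesis by auto
qed

text \<open>Each point of \<open>A\<close> is \<open>m - w\<close> for exactly one motif point and
  one lattice vector. The minus sign is chosen so that moving the point by \<open>- w\<close> can be
  traded for moving the variable of integration by \<open>w\<close>.\<close>

lemma nn_integral_motif_translates:
  fixes f :: "real^3 \<Rightarrow> ennreal"
  assumes A: "represents v M A"
  shows "(\<integral>\<^sup>+a. f a \<partial>count_space A) = (\<Sum>m\<in>M. \<integral>\<^sup>+w. f (m - w) \<partial>count_space (lattice_of v))"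
proof -
  have "indicator A a = (\<Sum>m\<in>M. indicator ((\<lambda>w. m - w) ` lattice_of v) a :: ennreal)" for a
  proof (cases "a \<in> A")
    case True
    then obtain m w where mw: "m \<in> M" "w \<in> lattice_of v" "a = m + w"
      using A by (auto simp: represents_def motif_translates_def)
    have "indicator ((\<lambda>w. m' - w) ` lattice_of v) a = (if m' = m then 1 else 0 :: ennreal)" if "m' \<in> M" for m'
    proof (cases "m' = m")
      case True
      have "a = m' - (- w)" using mw True by simp
      then have "a \<in> (\<lambda>w. m' - w) ` lattice_of v" using lattice_minus[OF mw(2)] by blast
      then show ?thesis using True by simp
    next
      case False
      have "a \<notin> (\<lambda>w. m' - w) ` lattice_of v"
      proof
        assume "a \<in> (\<lambda>w. m' - w) ` lattice_of v"
        then obtain w' where "w' \<in> lattice_of v" "m + w = m' - w'" using mw(3) by auto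
        then have "m' - m = w + w'" by (simp add: algebra_simps)
        then have "m' - m \<in> lattice_of v"
          using lattice_add[OF mw(2) \<open>w' \<in> lattice_of v\<close>] by simp
        then have "m' = m"
          using lattice_translate_unique2[OF represents_basis[OF A]] that mw(1) motif_cell[OF A] by blast
        then show False using False by simp
      qed
      then show ?thesis using False by simp
    qed
    then show ?thesis using True mw(1) motif_finite[OF A] by simp
  next
    case False
    have "a \<notin> (\<lambda>w. m - w) ` lattice_of v" if "m \<in> M" for m
    proof
      assume "a \<in> (\<lambda>w. m - w) ` lattice_of v"
      then obtain w where "w \<in> lattice_of v" "a = m + - w" by auto
      then show False
        using False lattice_invariantD[OF represents_invariant[OF A] lattice_minus] that motif_subset[OF A] by blast
    qed
    then show ?thesis using False by simp
  qed
  then have "(\<integral>\<^sup>+a. f a * indicator A a \<partial>count_space UNIV)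
     = (\<integral>\<^sup>+a. (\<Sum>m\<in>M. f a * indicator ((\<lambda>w. m - w) ` lattice_of v) a) \<partial>count_space UNIV)"
    by (simp add: sum_distrib_left)
  also have "\<dots> = (\<Sum>m\<in>M. \<integral>\<^sup>+a. f a * indicator ((\<lambda>w. m - w) ` lattice_of v) a \<partial>count_space UNIV)"
    by (rule nn_integral_sum) simp
  also have "\<dots> = (\<Sum>m\<in>M. \<integral>\<^sup>+w. f (m - w) \<partial>count_space (lattice_of v))"
  proof (rule sum.cong[OF refl])
    fix m
    have "(\<integral>\<^sup>+a. f a * indicator ((\<lambda>w. m - w) ` lattice_of v) a \<partial>count_space UNIV)
      = (\<integral>\<^sup>+a. f a \<partial>count_space ((\<lambda>w. m - w) ` lattice_of v))"
      by (simp add: nn_integral_count_space_indicator)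
    also have "\<dots> = (\<integral>\<^sup>+w. f (m - w) \<partial>count_space (lattice_of v))"
      by (rule nn_integral_bij_count_space[symmetric]) (auto simp: bij_betw_def inj_on_def)
    finally show "(\<integral>\<^sup>+a. f a * indicator ((\<lambda>w. m - w) ` lattice_of v) a \<partial>count_space UNIV)
        = (\<integral>\<^sup>+w. f (m - w) \<partial>count_space (lattice_of v))" .
  qed
  finally show ?thesis by (simp add: nn_integral_count_space_indicator)
qed

text \<open>A sum over all points, integrated over one cell, becomes a sum over the motif,
  integrated over the whole space. The hypothesis \<open>inv\<close> says that \<open>g\<close>
  depends only on relative positions, as far as lattice translations are concerned.\<close>

lemma nn_integral_motif_unfold:
  fixes g :: "real^3 \<Rightarrow> real^3 \<Rightarrow> ennreal"
  assumes A: "represents v M A" and g [measurable]: "\<And>m. g m \<in> borel_measurable borel"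
    and inv: "\<And>m w x. w \<in> lattice_of v \<Longrightarrow> g (m - w) x = g m (x + w)"
  shows "(\<integral>\<^sup>+x. (\<integral>\<^sup>+a. g a x \<partial>count_space A) * indicator (unit_cell v) x \<partial>lborel)
       = (\<Sum>m\<in>M. \<integral>\<^sup>+x. g m x \<partial>lborel)"
proof -
  note [measurable] = unit_cell_borel[OF represents_basis[OF A]]
  have "(\<integral>\<^sup>+x. (\<integral>\<^sup>+a. g a x \<partial>count_space A) * indicator (unit_cell v) x \<partial>lborel)
     = (\<integral>\<^sup>+x. (\<integral>\<^sup>+a. g a x * indicator (unit_cell v) x \<partial>count_space A) \<partial>lborel)"
    by (simp add: nn_integral_multc)
  also have "\<dots> = (\<integral>\<^sup>+a. (\<integral>\<^sup>+x. g a x * indicator (unit_cell v) x \<partial>lborel) \<partial>count_space A)"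
    by (rule nn_integral_count_space_nn_integral[where f = "\<lambda>a x. g a x * indicator (unit_cell v) x"])
      (simp_all add: represents_countable[OF A])
  also have "\<dots> = (\<Sum>m\<in>M. \<integral>\<^sup>+w. (\<integral>\<^sup>+x. g (m - w) x * indicator (unit_cell v) x \<partial>lborel) \<partial>count_space (lattice_of v))"
    by (rule nn_integral_motif_translates[OF A])
  also have "\<dots> = (\<Sum>m\<in>M. \<integral>\<^sup>+x. g m x \<partial>lborel)"
  proof (rule sum.cong[OF refl])
    fix m
    have "(\<integral>\<^sup>+w. (\<integral>\<^sup>+x. g (m - w) x * indicator (unit_cell v) x \<partial>lborel) \<partial>count_space (lattice_of v))
       = (\<integral>\<^sup>+x. (\<integral>\<^sup>+w. g (m - w) x * indicator (unit_cell v) x \<partial>count_space (lattice_of v)) \<partial>lborel)"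
      by (rule nn_integral_count_space_nn_integral[where f = "\<lambda>w x. g (m - w) x * indicator (unit_cell v) x", symmetric])
        (simp_all add: countable_lattice)
    also have "\<dots> = (\<integral>\<^sup>+x. (\<integral>\<^sup>+w. g m (x + w) * indicator (unit_cell v) x \<partial>count_space (lattice_of v)) \<partial>lborel)"
      by (intro nn_integral_cong) (simp add: inv)
    also have "\<dots> = (\<integral>\<^sup>+x. (\<integral>\<^sup>+w. g m (x + w) \<partial>count_space (lattice_of v)) * indicator (unit_cell v) x \<partial>lborel)"
      by (simp add: nn_integral_multc)
    also have "\<dots> = (\<integral>\<^sup>+x. g m x \<partial>lborel)"
      by (rule nn_integral_lattice_unfold[OF represents_basis[OF A] g])
    finally show "(\<integral>\<^sup>+w. (\<integral>\<^sup>+x. g (m - w) x * indicator (unit_cell v) x \<partial>lborel) \<partial>count_space (lattice_of v))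
       = (\<integral>\<^sup>+x. g m x \<partial>lborel)" .
  qed
  finally show ?thesis .
qed

lemma cover_set_subset:
  assumes "\<And>x. card {a \<in> A. x \<in> cball a s} \<le> card {a \<in> B. x \<in> cball a t}"
  shows "cover_set A k s \<subseteq> cover_set B k t"
  unfolding cover_set_def using order_trans[OF _ assms] by (intro Collect_mono) blast

lemma nn_integral_convolution_motif:
  fixes g :: "real^3 \<Rightarrow> ennreal"
  assumes A: "represents v M A" and [measurable]: "g \<in> borel_measurable borel"
  shows "(\<integral>\<^sup>+x. (\<integral>\<^sup>+a. g (x - a) \<partial>count_space A) * indicator (unit_cell v) x \<partial>lborel)
       = of_nat (card M) * (\<integral>\<^sup>+x. g x \<partial>lborel)"
proof -
  have "(\<integral>\<^sup>+x. (\<integral>\<^sup>+a. g (x - a) \<partial>count_space A) * indicator (unit_cell v) x \<partial>lborel)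
      = (\<Sum>m\<in>M. \<integral>\<^sup>+x. g (x - m) \<partial>lborel)"
    by (rule nn_integral_motif_unfold[OF A]) (simp_all add: algebra_simps)
  also have "\<dots> = (\<Sum>m\<in>M. \<integral>\<^sup>+x. g x \<partial>lborel)"
    using nn_integral_translate[of g "- _"] by simp
  finally show ?thesis by simp
qed

text \<open>The open balls of the packing radius around the points of \<open>A\<close> are disjoint,
  so the sum of their indicators is at most 1; integrating over the cell counts one ball for each
  motif point.\<close>

lemma point_density_le:
  assumes A: "represents v M A"
  shows "real (card M) * measure lborel (ball (0::real^3) (packing_radius A)) \<le> measure lborel (unit_cell v)"
proof -
  define r where "r = packing_radius A"
  have le1: "(\<integral>\<^sup>+a. indicator (ball 0 r) (x - a) \<partial>count_space A) \<le> 1" for x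
  proof -
    have eq: "(indicator (ball 0 r) (x - a) :: ennreal) = indicator (A \<inter> ball x r) a" if "a \<in> A" for a
      using that by (auto simp: indicator_def dist_norm norm_minus_commute)
    have sub: "\<exists>a. A \<inter> ball x r \<subseteq> {a}"
      using packing_radius_properties(2)[OF A, folded r_def, of _ x] by blast
    then have fin: "finite (A \<inter> ball x r)" "card (A \<inter> ball x r) \<le> 1"
      by (auto intro: finite_subset) (metis card_mono card.empty card_insert_disjoint empty_iff finite.emptyI finite_insert One_nat_def)
    have "(\<integral>\<^sup>+a. indicator (ball 0 r) (x - a) \<partial>count_space A) = (\<integral>\<^sup>+a. indicator (A \<inter> ball x r) a \<partial>count_space A)"
      by (intro nn_integral_cong) (simp add: eq)
    also have "\<dots> = of_nat (card (A \<inter> ball x r))"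
      using fin by (simp add: emeasure_count_space_finite)
    also have "\<dots> \<le> 1" using fin(2) by (metis of_nat_1 of_nat_le_iff)
    finally show ?thesis .
  qed
  have "of_nat (card M) * emeasure lborel (ball (0::real^3) r)
      = (\<integral>\<^sup>+x. (\<integral>\<^sup>+a. indicator (ball 0 r) (x - a) \<partial>count_space A) * indicator (unit_cell v) x \<partial>lborel)"
    by (subst nn_integral_convolution_motif[OF A]) (auto intro: borel_measurable_indicator borel_open)
  also have "\<dots> \<le> (\<integral>\<^sup>+x. 1 * indicator (unit_cell v) x \<partial>lborel)"
    by (intro nn_integral_mono mult_right_mono le1) auto
  also have "\<dots> = emeasure lborel (unit_cell v)"
    using unit_cell_borel[OF represents_basis[OF A]] by simp
  finally have "of_nat (card M) * emeasure lborel (ball (0::real^3) r) \<le> emeasure lborel (unit_cell v)" .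
  moreover have "emeasure lborel (ball (0::real^3) r) = ennreal (measure lborel (ball (0::real^3) r))"
    using emeasure_lborel_ball_finite[of "0::real^3" r] by (intro emeasure_eq_ennreal_measure) simp
  moreover have "emeasure lborel (unit_cell v) = ennreal (measure lborel (unit_cell v))"
    using emeasure_unit_cell[OF represents_basis[OF A]] by (intro emeasure_eq_ennreal_measure) simp
  ultimately show ?thesis
    by (simp add: r_def ennreal_of_nat_eq_real_of_nat ennreal_mult'[symmetric])
qed

text \<open>The balls of radius \<open>R\<close> around the points of \<open>A\<close> in \<open>cball x s\<close> cover \<open>cball x (s - R)\<close>.\<close>

lemma ball_covering_count:
  assumes A: "represents v M A" and R: "R > 0" "\<And>c. \<exists>a\<in>A. dist c a \<le> R" and s: "s \<ge> R"
  shows "(s - R) ^ 3 \<le> real (card (A \<inter> cball x s)) * R ^ 3"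
proof -
  have cb: "measure lborel (cball (c::real^3) r) = unit_ball_vol 3 * r ^ 3" if "r \<ge> 0" for r c
    using content_cball[OF that, of c] by simp
  have fm: "cball (c::real^3) r \<in> fmeasurable lborel" for c r by (simp add: fmeasurable_compact)
  have fin: "finite (A \<inter> cball x s)" by (rule represents_finite_ball[OF A])
  have "cball x (s - R) \<subseteq> (\<Union>a\<in>A \<inter> cball x s. cball a R)"
  proof
    fix y assume y: "y \<in> cball x (s - R)"
    obtain a where a: "a \<in> A" "dist y a \<le> R" using R(2) by blast
    then have "dist x a \<le> s" using y dist_triangle[of x a y] by simp
    then show "y \<in> (\<Union>a\<in>A \<inter> cball x s. cball a R)" using a by (auto simp: dist_commute)
  qed
  then have "measure lborel (cball x (s - R)) \<le> measure lborel (\<Union>a\<in>A \<inter> cball x s. cball a R)"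
    using fin fm by (intro measure_mono_fmeasurable fmeasurable.finite_UN) auto
  also have "\<dots> \<le> (\<Sum>a\<in>A \<inter> cball x s. measure lborel (cball a R))"
    using fm by (intro measure_UNION_le fin) (auto simp: fmeasurableD)
  also have "\<dots> = real (card (A \<inter> cball x s)) * (unit_ball_vol 3 * R ^ 3)"
    using R(1) by (simp add: cb)
  finally have "unit_ball_vol 3 * (s - R) ^ 3 \<le> unit_ball_vol 3 * (real (card (A \<inter> cball x s)) * R ^ 3)"
    using s by (simp add: cb mult_ac)
  moreover have "unit_ball_vol 3 > 0" by simp
  ultimately show ?thesis by (metis mult_le_cancel_left_pos)
qed

lemma coverage_mono_radius:
  assumes A: "represents v M A" and "s \<le> t"
  shows "coverage A k s \<le> coverage A k t"
proof (rule coverage_le_isometry[OF A A is_isometry_id])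
  have "card {a \<in> A. x \<in> cball a s} \<le> card {a \<in> A. x \<in> cball a t}" for x
    using \<open>s \<le> t\<close> by (intro card_mono represents_near_finite[OF A]) auto
  then show "(\<lambda>x. x) ` cover_set A k s \<subseteq> cover_set A k t"
    using cover_set_subset by simp
qed

text \<open>The factor 6 is the derivative factor 3 of the cube times the thickness
  \<open>2 * \<delta>\<close>. If \<open>\<delta> > t\<close>, the inner ball has negative radius
  and is empty, and the outer ball alone satisfies the bound.\<close>

lemma shell_measure_le:
  assumes d: "0 < \<delta>" "0 \<le> t"
  shows "measure lborel (cball (0::real^3) (t + \<delta>) - cball 0 (t - \<delta>)) \<le> 6 * unit_ball_vol 3 * \<delta> * (t + \<delta>)\<^sup>2"
proof -
  have cb: "measure lborel (cball (0::real^3) r) = unit_ball_vol 3 * r ^ 3" if "r \<ge> 0" for r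
    using content_cball[OF that, of "0::real^3"] by simp
  have fm: "cball (0::real^3) r \<in> fmeasurable lborel" for r by (simp add: fmeasurable_compact)
  have pos: "unit_ball_vol 3 > 0" by simp
  show ?thesis
  proof (cases "\<delta> \<le> t")
    case True
    have "measure lborel (cball (0::real^3) (t + \<delta>) - cball 0 (t - \<delta>))
       = measure lborel (cball (0::real^3) (t + \<delta>)) - measure lborel (cball (0::real^3) (t - \<delta>))"
      using d fm[of "t + \<delta>"] by (intro measure_Diff) (auto dest: fmeasurableD2)
    also have "\<dots> = unit_ball_vol 3 * ((t + \<delta>) ^ 3 - (t - \<delta>) ^ 3)"
      using True d by (simp add: cb right_diff_distrib)
    also have "\<dots> \<le> unit_ball_vol 3 * (6 * \<delta> * (t + \<delta>)\<^sup>2)"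
    proof (rule mult_left_mono)
      have "(t + \<delta>) ^ 3 - (t - \<delta>) ^ 3 = 6 * \<delta> * t\<^sup>2 + 2 * \<delta> ^ 3" by (simp add: power3_eq_cube power2_eq_square algebra_simps)
      moreover have "6 * \<delta> * (t + \<delta>)\<^sup>2 = 6 * \<delta> * t\<^sup>2 + 2 * \<delta> ^ 3 + (12 * \<delta>\<^sup>2 * t + 4 * \<delta> ^ 3)"
        by (simp add: power3_eq_cube power2_eq_square algebra_simps)
      moreover have "12 * \<delta>\<^sup>2 * t + 4 * \<delta> ^ 3 \<ge> 0" using d by simp
      ultimately show "(t + \<delta>) ^ 3 - (t - \<delta>) ^ 3 \<le> 6 * \<delta> * (t + \<delta>)\<^sup>2" by linarith
    qed (use pos in simp)
    finally show ?thesis by (simp add: mult_ac)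
  next
    case False
    have "measure lborel (cball (0::real^3) (t + \<delta>) - cball 0 (t - \<delta>)) \<le> measure lborel (cball (0::real^3) (t + \<delta>))"
      using fm by (intro measure_mono_fmeasurable) (auto simp: fmeasurableD)
    also have "\<dots> = unit_ball_vol 3 * ((t + \<delta>) * (t + \<delta>)\<^sup>2)"
      using d by (simp add: cb power3_eq_cube power2_eq_square)
    also have "\<dots> \<le> unit_ball_vol 3 * ((6 * \<delta>) * (t + \<delta>)\<^sup>2)"
      using False d pos by (intro mult_left_mono mult_right_mono) auto
    finally show ?thesis by (simp add: mult_ac)
  qed
qed

lemma coverage_increment_le:
  assumes A: "represents v M A" and d: "0 < \<delta>" "0 \<le> t"
  shows "coverage A k (t + \<delta>) - coverage A k (t - \<delta>) \<le> 6 * \<delta> * (t + \<delta>)\<^sup>2 / packing_radius A ^ 3"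
proof -
  define r where "r = packing_radius A"
  have r: "r > 0" unfolding r_def by (rule packing_radius_properties(1)[OF A])
  define Sh where "Sh = cball (0::real^3) (t + \<delta>) - cball 0 (t - \<delta>)"
  have Sh_b: "Sh \<in> sets borel" unfolding Sh_def by (intro sets.Diff borel_closed) auto
  have Sh_fm: "Sh \<in> fmeasurable lborel"
    by (rule fmeasurableI2[of "cball 0 (t + \<delta>)"]) (use Sh_b in \<open>auto simp: Sh_def fmeasurable_compact\<close>)
  define D where "D = cover_set A k (t + \<delta>) - cover_set A k (t - \<delta>)"
  have sub: "cover_set A k (t - \<delta>) \<subseteq> cover_set A k (t + \<delta>)"
  proof
    fix x assume "x \<in> cover_set A k (t - \<delta>)"
    moreover have "card {a \<in> A. x \<in> cball a (t - \<delta>)} \<le> card {a \<in> A. x \<in> cball a (t + \<delta>)}"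
      using d by (intro card_mono represents_near_finite[OF A]) auto
    ultimately show "x \<in> cover_set A k (t + \<delta>)" by (simp add: cover_set_def)
  qed
  have Db: "D \<in> sets borel" unfolding D_def using cover_set_borel[OF A] by blast
  have U: "measure lborel (unit_cell v) > 0" by (rule measure_unit_cell_pos[OF represents_basis[OF A]])
  note [measurable] = unit_cell_borel[OF represents_basis[OF A]] Sh_b Db
  \<comment> \<open>A point where the count rises to \<open>k\<close> has at least one new ball, so
    it lies in at least one shell. Overlaps of shells only enlarge the right side.\<close>
  have point: "indicator D x \<le> (\<integral>\<^sup>+a. indicator Sh (x - a) \<partial>count_space A)" for x
  proof (cases "x \<in> D")
    case True
    then have "card {a \<in> A. x \<in> cball a (t - \<delta>)} < card {a \<in> A. x \<in> cball a (t + \<delta>)}"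
      by (auto simp: D_def cover_set_def)
    then have "\<not> {a \<in> A. x \<in> cball a (t + \<delta>)} \<subseteq> {a \<in> A. x \<in> cball a (t - \<delta>)}"
      using card_mono[OF represents_near_finite[OF A]] by (meson not_le)
    then obtain a where a: "a \<in> A" "x - a \<in> Sh" by (auto simp: Sh_def dist_norm norm_minus_commute)
    have "indicator Sh (x - a) \<le> (\<integral>\<^sup>+a. (indicator Sh (x - a) :: ennreal) \<partial>count_space A)"
      by (rule nn_integral_ge_point[OF a(1)])
    then show ?thesis using True a(2) by simp
  qed simp
  have "emeasure lborel (D \<inter> unit_cell v) = (\<integral>\<^sup>+x. indicator D x * indicator (unit_cell v) x \<partial>lborel)"
    unfolding indicator_inter_arith[symmetric] by simp
  also have "\<dots> \<le> (\<integral>\<^sup>+x. (\<integral>\<^sup>+a. indicator Sh (x - a) \<partial>count_space A) * indicator (unit_cell v) x \<partial>lborel)"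
    by (intro nn_integral_mono mult_right_mono point) auto
  also have "\<dots> = of_nat (card M) * emeasure lborel Sh"
    by (subst nn_integral_convolution_motif[OF A]) auto
  finally have "ennreal (measure lborel (D \<inter> unit_cell v)) \<le> ennreal (real (card M) * measure lborel Sh)"
    using fmeasurable_Int_unit_cell[OF represents_basis[OF A] Db] Sh_fm
    by (simp add: emeasure_eq_measure2 ennreal_of_nat_eq_real_of_nat ennreal_mult')
  then have m1: "measure lborel (D \<inter> unit_cell v) \<le> real (card M) * measure lborel Sh"
    by (simp add: ennreal_le_iff)
  have "coverage A k (t + \<delta>) - coverage A k (t - \<delta>) = measure lborel (D \<inter> unit_cell v) / measure lborel (unit_cell v)"
  proof -
    note fm = fmeasurable_Int_unit_cell[OF represents_basis[OF A] cover_set_borel[OF A]]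
    have "D \<inter> unit_cell v = (cover_set A k (t + \<delta>) \<inter> unit_cell v) - (cover_set A k (t - \<delta>) \<inter> unit_cell v)"
      by (auto simp: D_def)
    then have "measure lborel (D \<inter> unit_cell v) = measure lborel (cover_set A k (t + \<delta>) \<inter> unit_cell v)
        - measure lborel (cover_set A k (t - \<delta>) \<inter> unit_cell v)"
      using sub by (simp only:) (intro measurable_measure_Diff fm fmeasurableD[OF fm]; blast)
    then show ?thesis by (simp add: coverage_eq_mean_density[OF A] mean_density_def diff_divide_distrib)
  qed
  also have "\<dots> \<le> real (card M) * measure lborel Sh / measure lborel (unit_cell v)"
    using U m1 by (intro divide_right_mono) auto
  also have "\<dots> \<le> measure lborel Sh / (unit_ball_vol 3 * r ^ 3)"
  proof -
    have "measure lborel (ball (0::real^3) r) = unit_ball_vol 3 * r ^ 3"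
      using content_ball[of r "0::real^3"] r by simp
    then have "real (card M) * (unit_ball_vol 3 * r ^ 3) \<le> measure lborel (unit_cell v)"
      using point_density_le[OF A] by (simp add: r_def)
    then have "real (card M) / measure lborel (unit_cell v) \<le> 1 / (unit_ball_vol 3 * r ^ 3)"
      using U r by (simp add: field_simps)
    from mult_right_mono[OF this, of "measure lborel Sh"] show ?thesis by simp
  qed
  also have "\<dots> \<le> (6 * unit_ball_vol 3 * \<delta> * (t + \<delta>)\<^sup>2) / (unit_ball_vol 3 * r ^ 3)"
    using shell_measure_le[OF d] r by (intro divide_right_mono) (auto simp: Sh_def)
  also have "\<dots> = 6 * \<delta> * (t + \<delta>)\<^sup>2 / r ^ 3"
  proof -
    have "unit_ball_vol (3::real) \<noteq> 0" by (metis less_irrefl unit_ball_vol_pos zero_le_numeral)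
    then show ?thesis by (simp add: field_simps)
  qed
  finally show ?thesis by (simp add: r_def)
qed

lemma coverage_0: "represents v M A \<Longrightarrow> coverage A 0 t = 1"
  using measure_unit_cell_pos[of v] by (simp add: coverage_eq_mean_density mean_density_def cover_set_def represents_basis)

text \<open>If there is an increment, some \<open>x\<close> has fewer than \<open>k\<close> points
  within \<open>t - \<delta>\<close>, and \<open>ball_covering_count\<close> gives
  \<open>t - \<delta> - R \<le> R * \<kappa>\<close> for the cube root \<open>\<kappa>\<close> of
  \<open>k\<close>. The unit added to the covering radius makes \<open>R \<ge> 1\<close>, so that
  \<open>\<delta>\<close> is absorbed.\<close>

lemma coverage_increment_le_powr:
  assumes A: "represents v M A" and d: "0 < \<delta>" "\<delta> \<le> 1" "0 \<le> t"
  shows "coverage A k (t + \<delta>) - coverage A k (t - \<delta>)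
    \<le> 96 * (covering_radius A + 1)\<^sup>2 / packing_radius A ^ 3 * \<delta> * real k powr (2 / 3)"
proof -
  define R where "R = covering_radius A + 1"
  define r where "r = packing_radius A"
  have r: "r > 0" unfolding r_def by (rule packing_radius_properties(1)[OF A])
  have cov: "\<exists>a\<in>A. dist c a \<le> R - 1" for c using covering_radius_properties[OF A] by (simp add: R_def)
  then have R: "R \<ge> 1" by (metis diff_ge_0_iff_ge order_trans zero_le_dist)
  have cov': "\<exists>a\<in>A. dist c a \<le> R" for c using cov[of c] by force
  have rhs: "0 \<le> 96 * R\<^sup>2 / r ^ 3 * \<delta> * real k powr (2 / 3)" using r d by simp
  show ?thesis
  proof (cases "k = 0 \<or> cover_set A k (t - \<delta>) = UNIV")
    case True
    have "coverage A k (t + \<delta>) - coverage A k (t - \<delta>) \<le> 0"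
    proof (cases "k = 0")
      case True
      then show ?thesis by (simp add: coverage_0[OF A])
    next
      case False
      then have "(\<lambda>x. x) ` cover_set A k (t + \<delta>) \<subseteq> cover_set A k (t - \<delta>)" using True by simp
      then show ?thesis using coverage_le_isometry[OF A A is_isometry_id] by simp
    qed
    then show ?thesis using rhs by (simp add: R_def r_def)
  next
    case False
    then have k: "real k \<ge> 1" by simp
    define \<kappa> where "\<kappa> = real k powr (1 / 3)"
    have \<kappa>: "\<kappa> \<ge> 1" unfolding \<kappa>_def using k by (simp add: ge_one_powr_ge_zero)
    have \<kappa>3: "\<kappa> ^ 3 = real k" unfolding \<kappa>_def using k by (simp add: powr_power)
    have \<kappa>2: "\<kappa>\<^sup>2 = real k powr (2 / 3)" unfolding \<kappa>_def using k by (simp add: powr_power)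
    obtain x where "x \<notin> cover_set A k (t - \<delta>)" using False by blast
    then have "card {a \<in> A. x \<in> cball a (t - \<delta>)} < k" unfolding cover_set_def by simp
    then have x: "card (A \<inter> cball x (t - \<delta>)) < k" by (simp only: near_points_eq)
    have "t - \<delta> - R \<le> R * \<kappa>"
    proof (cases "t - \<delta> \<ge> R")
      case True
      have "(t - \<delta> - R) ^ 3 \<le> real (card (A \<inter> cball x (t - \<delta>))) * R ^ 3"
        using R by (intro ball_covering_count[OF A _ cov' True]) simp
      also have "\<dots> \<le> real k * R ^ 3" using x R by (intro mult_right_mono) auto
      also have "\<dots> = (R * \<kappa>) ^ 3" by (simp add: power_mult_distrib \<kappa>3)
      finally have "(t - \<delta> - R) ^ Suc 2 \<le> (R * \<kappa>) ^ Suc 2" by simp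
      then show ?thesis by (rule power_le_imp_le_base) (use R \<kappa> in simp)
    next
      case False
      moreover have "0 \<le> R * \<kappa>" using R \<kappa> by simp
      ultimately show ?thesis by linarith
    qed
    moreover have "R \<le> R * \<kappa>" using R \<kappa> by simp
    \<comment> \<open>\<open>t + \<delta>\<close> is the sum of \<open>t - \<delta> - R\<close>,
      \<open>R\<close> and \<open>2 * \<delta>\<close>, bounded by one, one and two times
      \<open>R * \<kappa>\<close>. With the shell factor 6, the square of 4 yields the constant
      96.\<close>
    ultimately have "t + \<delta> \<le> 4 * (R * \<kappa>)" using d R by linarith
    then have "(t + \<delta>)\<^sup>2 \<le> (4 * (R * \<kappa>))\<^sup>2" using d by (intro power_mono) auto
    then have "6 * \<delta> * (t + \<delta>)\<^sup>2 / r ^ 3 \<le> 6 * \<delta> * (4 * (R * \<kappa>))\<^sup>2 / r ^ 3"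
      using d r by (intro divide_right_mono mult_left_mono) auto
    also have "\<dots> = 96 * R\<^sup>2 / r ^ 3 * \<delta> * real k powr (2 / 3)"
      by (simp add: power_mult_distrib \<kappa>2)
    finally show ?thesis
      using coverage_increment_le[OF A d(1) d(3), of k] by (simp add: R_def r_def)
  qed
qed

lemma coverage_perturbation:
  assumes A: "represents v M A" and Q: "represents v' M' Q"
    and \<gamma>: "bij_betw \<gamma> A Q" "\<And>a. a \<in> A \<Longrightarrow> norm (a - \<gamma> a) \<le> \<delta>"
  shows "coverage A k (t - \<delta>) \<le> coverage Q k t" "coverage Q k t \<le> coverage A k (t + \<delta>)"
proof -
  have le: "\<delta> \<ge> 0" using \<gamma>(2) motif_ne[OF A] motif_subset[OF A] by (metis all_not_in_conv norm_ge_zero order_trans subset_eq)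
  have inj: "inj_on \<gamma> A" and img: "\<gamma> ` A = Q" using \<gamma>(1) by (auto simp: bij_betw_def)
  have d: "dist a (\<gamma> a) \<le> \<delta>" if "a \<in> A" for a using \<gamma>(2)[OF that] by (simp add: dist_norm)
  have "card {a \<in> A. x \<in> cball a (t - \<delta>)} \<le> card {q \<in> Q. x \<in> cball q t}" for x
  proof (rule card_inj_on_le[of \<gamma>])
    show "\<gamma> ` {a \<in> A. x \<in> cball a (t - \<delta>)} \<subseteq> {q \<in> Q. x \<in> cball q t}"
    proof clarify
      fix a assume a: "a \<in> A" "x \<in> cball a (t - \<delta>)"
      have "dist (\<gamma> a) x \<le> dist a (\<gamma> a) + dist a x" by (metis dist_commute dist_triangle)
      then show "\<gamma> a \<in> Q \<and> x \<in> cball (\<gamma> a) t" using a d[OF a(1)] img by auto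
    qed
  qed (use inj represents_near_finite[OF Q] in \<open>auto intro: inj_on_subset\<close>)
  then have "(\<lambda>x. x) ` cover_set A k (t - \<delta>) \<subseteq> cover_set Q k t"
    using cover_set_subset by simp
  then show "coverage A k (t - \<delta>) \<le> coverage Q k t"
    by (rule coverage_le_isometry[OF A Q is_isometry_id])
  have "card {q \<in> Q. x \<in> cball q t} \<le> card {a \<in> A. x \<in> cball a (t + \<delta>)}" for x
  proof (rule surj_card_le[of _ _ \<gamma>])
    show "{q \<in> Q. x \<in> cball q t} \<subseteq> \<gamma> ` {a \<in> A. x \<in> cball a (t + \<delta>)}"
    proof clarify
      fix q assume q: "q \<in> Q" "x \<in> cball q t"
      then obtain a where a: "a \<in> A" "q = \<gamma> a" using img by blast
      have "dist a x \<le> dist a (\<gamma> a) + dist (\<gamma> a) x" by (rule dist_triangle)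
      then have "a \<in> {a \<in> A. x \<in> cball a (t + \<delta>)}" using a q d[OF a(1)] by auto
      then show "q \<in> \<gamma> ` {a \<in> A. x \<in> cball a (t + \<delta>)}" using a(2) by blast
    qed
  qed (rule represents_near_finite[OF A])
  then have "(\<lambda>x. x) ` cover_set Q k t \<subseteq> cover_set A k (t + \<delta>)"
    using cover_set_subset by simp
  then show "coverage Q k t \<le> coverage A k (t + \<delta>)"
    by (rule coverage_le_isometry[OF Q A is_isometry_id])
qed


text \<open>Twice the constant 96, as a density function is a difference of two coverages. The value
  1 for arguments that are no radii of a periodic set makes the function positive
  everywhere.\<close>

definition lipschitz_const :: "real \<Rightarrow> real \<Rightarrow> real" where
  "lipschitz_const r R = (if r > 0 \<and> R \<ge> 0 then 192 * (R + 1)\<^sup>2 / r ^ 3 else 1)"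

lemma lipschitz_const_pos: "lipschitz_const r R > 0"
  by (simp add: lipschitz_const_def)

lemma covering_radius_nonneg: "represents v M A \<Longrightarrow> covering_radius A \<ge> 0"
  using covering_radius_properties[of v M A 0] by (metis order_trans zero_le_dist)

lemma density_function_perturbation:
  assumes A: "represents v M A" and Q: "represents v' M' Q"
    and \<gamma>: "bij_betw \<gamma> A Q" "\<And>a. a \<in> A \<Longrightarrow> norm (a - \<gamma> a) \<le> \<delta>"
    and d: "0 < \<delta>" "\<delta> \<le> 1" and t: "0 \<le> t"
  shows "real (k + 1) powr (- (2 / 3)) * \<bar>density_function A k t - density_function Q k t\<bar>
    \<le> lipschitz_const (packing_radius A) (covering_radius A) * \<delta>"
proof -
  define C where "C = 96 * (covering_radius A + 1)\<^sup>2 / packing_radius A ^ 3"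
  have r: "packing_radius A > 0" by (rule packing_radius_properties(1)[OF A])
  have C: "C \<ge> 0" "lipschitz_const (packing_radius A) (covering_radius A) = 2 * C"
    using r covering_radius_nonneg[OF A] by (simp_all add: C_def lipschitz_const_def)
  have near: "\<bar>coverage A j t - coverage Q j t\<bar> \<le> C * \<delta> * real (k + 1) powr (2 / 3)" if "j \<le> k + 1" for j
  proof -
    have "coverage A j (t - \<delta>) \<le> coverage A j t" "coverage A j t \<le> coverage A j (t + \<delta>)"
      using d by (intro coverage_mono_radius[OF A]; simp)+
    then have "\<bar>coverage A j t - coverage Q j t\<bar> \<le> coverage A j (t + \<delta>) - coverage A j (t - \<delta>)"
      using coverage_perturbation[OF A Q \<gamma>, of j t] by linarith
    also have "\<dots> \<le> C * \<delta> * real j powr (2 / 3)"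
      unfolding C_def by (rule coverage_increment_le_powr[OF A d t])
    \<comment> \<open>Both orders \<open>k\<close> and \<open>k + 1\<close> are estimated by the
      larger one, whose power is exactly inverse to the weight in the distance of
      fingerprints.\<close>
    also have "\<dots> \<le> C * \<delta> * real (k + 1) powr (2 / 3)"
      using that C d by (intro mult_left_mono powr_mono2) auto
    finally show ?thesis .
  qed
  have "\<bar>density_function A k t - density_function Q k t\<bar>
      \<le> \<bar>coverage A k t - coverage Q k t\<bar> + \<bar>coverage A (k + 1) t - coverage Q (k + 1) t\<bar>"
    using t by (simp add: density_function_def)
  also have "\<dots> \<le> 2 * C * \<delta> * real (k + 1) powr (2 / 3)"
    using near[of k] near[of "k + 1"] by simp
  finally have "real (k + 1) powr (- (2 / 3)) * \<bar>density_function A k t - density_function Q k t\<bar>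
      \<le> real (k + 1) powr (- (2 / 3)) * (2 * C * \<delta> * real (k + 1) powr (2 / 3))"
    by (rule mult_left_mono) simp
  also have "\<dots> = 2 * C * \<delta> * (real (k + 1) powr (- (2 / 3)) * real (k + 1) powr (2 / 3))"
    by (simp only: mult_ac)
  also have "real (k + 1) powr (- (2 / 3)) * real (k + 1) powr (2 / 3) = 1"
    by (simp add: powr_add[symmetric])
  finally show ?thesis by (simp add: C(2))
qed

text \<open>The infimum over bijections need not be attained and may be 0, whereas the perturbation
  estimate needs an actual bijection and \<open>\<delta> > 0\<close>. So the bound is proved for
  every \<open>\<delta>\<close> strictly between the distance and 1, and then passed to the
  limit.\<close>

theorem fingerprint_dist_le_bottleneck:
  assumes "periodic_set A" "periodic_set Q" and lt: "bottleneck_dist A Q < ennreal 1"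
  shows "fingerprint_dist (density_fingerprint A) (density_fingerprint Q)
    \<le> ennreal (lipschitz_const (packing_radius A) (covering_radius A)) * bottleneck_dist A Q"
proof -
  obtain v M v' M' where A: "represents v M A" and Q: "represents v' M' Q"
    using assms by (auto simp: periodic_set_def)
  define C where "C = lipschitz_const (packing_radius A) (covering_radius A)"
  have C: "C > 0" unfolding C_def by (rule lipschitz_const_pos)
  have "bottleneck_dist A Q \<noteq> top" using lt by auto
  then obtain b where b: "b \<ge> 0" "bottleneck_dist A Q = ennreal b" by (cases "bottleneck_dist A Q") auto
  have b1: "b < 1" using lt b by (metis ennreal_less_iff)
  have key: "real (k + 1) powr (- (2 / 3)) * \<bar>density_function A k t - density_function Q k t\<bar> \<le> C * b"
    if t: "0 \<le> t" for k t
  proof -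
    let ?x = "real (k + 1) powr (- (2 / 3)) * \<bar>density_function A k t - density_function Q k t\<bar>"
    have "?x / C \<le> b"
    proof (rule dense_ge_bounded[OF b1])
      fix \<delta> assume d: "b < \<delta>" "\<delta> < 1"
      then have "bottleneck_dist A Q < ennreal \<delta>" using b by (simp add: ennreal_less_iff)
      then obtain \<gamma> where \<gamma>: "bij_betw \<gamma> A Q" "(SUP a\<in>A. ennreal (norm (a - \<gamma> a))) < ennreal \<delta>"
        unfolding bottleneck_dist_def INF_less_iff by blast
      have "norm (a - \<gamma> a) \<le> \<delta>" if "a \<in> A" for a
      proof -
        have "ennreal (norm (a - \<gamma> a)) \<le> (SUP a\<in>A. ennreal (norm (a - \<gamma> a)))" by (rule SUP_upper[OF that])
        also have "\<dots> < ennreal \<delta>" by (rule \<gamma>(2))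
        finally show ?thesis using d b by (simp add: ennreal_less_iff)
      qed
      then have "?x \<le> C * \<delta>"
        unfolding C_def using d b(1) by (intro density_function_perturbation[OF A Q \<gamma>(1) _ _ _ t]) auto
      then show "?x / C \<le> \<delta>" using C by (simp add: field_simps)
    qed
    then show ?thesis using C by (simp add: field_simps)
  qed
  have "fingerprint_dist (density_fingerprint A) (density_fingerprint Q) \<le> ennreal (C * b)"
    unfolding fingerprint_dist_def SUP_mult_left_ennreal density_fingerprint_def
  proof (intro SUP_least)
    fix k t assume "t \<in> {0::real..}"
    then show "ennreal (real (k + 1) powr (- (2 / 3))) * ennreal \<bar>density_function A k t - density_function Q k t\<bar>
        \<le> ennreal (C * b)"
      using key[of t k] by (subst ennreal_mult[symmetric]) (auto intro: ennreal_leI)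
  qed
  then show ?thesis using b C by (simp add: C_def ennreal_mult)
qed

section \<open>Distances between points from the second moment\<close>

text \<open>The density functions are consecutive differences of the coverages, which therefore
  follow from order 0, where the value is 1.\<close>

lemma coverage_eq_if_fingerprint_eq:
  assumes A: "represents v M A" and Q: "represents v' M' Q"
    and eq: "density_fingerprint A = density_fingerprint Q" and t: "0 \<le> t"
  shows "coverage A k t = coverage Q k t"
proof (induction k)
  case 0
  then show ?case by (simp add: coverage_0[OF A] coverage_0[OF Q])
next
  case (Suc k)
  have "density_function A k t = density_function Q k t"
    using eq by (metis density_fingerprint_def)
  then show ?case using Suc t by (simp add: density_function_def)
qed

text \<open>Balls of radius \<open>t\<close> can meet only if their centres are at most
  \<open>2 * t\<close> apart; this keeps the inner sum finite. The pair of a point with itself is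
  included.\<close>

definition pair_overlap :: "(real^3) set \<Rightarrow> (real^3) set \<Rightarrow> real \<Rightarrow> real" where
  "pair_overlap M A t = (\<Sum>m\<in>M. \<Sum>b\<in>A \<inter> cball m (2 * t). measure lborel (cball m t \<inter> cball b t))"

text \<open>The odd numbers are the weights that express the square of a count through the events
  that it is at least \<open>k\<close>, that is, the second moment through the coverages.\<close>

lemma square_eq_sum_odd: "n \<le> K \<Longrightarrow> (\<Sum>k\<in>{1..K}. if k \<le> n then 2 * k - 1 else 0) = n\<^sup>2" for n K :: nat
proof -
  assume "n \<le> K"
  have "(\<Sum>k\<in>{1..K}. if k \<le> n then 2 * k - 1 else 0) = (\<Sum>k\<in>{1..n}. 2 * k - 1)"
    using \<open>n \<le> K\<close> by (intro sum.mono_neutral_cong_right) auto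
  also have "\<dots> = n\<^sup>2" by (induction n) (simp_all add: power2_eq_square)
  finally show ?thesis .
qed

text \<open>The left side is the second moment of the number of balls containing a uniformly random
  point of the unit cell.\<close>

lemma second_moment_eq_pair_overlap:
  assumes A: "represents v M A" and c: "unit_cell v \<subseteq> ball 0 c" and K: "card (A \<inter> cball 0 (c + t)) \<le> K"
    and t: "0 \<le> t"
  shows "(\<Sum>k\<in>{1..K}. real (2 * k - 1) * coverage A k t) = pair_overlap M A t / measure lborel (unit_cell v)"
proof -
  define N where "N = (\<lambda>x. card {a \<in> A. x \<in> cball a t})"
  note [measurable] = unit_cell_borel[OF represents_basis[OF A]] cover_set_borel[OF A]
  have U: "measure lborel (unit_cell v) > 0" by (rule measure_unit_cell_pos[OF represents_basis[OF A]])
  \<comment> \<open>A bound on the count that is uniform over the cell makes the sum over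
    \<open>k\<close> finite; leaving \<open>K\<close> free allows the same bound for two periodic
    sets.\<close>
  have NK: "N x \<le> K" if "x \<in> unit_cell v" for x
  proof -
    have "norm x < c" using c that by auto
    then have "A \<inter> cball x t \<subseteq> A \<inter> cball 0 (c + t)"
      using norm_triangle_sub by (auto simp: dist_norm norm_minus_commute) (smt (verit) norm_triangle_sub)
    then have "card (A \<inter> cball x t) \<le> card (A \<inter> cball 0 (c + t))"
      by (intro card_mono represents_finite_ball[OF A])
    then show ?thesis using K unfolding N_def near_points_eq by linarith
  qed
  have g_eq: "indicator (cball m t) x * of_nat (N x)
      = (\<Sum>b\<in>A \<inter> cball m (2 * t). indicator (cball m t \<inter> cball b t) x :: ennreal)" for m x
  proof (cases "x \<in> cball m t")
    case True
    have "{a \<in> A. x \<in> cball a t} = {b \<in> A \<inter> cball m (2 * t). x \<in> cball b t}"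
    proof (intro set_eqI iffI)
      fix b assume b: "b \<in> {a \<in> A. x \<in> cball a t}"
      have "dist m b \<le> dist m x + dist b x" by (metis dist_commute dist_triangle)
      then show "b \<in> {b \<in> A \<inter> cball m (2 * t). x \<in> cball b t}" using b True by simp
    qed blast
    then have "of_nat (N x) = (\<Sum>b\<in>A \<inter> cball m (2 * t). if x \<in> cball b t then 1 else 0 :: ennreal)"
      using represents_finite_ball[OF A, of m "2 * t"] by (simp add: N_def sum.If_cases Int_def conj_ac)
    then show ?thesis using True by (simp add: indicator_def of_bool_def)
  qed (simp add: indicator_def)
  have g_meas: "(\<lambda>x. indicator (cball m t) x * of_nat (N x) :: ennreal) \<in> borel_measurable borel" for m
    unfolding g_eq by (intro borel_measurable_sum borel_measurable_indicator sets.Int borel_closed) auto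
  \<comment> \<open>One factor of the square is written as a sum over the points of \<open>A\<close>
    and unfolded; the other stays as a lattice-invariant weight and is expanded afterwards by
    \<open>g_eq\<close>.\<close>
  have "(\<integral>\<^sup>+x. of_nat ((N x)\<^sup>2) * indicator (unit_cell v) x \<partial>lborel)
      = (\<integral>\<^sup>+x. (\<integral>\<^sup>+a. indicator (cball a t) x * of_nat (N x) \<partial>count_space A) * indicator (unit_cell v) x \<partial>lborel)"
  proof (rule nn_integral_cong)
    fix x
    have "(\<integral>\<^sup>+a. indicator (cball a t) x * of_nat (N x) \<partial>count_space A)
      = (\<integral>\<^sup>+a. indicator {a \<in> A. x \<in> cball a t} a * of_nat (N x) \<partial>count_space A)"
      by (intro nn_integral_cong) (auto simp: indicator_def)
    also have "\<dots> = of_nat (N x) * of_nat (N x)"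
      using represents_near_finite[OF A, of x t] by (simp add: nn_integral_multc emeasure_count_space_finite N_def)
    finally show "of_nat ((N x)\<^sup>2) * indicator (unit_cell v) x
      = (\<integral>\<^sup>+a. indicator (cball a t) x * of_nat (N x) \<partial>count_space A) * (indicator (unit_cell v) x :: ennreal)"
      by (simp add: power2_eq_square)
  qed
  also have "\<dots> = (\<Sum>m\<in>M. \<integral>\<^sup>+x. indicator (cball m t) x * of_nat (N x) \<partial>lborel)"
  proof (rule nn_integral_motif_unfold[OF A g_meas])
    fix m w x assume w: "w \<in> lattice_of v"
    have "N (x + w) = N x" unfolding N_def by (rule card_near_translate[OF represents_invariant[OF A] w])
    moreover have "x \<in> cball (m - w) t \<longleftrightarrow> x + w \<in> cball m t" by (simp add: dist_norm algebra_simps)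
    ultimately show "indicator (cball (m - w) t) x * of_nat (N x) = indicator (cball m t) (x + w) * (of_nat (N (x + w)) :: ennreal)"
      by (simp add: indicator_def)
  qed
  also have "\<dots> = (\<Sum>m\<in>M. \<Sum>b\<in>A \<inter> cball m (2 * t). ennreal (measure lborel (cball m t \<inter> cball b t)))"
  proof (rule sum.cong[OF refl])
    fix m
    have fm: "cball m t \<inter> cball b t \<in> fmeasurable lborel" for b :: "real^3"
      by (intro fmeasurable_Int_cball borel_closed) auto
    have "(\<integral>\<^sup>+x. indicator (cball m t) x * of_nat (N x) \<partial>lborel)
        = (\<Sum>b\<in>A \<inter> cball m (2 * t). \<integral>\<^sup>+x. indicator (cball m t \<inter> cball b t) x \<partial>lborel)"
      unfolding g_eq using fm by (intro nn_integral_sum) (auto dest: fmeasurableD)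
    also have "\<dots> = (\<Sum>b\<in>A \<inter> cball m (2 * t). ennreal (measure lborel (cball m t \<inter> cball b t)))"
      using fm by (intro sum.cong refl) (simp add: fmeasurableD emeasure_eq_measure2)
    finally show "(\<integral>\<^sup>+x. indicator (cball m t) x * of_nat (N x) \<partial>lborel) = \<dots>" .
  qed
  also have "\<dots> = ennreal (pair_overlap M A t)"
    by (simp add: pair_overlap_def sum_nonneg sum_ennreal)
  finally have 1: "(\<integral>\<^sup>+x. of_nat ((N x)\<^sup>2) * indicator (unit_cell v) x \<partial>lborel) = ennreal (pair_overlap M A t)" .
  have "(\<integral>\<^sup>+x. of_nat ((N x)\<^sup>2) * indicator (unit_cell v) x \<partial>lborel)
     = (\<integral>\<^sup>+x. (\<Sum>k\<in>{1..K}. of_nat (2 * k - 1) * indicator (cover_set A k t \<inter> unit_cell v) x) \<partial>lborel)"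
  proof (rule nn_integral_cong)
    fix x
    show "of_nat ((N x)\<^sup>2) * indicator (unit_cell v) x
       = (\<Sum>k\<in>{1..K}. of_nat (2 * k - 1) * (indicator (cover_set A k t \<inter> unit_cell v) x :: ennreal))"
    proof (cases "x \<in> unit_cell v")
      case True
      have "(\<Sum>k\<in>{1..K}. of_nat (2 * k - 1) * (indicator (cover_set A k t \<inter> unit_cell v) x :: ennreal))
        = (\<Sum>k\<in>{1..K}. of_nat (if k \<le> N x then 2 * k - 1 else 0))"
        using True by (intro sum.cong refl) (auto simp: cover_set_def N_def)
      also have "\<dots> = of_nat ((N x)\<^sup>2)"
        unfolding of_nat_sum[symmetric] using square_eq_sum_odd[OF NK[OF True]] by simp
      finally show ?thesis using True by simp
    qed simp
  qed
  also have "\<dots> = (\<Sum>k\<in>{1..K}. \<integral>\<^sup>+x. of_nat (2 * k - 1) * indicator (cover_set A k t \<inter> unit_cell v) x \<partial>lborel)"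
    by (intro nn_integral_sum) measurable
  also have "\<dots> = (\<Sum>k\<in>{1..K}. ennreal (real (2 * k - 1) * measure lborel (cover_set A k t \<inter> unit_cell v)))"
  proof (rule sum.cong[OF refl])
    fix k
    have fm: "cover_set A k t \<inter> unit_cell v \<in> fmeasurable lborel"
      by (rule fmeasurable_Int_unit_cell[OF represents_basis[OF A] cover_set_borel[OF A]])
    show "(\<integral>\<^sup>+x. of_nat (2 * k - 1) * indicator (cover_set A k t \<inter> unit_cell v) x \<partial>lborel)
       = ennreal (real (2 * k - 1) * measure lborel (cover_set A k t \<inter> unit_cell v))"
      using fmeasurableD[OF fm]
      by (subst nn_integral_cmult) (auto simp: emeasure_eq_measure2[OF fm] ennreal_mult' ennreal_of_nat_eq_real_of_nat)
  qed
  also have "\<dots> = ennreal (\<Sum>k\<in>{1..K}. real (2 * k - 1) * measure lborel (cover_set A k t \<inter> unit_cell v))"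
    by (rule sum_ennreal) simp
  finally have "ennreal (pair_overlap M A t) = ennreal (\<Sum>k\<in>{1..K}. real (2 * k - 1) * measure lborel (cover_set A k t \<inter> unit_cell v))"
    using 1 by simp
  then have "pair_overlap M A t = (\<Sum>k\<in>{1..K}. real (2 * k - 1) * measure lborel (cover_set A k t \<inter> unit_cell v))"
    by (subst (asm) ennreal_inj) (auto simp: pair_overlap_def intro!: sum_nonneg)
  then show ?thesis
    by (simp add: coverage_eq_mean_density[OF A] mean_density_def sum_divide_distrib)
qed

lemma pair_overlap_eq_if_fingerprint_eq:
  assumes A: "represents v M A" and Q: "represents v' M' Q"
    and eq: "density_fingerprint A = density_fingerprint Q" and t: "0 \<le> t"
  shows "pair_overlap M A t / measure lborel (unit_cell v) = pair_overlap M' Q t / measure lborel (unit_cell v')"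
proof -
  obtain c where c: "c > 0" "unit_cell v \<subseteq> ball 0 c" using unit_cell_subset_ball by blast
  obtain c' where c': "c' > 0" "unit_cell v' \<subseteq> ball 0 c'" using unit_cell_subset_ball by blast
  define K where "K = max (card (A \<inter> cball 0 (c + t))) (card (Q \<inter> cball 0 (c' + t)))"
  show ?thesis
    using second_moment_eq_pair_overlap[OF A c(2) _ t, of K] second_moment_eq_pair_overlap[OF Q c'(2) _ t, of K]
      coverage_eq_if_fingerprint_eq[OF A Q eq t] by (simp add: K_def)
qed

section \<open>Lens volumes and the recovery of the distances\<close>

definition lens_volume :: "real \<Rightarrow> real \<Rightarrow> real" where
  "lens_volume d t = measure lborel (cball (0::real^3) t \<inter> cball (d *\<^sub>R axis 1 1) t)"

lemma measure_lens:
  "measure lborel (cball (m::real^3) t \<inter> cball b t) = lens_volume (dist m b) t"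
proof -
  have "norm (b - m) = norm (dist m b *\<^sub>R (axis 1 1 :: real^3))" by (simp add: dist_norm norm_minus_commute)
  then obtain L where L: "orthogonal_transformation L" "L (b - m) = dist m b *\<^sub>R (axis 1 1 :: real^3)"
    by (rule orthogonal_transformation_exists)
  define \<iota> where "\<iota> = (\<lambda>x. L (x - m))"
  have d: "dist (\<iota> x) (\<iota> y) = dist x y" for x y
    unfolding \<iota>_def dist_norm linear_diff[OF orthogonal_transformation_linear[OF L(1)], symmetric]
    using L(1) by (simp add: orthogonal_transformation_norm)
  then have iso: "is_isometry \<iota>" by (simp add: is_isometry_def)
  have \<iota>: "\<iota> m = 0" "\<iota> b = dist m b *\<^sub>R axis 1 1"
    using L(2) linear_0[OF orthogonal_transformation_linear[OF L(1)]] by (simp_all add: \<iota>_def)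
  have img: "\<iota> ` (cball m t \<inter> cball b t) = cball 0 t \<inter> cball (dist m b *\<^sub>R axis 1 1) t"
  proof (intro set_eqI iffI)
    fix y :: "real^3" assume y: "y \<in> cball 0 t \<inter> cball (dist m b *\<^sub>R axis 1 1) t"
    obtain x where x: "y = \<iota> x" using surjD[OF is_isometry_surj[OF iso]] by blast
    have "dist m x \<le> t" "dist b x \<le> t" using y d[of m x] d[of b x] unfolding \<iota> x by simp_all
    then show "y \<in> \<iota> ` (cball m t \<inter> cball b t)" using x by simp
  next
    fix y :: "real^3" assume "y \<in> \<iota> ` (cball m t \<inter> cball b t)"
    then obtain x where x: "y = \<iota> x" "dist m x \<le> t" "dist b x \<le> t" by auto
    then show "y \<in> cball 0 t \<inter> cball (dist m b *\<^sub>R axis 1 1) t"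
      using d[of m x] d[of b x] unfolding \<iota> x by simp
  qed
  have fm: "cball m t \<inter> cball b t \<in> fmeasurable lborel" for m b :: "real^3"
    by (intro fmeasurable_Int_cball borel_closed) auto
  have "measure lborel (cball m t \<inter> cball b t) = measure lebesgue (\<iota> ` (cball m t \<inter> cball b t))"
    using measure_isometry_image[OF iso fm] by simp
  also have "\<dots> = lens_volume (dist m b) t"
    unfolding img lens_volume_def using fmeasurableD[OF fm] by (rule measure_completion)
  finally show ?thesis .
qed

text \<open>The ball of radius \<open>t - d / 2\<close> around the midpoint of the centres lies in
  both balls.\<close>

lemma lens_volume_pos:
  assumes "0 \<le> d" "d < 2 * t" shows "lens_volume d t > 0"
proof -
  define e where "e = t - d / 2"
  define p :: "real^3" where "p = (d / 2) *\<^sub>R axis 1 1"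
  have e: "e > 0" using assms by (simp add: e_def)
  have "cball p e \<subseteq> cball 0 t \<inter> cball (d *\<^sub>R axis 1 1) t"
  proof
    fix x assume x: "x \<in> cball p e"
    have "dist 0 p = d / 2" using assms by (simp add: p_def)
    moreover have "dist (d *\<^sub>R axis 1 1) p = d / 2"
    proof -
      have "d *\<^sub>R axis 1 1 - p = (d / 2) *\<^sub>R (axis 1 1 :: real^3)"
        unfolding p_def scaleR_left_diff_distrib[symmetric] by simp
      then show ?thesis using assms by (simp add: dist_norm)
    qed
    ultimately have "dist 0 x \<le> t" "dist (d *\<^sub>R axis 1 1) x \<le> t"
      using x dist_triangle[of 0 x p] dist_triangle[of "d *\<^sub>R axis 1 1" x p] by (simp_all add: e_def)
    then show "x \<in> cball 0 t \<inter> cball (d *\<^sub>R axis 1 1) t" by simp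
  qed
  then have "measure lborel (cball p e) \<le> lens_volume d t"
    unfolding lens_volume_def
    by (intro measure_mono_fmeasurable fmeasurable_Int_cball borel_closed) auto
  moreover have "measure lborel (cball p e) > 0" using e by simp
  ultimately show ?thesis by linarith
qed

text \<open>Up to division by the volume of the cell, this is the radial distribution of the point
  set.\<close>

definition pair_weight :: "(real^3) set \<Rightarrow> (real^3) set \<Rightarrow> real \<Rightarrow> nat" where
  "pair_weight M A d = card {(m, b). m \<in> M \<and> b \<in> A \<and> dist m b = d}"

definition point_distances :: "(real^3) set \<Rightarrow> real set" where
  "point_distances A = {dist a b | a b. a \<in> A \<and> b \<in> A}"

lemma finite_pairs:
  assumes "represents v M A"
  shows "finite {(m, b). m \<in> M \<and> b \<in> A \<and> dist m b \<le> T}"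
proof (rule finite_subset)
  show "{(m, b). m \<in> M \<and> b \<in> A \<and> dist m b \<le> T} \<subseteq> Sigma M (\<lambda>m. A \<inter> cball m T)" by auto
  show "finite (Sigma M (\<lambda>m. A \<inter> cball m T))"
    using motif_finite[OF assms] represents_finite_ball[OF assms] by (intro finite_SigmaI)
qed

lemma point_distances_motif:
  assumes A: "represents v M A"
  shows "point_distances A = {dist m b | m b. m \<in> M \<and> b \<in> A}"
proof (intro set_eqI iffI)
  fix d assume "d \<in> point_distances A"
  then obtain a b where ab: "a \<in> A" "b \<in> A" "d = dist a b" by (auto simp: point_distances_def)
  obtain m w where mw: "m \<in> M" "w \<in> lattice_of v" "a = m + w"
    using A ab(1) by (auto simp: represents_def motif_translates_def)
  have "b + - w \<in> A" using lattice_invariantD[OF represents_invariant[OF A] lattice_minus[OF mw(2)]] ab(2) by blast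
  moreover have "dist m (b + - w) = d" using ab(3) mw(3) by (simp add: dist_norm algebra_simps)
  ultimately show "d \<in> {dist m b | m b. m \<in> M \<and> b \<in> A}" using mw(1) by blast
next
  fix d assume "d \<in> {dist m b | m b. m \<in> M \<and> b \<in> A}"
  then show "d \<in> point_distances A" unfolding point_distances_def using motif_subset[OF A] by blast
qed

lemma point_distances_iff_weight:
  assumes A: "represents v M A"
  shows "d \<in> point_distances A \<longleftrightarrow> pair_weight M A d \<noteq> 0"
proof -
  have "finite {(m, b). m \<in> M \<and> b \<in> A \<and> dist m b = d}"
    by (rule finite_subset[OF _ finite_pairs[OF A, of d]]) auto
  then show ?thesis unfolding point_distances_motif[OF A] pair_weight_def by auto
qed

lemma finite_point_distances_le:
  assumes A: "represents v M A"
  shows "finite {d \<in> point_distances A. d \<le> T}"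
proof (rule finite_subset)
  show "{d \<in> point_distances A. d \<le> T} \<subseteq> (\<lambda>(m, b). dist m b) ` {(m, b). m \<in> M \<and> b \<in> A \<and> dist m b \<le> T}"
    unfolding point_distances_motif[OF A] by force
  show "finite ((\<lambda>(m, b). dist m b) ` {(m, b). m \<in> M \<and> b \<in> A \<and> dist m b \<le> T})"
    using finite_pairs[OF A] by simp
qed

text \<open>The index set \<open>E\<close> may contain values that are not distances of
  \<open>A\<close>, as these have weight 0. One index set can therefore serve two sets of
  points.\<close>

lemma pair_overlap_eq_weights:
  assumes A: "represents v M A" and E: "finite E" "{d \<in> point_distances A. d \<le> 2 * t} \<subseteq> E" "\<And>d. d \<in> E \<Longrightarrow> d \<le> 2 * t"
  shows "pair_overlap M A t = (\<Sum>d\<in>E. real (pair_weight M A d) * lens_volume d t)"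
proof -
  define P where "P = {(m, b). m \<in> M \<and> b \<in> A \<and> dist m b \<le> 2 * t}"
  have P: "finite P" unfolding P_def by (rule finite_pairs[OF A])
  have PS: "P = Sigma M (\<lambda>m. A \<inter> cball m (2 * t))" by (auto simp: P_def)
  have "pair_overlap M A t = (\<Sum>(m, b)\<in>P. lens_volume (dist m b) t)"
    unfolding pair_overlap_def measure_lens PS
    using motif_finite[OF A] represents_finite_ball[OF A] by (intro sum.Sigma) auto
  also have "\<dots> = (\<Sum>d\<in>E. \<Sum>p\<in>{p \<in> P. (case p of (m, b) \<Rightarrow> dist m b) = d}. (case p of (m, b) \<Rightarrow> lens_volume (dist m b) t))"
  proof (rule sum.group[symmetric, OF P E(1)])
    show "(\<lambda>(m, b). dist m b) ` P \<subseteq> E"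
    proof
      fix d assume "d \<in> (\<lambda>(m, b). dist m b) ` P"
      then obtain m b where "m \<in> M" "b \<in> A" "dist m b \<le> 2 * t" "d = dist m b" by (auto simp: P_def)
      then have "d \<in> {d \<in> point_distances A. d \<le> 2 * t}" unfolding point_distances_motif[OF A] by blast
      then show "d \<in> E" using E(2) by (rule rev_subsetD)
    qed
  qed
  also have "\<dots> = (\<Sum>d\<in>E. real (pair_weight M A d) * lens_volume d t)"
  proof (rule sum.cong[OF refl])
    fix d assume d: "d \<in> E"
    have eq: "{p \<in> P. (case p of (m, b) \<Rightarrow> dist m b) = d} = {(m, b). m \<in> M \<and> b \<in> A \<and> dist m b = d}"
      using E(3)[OF d] by (auto simp: P_def)
    have "(\<Sum>p\<in>{(m, b). m \<in> M \<and> b \<in> A \<and> dist m b = d}. (case p of (m, b) \<Rightarrow> lens_volume (dist m b) t))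
       = (\<Sum>p\<in>{(m, b). m \<in> M \<and> b \<in> A \<and> dist m b = d}. lens_volume d t)"
      by (intro sum.cong refl) auto
    then show "(\<Sum>p\<in>{p \<in> P. (case p of (m, b) \<Rightarrow> dist m b) = d}. (case p of (m, b) \<Rightarrow> lens_volume (dist m b) t))
       = real (pair_weight M A d) * lens_volume d t"
      unfolding eq by (simp add: pair_weight_def)
  qed
  finally show ?thesis .
qed

text \<open>At the least distance \<open>d0\<close> where the normalised weights differ, take
  \<open>2 * t\<close> between \<open>d0\<close> and the next distance. The second moments agree,
  the shorter distances contribute equally, the longer ones not at all, and the lens at
  \<open>d0\<close> has positive volume; so the weights at \<open>d0\<close> agree after
  all.\<close>

theorem point_distances_eq_if_fingerprint_eq:
  assumes A: "represents v M A" and Q: "represents v' M' Q"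
    and eq: "density_fingerprint A = density_fingerprint Q"
  shows "point_distances A = point_distances Q"
proof -
  define WA where "WA = (\<lambda>d. real (pair_weight M A d) / measure lborel (unit_cell v))"
  define WQ where "WQ = (\<lambda>d. real (pair_weight M' Q d) / measure lborel (unit_cell v'))"
  have U: "measure lborel (unit_cell v) > 0" "measure lborel (unit_cell v') > 0"
    using measure_unit_cell_pos represents_basis A Q by blast+
  define D where "D = point_distances A \<union> point_distances Q"
  have fin: "finite {d \<in> D. d \<le> T}" for T
  proof -
    have "{d \<in> D. d \<le> T} = {d \<in> point_distances A. d \<le> T} \<union> {d \<in> point_distances Q. d \<le> T}"
      by (auto simp: D_def)
    then show ?thesis using finite_point_distances_le[OF A] finite_point_distances_le[OF Q] by simp
  qed
  have D: "d \<in> D \<longleftrightarrow> WA d \<noteq> 0 \<or> WQ d \<noteq> 0" for d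
    using U by (simp add: D_def WA_def WQ_def point_distances_iff_weight[OF A] point_distances_iff_weight[OF Q])
  have D0: "d \<ge> 0" if "d \<in> D" for d using that by (auto simp: D_def point_distances_def)
  have same: "WA d = WQ d" for d
  proof (rule ccontr)
    assume ne: "WA d \<noteq> WQ d"
    define B where "B = {e \<in> D. e \<le> d \<and> WA e \<noteq> WQ e}"
    have "finite B" by (rule finite_subset[OF _ fin[of d]]) (auto simp: B_def)
    moreover have "d \<in> B" using ne D[of d] by (auto simp: B_def)
    ultimately have d0: "Min B \<in> B" "\<And>e. e \<in> B \<Longrightarrow> Min B \<le> e" by (auto intro: Min_in)
    define d0 where "d0 = Min B"
    have d0': "d0 \<in> D" "WA d0 \<noteq> WQ d0" "d0 \<le> d" using d0(1) by (auto simp: B_def d0_def)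
    have less: "WA e = WQ e" if "e \<in> D" "e < d0" for e
      using d0(2)[of e] that d0'(3) by (auto simp: B_def d0_def)
    define G where "G = insert (d0 + 1) {e \<in> D. e \<le> d0 + 1 \<and> d0 < e}"
    have fG: "finite G" unfolding G_def by (rule finite.insertI, rule finite_subset[OF _ fin[of "d0 + 1"]]) auto
    have G1: "Min G > d0"
      using Min_in[OF fG] by (auto simp: G_def)
    \<comment> \<open>Then \<open>2 * t\<close> is the midpoint between \<open>d0\<close> and the
      next distance; \<open>d0 + 1\<close> stands in if there is none up to that value.\<close>
    define t where "t = (d0 + Min G) / 4"
    have t: "d0 < 2 * t" "2 * t < Min G" "0 \<le> t" using G1 D0[OF d0'(1)] by (auto simp: t_def)
    define E where "E = {e \<in> D. e \<le> 2 * t}"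
    have fE: "finite E" unfolding E_def by (rule fin)
    have le: "e \<le> d0" if "e \<in> E" for e
    proof (rule ccontr)
      assume "\<not> e \<le> d0"
      have "e \<in> D" "e \<le> 2 * t" using that by (auto simp: E_def)
      have "Min G \<le> d0 + 1" by (rule Min_le[OF fG]) (simp add: G_def)
      then have "e \<in> G" using \<open>e \<in> D\<close> \<open>e \<le> 2 * t\<close> t(2) \<open>\<not> e \<le> d0\<close> by (auto simp: G_def)
      then have "Min G \<le> e" by (rule Min_le[OF fG])
      then show False using \<open>e \<le> 2 * t\<close> t(2) by simp
    qed
    have A': "pair_overlap M A t / measure lborel (unit_cell v) = (\<Sum>e\<in>E. WA e * lens_volume e t)"
      by (subst pair_overlap_eq_weights[OF A fE]) (auto simp: E_def D_def WA_def sum_divide_distrib)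
    have Q': "pair_overlap M' Q t / measure lborel (unit_cell v') = (\<Sum>e\<in>E. WQ e * lens_volume e t)"
      by (subst pair_overlap_eq_weights[OF Q fE]) (auto simp: E_def D_def WQ_def sum_divide_distrib)
    have "0 = (\<Sum>e\<in>E. (WA e - WQ e) * lens_volume e t)"
      using pair_overlap_eq_if_fingerprint_eq[OF A Q eq t(3)] unfolding A' Q'
      by (simp add: sum_subtractf left_diff_distrib)
    also have "\<dots> = (\<Sum>e\<in>{d0}. (WA e - WQ e) * lens_volume e t)"
    proof (rule sum.mono_neutral_right[OF fE])
      show "{d0} \<subseteq> E" using d0'(1) t(1) by (simp add: E_def)
      show "\<forall>e\<in>E - {d0}. (WA e - WQ e) * lens_volume e t = 0"
        using le less by (force simp: E_def)
    qed
    finally have "(WA d0 - WQ d0) * lens_volume d0 t = 0" by simp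
    then show False using lens_volume_pos[OF D0[OF d0'(1)] t(1)] d0'(2) by simp
  qed
  have "d \<in> point_distances A \<longleftrightarrow> d \<in> point_distances Q" for d
  proof -
    have "WA d \<noteq> 0 \<longleftrightarrow> pair_weight M A d \<noteq> 0" "WQ d \<noteq> 0 \<longleftrightarrow> pair_weight M' Q d \<noteq> 0"
      using U by (simp_all add: WA_def WQ_def)
    then show ?thesis
      using same[of d] unfolding point_distances_iff_weight[OF A] point_distances_iff_weight[OF Q] by simp
  qed
  then show ?thesis by blast
qed

text \<open>The missing points would leave a gap of positive density in the union of small balls.\<close>

lemma eq_if_subset_fingerprint_eq:
  assumes A: "represents v M A" and Q: "periodic_set Q" and sub: "A \<subseteq> Q" and inv: "lattice_invariant v Q"
    and eq: "density_fingerprint A = density_fingerprint Q"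
  shows "A = Q"
proof (rule ccontr)
  assume "A \<noteq> Q"
  then obtain q where q: "q \<in> Q" "q \<notin> A" using sub by blast
  obtain v' M' where Q': "represents v' M' Q" using Q by (auto simp: periodic_set_def)
  have QR: "represents v (Q \<inter> unit_cell v) Q"
    using q(1) represents_finite_ball[OF Q'] by (intro represents_if_invariant[OF represents_basis[OF A] inv]) auto
  obtain e where e: "e > 0" "\<And>a b. a \<in> Q \<Longrightarrow> b \<in> Q \<Longrightarrow> dist a b < e \<Longrightarrow> a = b"
    using represents_separated[OF Q'] by blast
  \<comment> \<open>Distinct points of \<open>Q\<close> are at least \<open>e\<close> apart, so the
    ball of radius \<open>e / 3\<close> around \<open>q\<close> misses the balls of that radius
    around the points of \<open>A\<close>.\<close>
  define t where "t = e / 3"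
  have t: "t > 0" using e(1) by (simp add: t_def)
  define S where "S = cover_set Q 1 t - cover_set A 1 t"
  have cov1: "x \<in> cover_set B 1 t \<longleftrightarrow> (\<exists>a\<in>B. dist a x \<le> t)" if "represents w N B" for x w N B
    using represents_near_finite[OF that, of x t] by (auto simp: cover_set_def Suc_le_eq card_gt_0_iff)
  have subset: "cover_set A 1 t \<subseteq> cover_set Q 1 t" using cov1[OF A] cov1[OF QR] sub by blast
  have b: "S \<in> sets borel" unfolding S_def using cover_set_borel[OF A] cover_set_borel[OF QR] by blast
  have U: "measure lborel (unit_cell v) > 0" by (rule measure_unit_cell_pos[OF represents_basis[OF A]])
  have "mean_density v (cover_set Q 1 t) = mean_density v (cover_set A 1 t)"
    using coverage_eq_if_fingerprint_eq[OF A QR eq, of t 1] t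
    by (simp add: coverage_eq_mean_density[OF A] coverage_eq_mean_density[OF QR])
  then have "measure lborel (cover_set Q 1 t \<inter> unit_cell v) = measure lborel (cover_set A 1 t \<inter> unit_cell v)"
    using U by (simp add: mean_density_def)
  moreover have "measure lborel (S \<inter> unit_cell v)
      = measure lborel (cover_set Q 1 t \<inter> unit_cell v) - measure lborel (cover_set A 1 t \<inter> unit_cell v)"
  proof -
    have fmQ: "cover_set Q 1 t \<inter> unit_cell v \<in> fmeasurable lborel" and fmA: "cover_set A 1 t \<inter> unit_cell v \<in> fmeasurable lborel"
      using fmeasurable_Int_unit_cell[OF represents_basis[OF A]] cover_set_borel[OF A] cover_set_borel[OF QR] by blast+
    have "S \<inter> unit_cell v = (cover_set Q 1 t \<inter> unit_cell v) - (cover_set A 1 t \<inter> unit_cell v)"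
      by (auto simp: S_def)
    then show ?thesis
      using subset by (simp only:) (intro measurable_measure_Diff fmQ fmeasurableD[OF fmA]; blast)
  qed
  ultimately have S0: "measure lborel (S \<inter> unit_cell v) = 0" by simp
  have invS: "lattice_invariant v S"
    using cover_set_invariant[OF inv, of 1 t] cover_set_invariant[OF represents_invariant[OF A], of 1 t]
    unfolding lattice_invariant_def S_def by blast
  obtain c where c: "c > 0" "unit_cell v \<subseteq> ball 0 c" using unit_cell_subset_ball by blast
  \<comment> \<open>An invariant set that is null in the cell is null in every ball, which
    contradicts the ball around \<open>q\<close>.\<close>
  have "measure lborel (S \<inter> cball 0 (norm q + t)) \<le> 0"
    using measure_Int_cball_lattice_count(1)[OF represents_basis[OF A] c(2) invS b, of "norm q + t"] S0 by simp
  moreover have "cball q t \<subseteq> S \<inter> cball 0 (norm q + t)"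
  proof
    fix x assume x: "x \<in> cball q t"
    have "norm x \<le> norm q + t" using x norm_triangle_sub[of x q] by (simp add: dist_norm norm_minus_commute)
    moreover have "x \<in> cover_set Q 1 t" unfolding cov1[OF QR] using q(1) x by auto
    moreover have "x \<notin> cover_set A 1 t"
    proof
      assume "x \<in> cover_set A 1 t"
      then obtain a where a: "a \<in> A" "dist a x \<le> t" unfolding cov1[OF A] by blast
      have "dist a q \<le> dist a x + dist q x" by (metis dist_commute dist_triangle)
      then have "dist a q < e" using a(2) x e(1) by (simp add: t_def)
      then show False using e(2)[of a q] a(1) q sub by blast
    qed
    ultimately show "x \<in> S \<inter> cball 0 (norm q + t)" by (simp add: S_def)
  qed
  then have "measure lborel (cball q t) \<le> measure lborel (S \<inter> cball 0 (norm q + t))"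
    by (intro measure_mono_fmeasurable fmeasurable_Int_cball b) auto
  moreover have "measure lborel (cball q t) > 0" using t by simp
  ultimately show False by linarith
qed

section \<open>Reconstruction of generic configurations\<close>

definition config_index :: "nat \<Rightarrow> (3 + nat) set" where
  "config_index m = UNIV <+> {..<m}"

definition config_vec :: "real^3^3 \<Rightarrow> (nat \<Rightarrow> real^3) \<Rightarrow> 3 + nat \<Rightarrow> real^3" where
  "config_vec v x = case_sum (\<lambda>i. v $ i) x"

text \<open>A difference of two unit vectors: a root of type A, or zero if
  \<open>k = l\<close>.\<close>

definition root_vec :: "nat \<Rightarrow> nat \<Rightarrow> nat \<Rightarrow> int" where
  "root_vec k l a = (if a = k then 1 else 0) - (if a = l then 1 else 0)"

text \<open>The coefficient vectors of differences of two points of a periodic set.\<close>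

definition difference_coeffs :: "nat \<Rightarrow> (3 + nat \<Rightarrow> int) \<Rightarrow> bool" where
  "difference_coeffs m c \<longleftrightarrow> (\<exists>k<m. \<exists>l<m. \<forall>a<m. c (Inr a) = root_vec k l a)"

abbreviation config_comb :: "nat \<Rightarrow> real^3^3 \<Rightarrow> (nat \<Rightarrow> real^3) \<Rightarrow> (3 + nat \<Rightarrow> int) \<Rightarrow> real^3" where
  "config_comb m v x \<equiv> int_comb (config_index m) (config_vec v x)"

abbreviation config_set :: "nat \<Rightarrow> real^3^3 \<Rightarrow> (nat \<Rightarrow> real^3) \<Rightarrow> (real^3) set" where
  "config_set m v x \<equiv> motif_translates v (x ` {..<m})"

lemma finite_config_index: "finite (config_index m)"
  by (simp add: config_index_def)

lemma config_index_iff: "Inl i \<in> config_index m" "Inr a \<in> config_index m \<longleftrightarrow> a < m"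
  by (auto simp: config_index_def)

lemma config_comb_eq:
  "config_comb m v x c = lattice_vec v (\<lambda>i. c (Inl i)) + (\<Sum>a<m. of_int (c (Inr a)) *\<^sub>R x a)"
  by (simp add: int_comb_def config_index_def config_vec_def lattice_vec_def sum.Plus)

lemma sum_root_vec:
  assumes "k < m" "l < m"
  shows "(\<Sum>a<m. of_int (root_vec k l a) *\<^sub>R (x a :: real^3)) = x k - x l"
proof -
  have "of_int (root_vec k l a) *\<^sub>R x a = (if a = k then x a else 0) - (if a = l then x a else 0)" for a
    by (simp add: root_vec_def)
  then show ?thesis using assms by (simp add: sum_subtractf)
qed

lemma config_comb_root:
  assumes "k < m" "l < m" "\<forall>a<m. c (Inr a) = s * root_vec k l a"
  shows "config_comb m v x c = lattice_vec v (\<lambda>i. c (Inl i)) + of_int s *\<^sub>R (x k - x l)"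
proof -
  have "(\<Sum>a<m. of_int (c (Inr a)) *\<^sub>R x a) = (\<Sum>a<m. of_int s *\<^sub>R (of_int (root_vec k l a) *\<^sub>R x a))"
    using assms(3) by (intro sum.cong) auto
  also have "\<dots> = of_int s *\<^sub>R (x k - x l)"
    unfolding scaleR_sum_right[symmetric] sum_root_vec[OF assms(1,2)] ..
  finally show ?thesis by (simp add: config_comb_eq)
qed

lemma difference_coeffs_minus: "difference_coeffs m c \<Longrightarrow> difference_coeffs m (\<lambda>a. - c a)"
proof -
  assume "difference_coeffs m c"
  then obtain k l where "k < m" "l < m" "\<forall>a<m. c (Inr a) = root_vec k l a"
    by (auto simp: difference_coeffs_def)
  then have "\<forall>a<m. - c (Inr a) = root_vec l k a" by (simp add: root_vec_def)
  then show ?thesis using \<open>k < m\<close> \<open>l < m\<close> by (auto simp: difference_coeffs_def)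
qed

lemma config_set_eq: "config_set m v x = {x k + lattice_vec v n | k n. k < m}"
  by (auto simp: motif_translates_def lattice_of_eq)

lemma point_distances_config:
  "point_distances (config_set m v x) = {norm (config_comb m v x c) | c. difference_coeffs m c}"
proof (intro set_eqI iffI)
  fix d assume "d \<in> point_distances (config_set m v x)"
  then obtain k l n n' where kl: "k < m" "l < m" and d: "d = dist (x k + lattice_vec v n) (x l + lattice_vec v n')"
    unfolding point_distances_def config_set_eq by blast
  define c :: "3 + nat \<Rightarrow> int" where "c = case_sum (\<lambda>i. n i + - n' i) (root_vec k l)"
  have "config_comb m v x c = lattice_vec v (\<lambda>i. c (Inl i)) + of_int 1 *\<^sub>R (x k - x l)"
    by (rule config_comb_root[OF kl]) (simp add: c_def)
  also have "lattice_vec v (\<lambda>i. c (Inl i)) = lattice_vec v n - lattice_vec v n'"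
    by (simp add: c_def lattice_vec_def scaleR_left_diff_distrib sum_subtractf)
  finally have "config_comb m v x c = (x k + lattice_vec v n) - (x l + lattice_vec v n')" by simp
  then have "d = norm (config_comb m v x c)" unfolding d dist_norm by simp
  moreover have "difference_coeffs m c" using kl by (auto simp: difference_coeffs_def c_def)
  ultimately show "d \<in> {norm (config_comb m v x c) | c. difference_coeffs m c}" by blast
next
  fix d assume "d \<in> {norm (config_comb m v x c) | c. difference_coeffs m c}"
  then obtain c k l where kl: "k < m" "l < m" and c: "\<forall>a<m. c (Inr a) = 1 * root_vec k l a"
    and d: "d = norm (config_comb m v x c)" by (auto simp: difference_coeffs_def)
  have "d = dist (x k + lattice_vec v (\<lambda>i. c (Inl i))) (x l + lattice_vec v (\<lambda>_. 0))"
    unfolding d config_comb_root[OF kl c] dist_norm by (simp add: lattice_vec_def algebra_simps)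
  then show "d \<in> point_distances (config_set m v x)"
    unfolding point_distances_def config_set_eq using kl by blast
qed

lemma represents_config:
  assumes "(v, x) \<in> config_tuples m" "m \<ge> 1"
  shows "represents v (x ` {..<m}) (config_set m v x)"
proof -
  have "x ` {..<m} \<subseteq> unit_cell v" "is_basis v" using assms(1) by (auto simp: config_tuples_def)
  moreover have "0 \<in> {..<m}" using assms(2) by simp
  ultimately show ?thesis unfolding represents_def is_motif_def by blast
qed

section \<open>Roots whose differences are roots\<close>

lemma root_vec_self: "root_vec k k a = 0"
  by (simp add: root_vec_def)

text \<open>If heads and tails both differ, the difference has entries of at least 1 at
  \<open>k\<close> and at \<open>l'\<close>, with the value 2 if these coincide. A root has just one
  positive entry, and it equals 1.\<close>

lemma root_vec_common:
  assumes "k \<noteq> l" "k' \<noteq> l'" "k < m" "l < m" "k' < m" "l' < m"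
    and "p < m" "q < m" "\<forall>a<m. root_vec k l a - root_vec k' l' a = root_vec p q a"
  shows "k = k' \<or> l = l'"
proof (rule ccontr)
  assume ne: "\<not> ?thesis"
  have 1: "root_vec k l k - root_vec k' l' k = root_vec p q k" using assms by blast
  have 2: "root_vec k l l' - root_vec k' l' l' = root_vec p q l'" using assms by blast
  have "root_vec p q k = 1 + (if k = l' then 1 else 0)"
    unfolding 1[symmetric] using ne assms(1) by (simp add: root_vec_def)
  moreover have "root_vec p q l' = 1 + (if k = l' then 1 else 0)"
    unfolding 2[symmetric] using ne assms(2) by (simp add: root_vec_def)
  moreover have ge: "root_vec p q a \<ge> 1 \<Longrightarrow> a = p" and le: "root_vec p q a \<le> 1" for a
    by (simp_all add: root_vec_def split: if_splits)
  ultimately have "k = p" "l' = p" "k \<noteq> l'"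
    using ge[of k] ge[of l'] le[of k] by (simp_all split: if_splits)
  then show False by simp
qed

lemma root_vec_star:
  fixes D :: "'j \<Rightarrow> nat \<Rightarrow> int"
  assumes m: "0 < m"
    and root: "\<And>j. j \<in> J \<Longrightarrow> \<exists>k<m. \<exists>l<m. \<forall>a<m. D j a = root_vec k l a"
    and diff: "\<And>i j. i \<in> J \<Longrightarrow> j \<in> J \<Longrightarrow> \<exists>k<m. \<exists>l<m. \<forall>a<m. D i a - D j a = root_vec k l a"
  shows "\<exists>k0<m. \<exists>s. (s = 1 \<or> s = -1) \<and> (\<forall>j\<in>J. \<exists>k<m. \<forall>a<m. D j a = s * root_vec k k0 a)"
proof -
  obtain hd tl where ht: "\<And>j. j \<in> J \<Longrightarrow> hd j < m \<and> tl j < m \<and> (\<forall>a<m. D j a = root_vec (hd j) (tl j) a)"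
    using root by metis
  define N where "N = {j \<in> J. hd j \<noteq> tl j}"
  have share: "hd i = hd j \<or> tl i = tl j" if ij: "i \<in> N" "j \<in> N" for i j
  proof -
    obtain p q where pq: "p < m" "q < m" "\<forall>a<m. D i a - D j a = root_vec p q a"
      using diff[of i j] ij by (auto simp: N_def)
    then have "\<forall>a<m. root_vec (hd i) (tl i) a - root_vec (hd j) (tl j) a = root_vec p q a"
      using ht that by (auto simp: N_def)
    then show ?thesis using root_vec_common[of "hd i" "tl i" "hd j" "tl j" m p q] ht that pq by (auto simp: N_def)
  qed
  have zero: "\<forall>a<m. D j a = s * root_vec k k a" if "j \<in> J" "j \<notin> N" for j k and s :: int
    using ht[OF that(1)] that by (auto simp: N_def root_vec_self)
  show ?thesis
  proof (cases "N = {}")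
    case True
    then have "\<forall>j\<in>J. \<exists>k<m. \<forall>a<m. D j a = 1 * root_vec k 0 a" using zero[of _ 1 0] m by blast
    then show ?thesis using m by blast
  next
    case False
    then obtain j0 where j0: "j0 \<in> N" by blast
    \<comment> \<open>Heads are only compared with heads and tails with tails. A member with another
      tail than \<open>j0\<close> and one with another head would share neither, so the pairwise
      condition makes one end common to all. Zero vectors fit every such star.\<close>
    have "(\<forall>j\<in>N. tl j = tl j0) \<or> (\<forall>j\<in>N. hd j = hd j0)"
      using share j0 by metis
    then show ?thesis
    proof
      assume tl: "\<forall>j\<in>N. tl j = tl j0"
      have "\<exists>k<m. \<forall>a<m. D j a = 1 * root_vec k (tl j0) a" if "j \<in> J" for j
      proof (cases "j \<in> N")
        case True
        then show ?thesis using ht[OF that] tl by auto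
      next
        case False
        then show ?thesis using zero[OF that False, of 1 "tl j0"] ht j0 N_def by blast
      qed
      moreover have "tl j0 < m" using ht j0 N_def by blast
      ultimately show ?thesis by blast
    next
      assume hd: "\<forall>j\<in>N. hd j = hd j0"
      have "\<exists>k<m. \<forall>a<m. D j a = -1 * root_vec k (hd j0) a" if "j \<in> J" for j
      proof (cases "j \<in> N")
        case True
        then have "\<forall>a<m. D j a = -1 * root_vec (tl j) (hd j0) a"
          using ht[OF that] hd by (auto simp: root_vec_def)
        then show ?thesis using ht[OF that] by blast
      next
        case False
        then show ?thesis using zero[OF that False, of "-1" "hd j0"] ht j0 N_def by blast
      qed
      moreover have "hd j0 < m" using ht j0 N_def by blast
      ultimately show ?thesis by blast
    qed
  qed
qed

text \<open>A combinatorial matching of the tuple \<open>(w, y)\<close> into \<open>(v, x)\<close>: it prescribes the images of the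
  basis vectors and of the differences of motif points under an isometry.\<close>

definition matching :: "nat \<Rightarrow> nat \<Rightarrow> (3 \<Rightarrow> 3 + nat \<Rightarrow> int) \<Rightarrow> (nat \<Rightarrow> 3 + nat \<Rightarrow> int) \<Rightarrow> bool" where
  "matching m n B c \<longleftrightarrow> (\<forall>i. \<forall>a<m. B i (Inr a) = 0) \<and>
     (\<exists>k0<m. \<exists>s. (s = 1 \<or> s = -1) \<and> (\<forall>j<n. \<exists>k<m. \<forall>a<m. c j (Inr a) = s * root_vec k k0 a))"

text \<open>A vector is determined by its inner products with a basis, so these equations fix an
  orthogonal map together with the images of all \<open>y j - y 0\<close>.\<close>

definition matching_isometric ::
  "nat \<Rightarrow> nat \<Rightarrow> (3 \<Rightarrow> 3 + nat \<Rightarrow> int) \<Rightarrow> (nat \<Rightarrow> 3 + nat \<Rightarrow> int) \<Rightarrow>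
    real^3^3 \<Rightarrow> (nat \<Rightarrow> real^3) \<Rightarrow> real^3^3 \<Rightarrow> (nat \<Rightarrow> real^3) \<Rightarrow> bool" where
  "matching_isometric m n B c v x w y \<longleftrightarrow>
     (\<forall>i j. w $ i \<bullet> w $ j = config_comb m v x (B i) \<bullet> config_comb m v x (B j)) \<and>
     (\<forall>j<n. \<forall>i. (y j - y 0) \<bullet> w $ i = config_comb m v x (c j) \<bullet> config_comb m v x (B i))"

text \<open>\<open>distance_structure\<close> is applied to all differences of points of the second
  set. Its signed coefficients describe one orthogonal map \<open>L\<close>; by independence the
  linearity of \<open>L\<close> passes to the coefficients, so the motif parts form roots with root
  differences and have a common end.\<close>

lemma matching_exists:
  assumes m: "0 < m" and gi: "gram_independent (config_index m) (config_vec v x)"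
    and w: "is_basis w" and n: "0 < n"
    and sub: "point_distances (config_set n w y) \<subseteq> point_distances (config_set m v x)"
  shows "\<exists>B c. matching m n B c \<and> matching_isometric m n B c v x w y \<and>
    (\<forall>j<n. norm (y j - y 0) = norm (config_comb m v x (c j)))"
proof -
  define \<Delta> where "\<Delta> = {a - b | a b. a \<in> config_set n w y \<and> b \<in> config_set n w y}"
  have inv: "lattice_invariant w (config_set n w y)" by (rule lattice_invariant_motif_translates)
  have y_in: "y j \<in> config_set n w y" if "j < n" for j
    unfolding config_set_eq using that by (force simp: lattice_vec_def intro: exI[of _ "\<lambda>_. 0"])
  have "\<exists>B c. (\<forall>k. difference_coeffs m (B k) \<and> (\<exists>c'. difference_coeffs m c' \<and> (\<forall>a\<in>config_index m. c' a = 2 * B k a))) \<and>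
     (\<forall>k l. w $ k \<bullet> w $ l = config_comb m v x (B k) \<bullet> config_comb m v x (B l)) \<and>
     (\<forall>z\<in>\<Delta>. difference_coeffs m (c z) \<and> norm z = norm (config_comb m v x (c z)) \<and>
        (\<forall>k. z \<bullet> w $ k = config_comb m v x (c z) \<bullet> config_comb m v x (B k)))"
  proof (rule distance_structure[OF finite_config_index gi, where L = "lattice_of w"])
    show "lattice_of w \<subseteq> \<Delta>"
    proof
      fix u assume u: "u \<in> lattice_of w"
      have "u = (y 0 + u) - y 0" by simp
      then show "u \<in> \<Delta>" unfolding \<Delta>_def using y_in[OF n] lattice_invariantD[OF inv u] by blast
    qed
    show "z + \<mu> \<in> \<Delta>" if z: "z \<in> \<Delta>" "\<mu> \<in> lattice_of w" for z \<mu>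
    proof -
      obtain a b where ab: "a \<in> config_set n w y" "b \<in> config_set n w y" "z = a - b" using z(1) by (auto simp: \<Delta>_def)
      have "z + \<mu> = (a + \<mu>) - b" using ab by simp
      then show ?thesis unfolding \<Delta>_def using ab lattice_invariantD[OF inv z(2)] by blast
    qed
    show "\<exists>c. difference_coeffs m c \<and> norm z = norm (config_comb m v x c)" if z: "z \<in> \<Delta>" for z
    proof -
      obtain a b where ab: "a \<in> config_set n w y" "b \<in> config_set n w y" "z = a - b" using z by (auto simp: \<Delta>_def)
      then have "norm z \<in> point_distances (config_set n w y)" unfolding point_distances_def dist_norm by blast
      then show ?thesis using sub unfolding point_distances_config[where m = m] by blast
    qed
  qed (auto intro: lattice_add lattice_scale difference_coeffs_minus basis_in_lattice simp: basis_vec_nonzero[OF w])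
  then obtain B c where B: "\<And>k. difference_coeffs m (B k)"
      "\<And>k. \<exists>c'. difference_coeffs m c' \<and> (\<forall>a\<in>config_index m. c' a = 2 * B k a)"
    and gram: "\<And>k l. w $ k \<bullet> w $ l = config_comb m v x (B k) \<bullet> config_comb m v x (B l)"
    and c: "\<And>z. z \<in> \<Delta> \<Longrightarrow> difference_coeffs m (c z)"
      "\<And>z. z \<in> \<Delta> \<Longrightarrow> norm z = norm (config_comb m v x (c z))"
      "\<And>z k. z \<in> \<Delta> \<Longrightarrow> z \<bullet> w $ k = config_comb m v x (c z) \<bullet> config_comb m v x (B k)"
    by metis
  have B0: "B i (Inr a) = 0" if "a < m" for i a
  proof -
    obtain k l where kl: "k < m" "l < m" "\<forall>a<m. B i (Inr a) = root_vec k l a"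
      using B(1)[of i] by (auto simp: difference_coeffs_def)
    obtain c' k' l' where c': "\<forall>a<m. c' (Inr a) = root_vec k' l' a" "\<forall>a\<in>config_index m. c' a = 2 * B i a"
      using B(2)[of i] by (auto simp: difference_coeffs_def)
    \<comment> \<open>Twice a nonzero root has an entry 2 and is no root, so the doubling property
      leaves \<open>B i\<close> without motif part: basis vectors go to lattice vectors.\<close>
    have "k = l"
    proof (rule ccontr)
      assume "k \<noteq> l"
      then have "root_vec k l k = 1" by (simp add: root_vec_def)
      moreover have "root_vec k' l' k = 2 * root_vec k l k"
        using c'(1) c'(2)[rule_format, of "Inr k"] kl by (simp add: config_index_iff)
      ultimately have "root_vec k' l' k = 2" by simp
      then show False by (simp add: root_vec_def split: if_splits)
    qed
    then show ?thesis using kl that by (simp add: root_vec_self)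
  qed
  obtain L where L: "orthogonal_transformation L" "\<And>i. L (w $ i) = config_comb m v x (B i)"
    "\<And>z z'. (\<And>i. z \<bullet> w $ i = z' \<bullet> config_comb m v x (B i)) \<Longrightarrow> L z = z'"
    using orthogonal_map_of_gram[OF w gram] by blast
  have lin: "linear L" using L(1) by (rule orthogonal_transformation_linear)
  have Lc: "L z = config_comb m v x (c z)" if "z \<in> \<Delta>" for z
    by (rule L(3)) (rule c(3)[OF that])
  have y\<Delta>: "y j - y k \<in> \<Delta>" if "j < n" "k < n" for j k
    unfolding \<Delta>_def using y_in that by blast
  define D where "D = (\<lambda>j a. c (y j - y 0) (Inr a))"
  have "\<exists>k0<m. \<exists>s. (s = 1 \<or> s = -1) \<and> (\<forall>j\<in>{..<n}. \<exists>k<m. \<forall>a<m. D j a = s * root_vec k k0 a)"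
  proof (rule root_vec_star[OF m])
    fix j assume "j \<in> {..<n}"
    then show "\<exists>k<m. \<exists>l<m. \<forall>a<m. D j a = root_vec k l a"
      using c(1)[OF y\<Delta>[of j 0]] n by (simp add: D_def difference_coeffs_def)
  next
    fix i j assume ij: "i \<in> {..<n}" "j \<in> {..<n}"
    have "L (y i - y 0) - L (y j - y 0) = L (y i - y j)"
      by (simp add: linear_diff[OF lin])
    then have eq: "config_comb m v x (c (y i - y 0)) - config_comb m v x (c (y j - y 0)) = config_comb m v x (c (y i - y j))"
      using Lc y\<Delta> ij n by simp
    \<comment> \<open>The combination is zero, so comparison with the zero coefficients yields
      equality without a choice of sign.\<close>
    have "norm (config_comb m v x (\<lambda>a. (c (y i - y 0) a - c (y j - y 0) a) - c (y i - y j) a)) = norm (config_comb m v x (\<lambda>a. 0))"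
      unfolding int_comb_diff eq by (simp add: int_comb_def)
    from gram_independent_norm_eq[OF gi this]
    have "\<forall>a\<in>config_index m. c (y i - y 0) a - c (y j - y 0) a = c (y i - y j) a" by auto
    then have "\<forall>a<m. D i a - D j a = c (y i - y j) (Inr a)" by (simp add: D_def config_index_iff)
    then show "\<exists>k<m. \<exists>l<m. \<forall>a<m. D i a - D j a = root_vec k l a"
      using c(1)[OF y\<Delta>[of i j]] ij by (simp add: difference_coeffs_def)
  qed
  then have "matching m n B (\<lambda>j. c (y j - y 0))"
    unfolding matching_def D_def Ball_def lessThan_iff using B0 by blast
  moreover have "matching_isometric m n B (\<lambda>j. c (y j - y 0)) v x w y"
    unfolding matching_isometric_def using gram c(3)[OF y\<Delta>] n by blast
  moreover have "\<forall>j<n. norm (y j - y 0) = norm (config_comb m v x (c (y j - y 0)))"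
    using c(2)[OF y\<Delta>] n by blast
  ultimately show ?thesis by blast
qed

lemma matching_isometry:
  assumes w: "is_basis w" and mt: "matching m n B c" and iso: "matching_isometric m n B c v x w y"
  shows "\<exists>\<iota>. is_isometry \<iota> \<and> \<iota> ` config_set n w y \<subseteq> config_set m v x \<and>
     (\<forall>u\<in>lattice_of w. \<forall>z. \<iota> (z + u) - \<iota> z \<in> lattice_of v)"
proof -
  obtain k0 s where k0: "k0 < m" and s: "s = 1 \<or> s = (-1::int)"
    and c: "\<And>j. j < n \<Longrightarrow> \<exists>k<m. \<forall>a<m. c j (Inr a) = s * root_vec k k0 a"
    using mt by (auto simp: matching_def)
  have B0: "\<And>i a. a < m \<Longrightarrow> B i (Inr a) = 0" using mt by (auto simp: matching_def)
  have gram: "\<And>i j. w $ i \<bullet> w $ j = config_comb m v x (B i) \<bullet> config_comb m v x (B j)"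
    using iso by (auto simp: matching_isometric_def)
  obtain L where L: "orthogonal_transformation L" "\<And>i. L (w $ i) = config_comb m v x (B i)"
    "\<And>z z'. (\<And>i. z \<bullet> w $ i = z' \<bullet> config_comb m v x (B i)) \<Longrightarrow> L z = z'"
    using orthogonal_map_of_gram[OF w gram] by blast
  have lin: "linear L" using L(1) by (rule orthogonal_transformation_linear)
  have Lw: "L (w $ i) \<in> lattice_of v" for i
    unfolding L(2) config_comb_eq using B0 by (simp add: lattice_of_eq)
  have sum_in: "(\<Sum>i\<in>S. f i) \<in> lattice_of v" if "\<And>i. f i \<in> lattice_of v" for f :: "3 \<Rightarrow> real^3" and S
    using that by (induction S rule: infinite_finite_induct) (auto intro: lattice_add)
  have Llat: "L u \<in> lattice_of v" if u: "u \<in> lattice_of w" for u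
  proof -
    obtain k where "u = lattice_vec w k" using u by (auto simp: lattice_of_eq)
    then have "L u = (\<Sum>i\<in>UNIV. real_of_int (k i) *\<^sub>R L (w $ i))"
      by (simp add: lattice_vec_def linear_sum[OF lin] linear_scale[OF lin])
    then show ?thesis using sum_in[of "\<lambda>i. real_of_int (k i) *\<^sub>R L (w $ i)"] lattice_scale[OF Lw] by simp
  qed
  have Ly: "L (y j - y 0) = config_comb m v x (c j)" if "j < n" for j
    using iso that by (intro L(3)) (simp add: matching_isometric_def)
  have sL: "of_int s *\<^sub>R u \<in> lattice_of v" if "u \<in> lattice_of v" for u
    using lattice_scale[OF that, of s] .
  \<comment> \<open>The point \<open>y 0\<close> goes to \<open>x k0\<close>, the common end of the
    star. The sign \<open>s\<close> records whether that end is a tail or a head; multiplying by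
    \<open>s\<close> makes the roots point away from \<open>x k0\<close>, so every
    \<open>y j\<close> lands on a point of the target.\<close>
  define \<iota> where "\<iota> = (\<lambda>z. of_int s *\<^sub>R L (z - y 0) + x k0)"
  have "is_isometry \<iota>"
    unfolding is_isometry_def
  proof (intro allI)
    fix p q
    have "\<iota> p - \<iota> q = of_int s *\<^sub>R L (p - q)"
      by (simp add: \<iota>_def linear_diff[OF lin] scaleR_diff_right)
    then show "dist (\<iota> p) (\<iota> q) = dist p q"
      using s by (auto simp: dist_norm orthogonal_transformation_norm[OF L(1)])
  qed
  moreover have "\<iota> ` config_set n w y \<subseteq> config_set m v x"
  proof clarify
    fix z assume "z \<in> config_set n w y"
    then obtain j k where j: "j < n" and z: "z = y j + lattice_vec w k" by (auto simp: config_set_eq)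
    obtain k' where k': "k' < m" "\<forall>a<m. c j (Inr a) = s * root_vec k' k0 a" using c[OF j] by blast
    have ss: "of_int s *\<^sub>R (of_int s *\<^sub>R u) = (u :: real^3)" for u using s by auto
    have "\<iota> z = of_int s *\<^sub>R (L (y j - y 0) + L (lattice_vec w k)) + x k0"
      by (simp add: \<iota>_def z linear_add[OF lin, symmetric] algebra_simps)
    also have "\<dots> = x k' + (of_int s *\<^sub>R lattice_vec v (\<lambda>i. c j (Inl i)) + of_int s *\<^sub>R L (lattice_vec w k))"
      unfolding Ly[OF j] config_comb_root[OF k'(1) k0 k'(2)] scaleR_add_right ss by simp
    finally have "\<iota> z = x k' + (of_int s *\<^sub>R lattice_vec v (\<lambda>i. c j (Inl i)) + of_int s *\<^sub>R L (lattice_vec w k))" .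
    moreover have "of_int s *\<^sub>R lattice_vec v (\<lambda>i. c j (Inl i)) + of_int s *\<^sub>R L (lattice_vec w k) \<in> lattice_of v"
      by (intro lattice_add sL Llat) (auto simp: lattice_of_eq)
    ultimately show "\<iota> z \<in> config_set m v x"
      unfolding motif_translates_def using k'(1) by blast
  qed
  moreover have "\<iota> (z + u) - \<iota> z \<in> lattice_of v" if "u \<in> lattice_of w" for u z
  proof -
    have "\<iota> (z + u) - \<iota> z = of_int s *\<^sub>R L u"
      by (simp add: \<iota>_def linear_diff[OF lin] linear_add[OF lin] scaleR_diff_right scaleR_add_right)
    then show ?thesis using sL[OF Llat[OF that]] by simp
  qed
  ultimately show ?thesis by blast
qed

text \<open>The matching only embeds the first set. The second is pulled back along the isometry:
  the result contains the first set, has the same fingerprint, and is invariant under the lattice of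
  \<open>w\<close>, because translations by that lattice correspond to translations by the lattice
  of \<open>v\<close>. Hence nothing can be missing.\<close>

lemma isometric_if_matching:
  assumes p: "(v, x) \<in> config_tuples m" "m \<ge> 1" and q: "(w, y) \<in> config_tuples n" "n \<ge> 1"
    and mt: "matching m n B c" and iso: "matching_isometric m n B c v x w y"
    and eq: "density_fingerprint (config_set n w y) = density_fingerprint (config_set m v x)"
  shows "isometric_sets (config_set n w y) (config_set m v x)"
proof -
  define A where "A = config_set n w y"
  define Q where "Q = config_set m v x"
  have A: "represents w (y ` {..<n}) A" and Q: "represents v (x ` {..<m}) Q"
    unfolding A_def Q_def using represents_config p q by blast+
  obtain \<iota> where \<iota>: "is_isometry \<iota>" "\<iota> ` A \<subseteq> Q" "\<And>u z. u \<in> lattice_of w \<Longrightarrow> \<iota> (z + u) - \<iota> z \<in> lattice_of v"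
    using matching_isometry[OF represents_basis[OF A] mt iso] unfolding A_def Q_def by blast
  define P where "P = inv \<iota> ` Q"
  have \<iota>P: "\<iota> ` P = Q" by (simp add: P_def image_f_inv_f is_isometry_surj[OF \<iota>(1)])
  have P_iff: "z \<in> P \<longleftrightarrow> \<iota> z \<in> Q" for z
    unfolding \<iota>P[symmetric] by (simp add: inj_image_mem_iff is_isometry_inj[OF \<iota>(1)])
  have "periodic_set P"
    unfolding P_def periodic_set_def using represents_isometry_image[OF Q is_isometry_inv[OF \<iota>(1)]] .
  moreover have "A \<subseteq> P" using \<iota>(2) P_iff by blast
  moreover have "lattice_invariant w P"
  proof (rule lattice_invariantI)
    fix z u assume "z \<in> P" "u \<in> lattice_of w"
    then have "\<iota> z + (\<iota> (z + u) - \<iota> z) \<in> Q"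
      using lattice_invariantD[OF represents_invariant[OF Q] \<iota>(3)] P_iff by blast
    then show "z + u \<in> P" unfolding P_iff by simp
  qed
  moreover have "density_fingerprint A = density_fingerprint P"
  proof -
    have "periodic_set Q" unfolding periodic_set_def using Q by blast
    then have "density_fingerprint P = density_fingerprint Q"
      unfolding P_def by (rule density_fingerprint_isometry[OF _ is_isometry_inv[OF \<iota>(1)]])
    then show ?thesis using eq unfolding A_def Q_def by simp
  qed
  ultimately have "A = P" by (intro eq_if_subset_fingerprint_eq[OF A])
  then have "Q = \<iota> ` A" using \<iota>P by simp
  then show ?thesis unfolding isometric_sets_def A_def[symmetric] Q_def[symmetric] using \<iota>(1) by blast
qed

section \<open>Topology of the configurations and stability of lengths\<close>

lemma config_topspace: "topspace (config_topology m) = config_tuples m"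
proof -
  have "x \<in> {..<m} \<rightarrow>\<^sub>E UNIV" if "(v, x) \<in> config_tuples m" for v x
    using that by (auto simp: config_tuples_def)
  then show ?thesis by (auto simp: config_topology_def)
qed

abbreviation config_space :: "nat \<Rightarrow> ((real^3^3) \<times> (nat \<Rightarrow> real^3)) topology" where
  "config_space m \<equiv> prod_topology euclidean (product_topology (\<lambda>_. euclidean) {..<m})"

lemma config_topology_eq: "config_topology m = subtopology (config_space m) (config_tuples m)"
  by (simp add: config_topology_def)

lemma config_space_continuous_basis: "continuous_map (config_space m) euclidean (\<lambda>u. fst u $ i)"
proof -
  have "continuous_map (config_space m) euclidean ((\<lambda>v. v $ i) \<circ> fst)"
    by (intro continuous_map_compose[OF continuous_map_fst]) (auto intro: continuous_intros)
  then show ?thesis by (simp add: o_def)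
qed

lemma config_space_continuous_point:
  assumes "k < m" shows "continuous_map (config_space m) euclidean (\<lambda>u. snd u k)"
proof -
  have "continuous_map (config_space m) euclidean ((\<lambda>x. x k) \<circ> snd)"
    by (intro continuous_map_compose[OF continuous_map_snd] continuous_map_product_projection)
       (use assms in simp)
  then show ?thesis by (simp add: o_def)
qed

lemma config_continuous_basis: "continuous_map (config_topology m) euclidean (\<lambda>u. fst u $ i)"
  unfolding config_topology_eq by (rule continuous_map_from_subtopology[OF config_space_continuous_basis])

lemma config_continuous_point:
  "k < m \<Longrightarrow> continuous_map (config_topology m) euclidean (\<lambda>u. snd u k)"
  unfolding config_topology_eq by (rule continuous_map_from_subtopology[OF config_space_continuous_point])

lemma continuous_map_scaleR_const:
  fixes f :: "'a \<Rightarrow> 'b::real_normed_vector"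
  assumes "continuous_map X euclidean f" shows "continuous_map X euclidean (\<lambda>x. r *\<^sub>R f x)"
proof -
  have "continuous_map X euclidean ((\<lambda>y. r *\<^sub>R y) \<circ> f)"
    by (intro continuous_map_compose[OF assms]) (auto intro: continuous_intros)
  then show ?thesis by (simp add: o_def)
qed

lemma config_continuous_comb:
  "continuous_map (config_topology m) euclideanreal (\<lambda>u. norm (config_comb m (fst u) (snd u) c))"
  unfolding config_comb_eq lattice_vec_def
  by (intro continuous_map_norm continuous_map_add continuous_map_sum continuous_map_scaleR_const
      config_continuous_basis config_continuous_point) auto

lemma eventually_nhdsin_norm_diff:
  fixes f :: "'a \<Rightarrow> 'b::real_normed_vector"
  assumes f: "continuous_map X euclidean f" and p: "p \<in> topspace X" and e: "e > 0"
  shows "eventually (\<lambda>u. norm (f u - f p) < e) (nhdsin X p)"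
  unfolding eventually_nhdsin
proof (intro disjI2 exI conjI ballI)
  show "openin X {u \<in> topspace X. f u \<in> ball (f p) e}"
    by (rule openin_continuous_map_preimage[OF f]) simp
  show "p \<in> {u \<in> topspace X. f u \<in> ball (f p) e}" using p e by simp
  fix u assume "u \<in> {u \<in> topspace X. f u \<in> ball (f p) e}"
  then show "norm (f u - f p) < e" by (simp add: dist_norm norm_minus_commute)
qed

text \<open>The bound on coefficients must hold uniformly near \<open>(v, x)\<close>. Moving three
  basis vectors by less than \<open>e / 6\<close> each changes a lattice vector by at most half of
  its lower bound, so half of that bound remains.\<close>

lemma lattice_coeffs_locally_finite:
  assumes p: "(v, x) \<in> config_tuples m"
  shows "\<exists>F. finite F \<and> eventually (\<lambda>u. \<forall>c. difference_coeffs m c \<and>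
     norm (config_comb m (fst u) (snd u) c) \<le> R \<longrightarrow> (\<lambda>i. c (Inl i)) \<in> F) (nhdsin (config_topology m) (v, x))"
proof -
  have v: "is_basis v" using p by (simp add: config_tuples_def)
  obtain e where e: "e > 0" "\<And>r. norm (basis_comb v r) \<ge> e * norm r"
    using basis_comb_lower_bound[OF v] by blast
  \<comment> \<open>A bound for differences of two motif points, each moved by less than 1.\<close>
  define S where "S = (\<Sum>k<m. norm (x k)) * 2 + 2"
  define N where "N = \<lceil>2 * (R + S) / e\<rceil>"
  have pt: "(v, x) \<in> topspace (config_topology m)" using p by (simp add: config_topspace)
  have ev1: "eventually (\<lambda>u. \<forall>i\<in>UNIV. norm (fst u $ i - v $ i) < e / 6) (nhdsin (config_topology m) (v, x))"
    using eventually_nhdsin_norm_diff[OF config_continuous_basis pt, of "e / 6"] e(1)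
    by (intro eventually_ball_finite) auto
  have ev2: "eventually (\<lambda>u. \<forall>k\<in>{..<m}. norm (snd u k - x k) < 1) (nhdsin (config_topology m) (v, x))"
    using eventually_nhdsin_norm_diff[OF config_continuous_point pt, of _ 1]
    by (intro eventually_ball_finite) auto
  have "eventually (\<lambda>u. \<forall>c. difference_coeffs m c \<and>
     norm (config_comb m (fst u) (snd u) c) \<le> R \<longrightarrow> (\<lambda>i. c (Inl i)) \<in> {n. \<forall>i. \<bar>n i\<bar> \<le> N}) (nhdsin (config_topology m) (v, x))"
    using ev1 ev2
  proof eventually_elim
    case (elim u)
    show ?case
    proof (intro allI impI, elim conjE)
      fix c assume c: "difference_coeffs m c" and le: "norm (config_comb m (fst u) (snd u) c) \<le> R"
      obtain k l where kl: "k < m" "l < m" "\<forall>a<m. c (Inr a) = 1 * root_vec k l a"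
        using c by (auto simp: difference_coeffs_def)
      define n where "n = (\<lambda>i. c (Inl i))"
      define r where "r = (\<chi> i. real_of_int (n i) :: real^3)"
      have pb: "norm (snd u j) \<le> (\<Sum>k<m. norm (x k)) + 1" if "j < m" for j
      proof -
        have "norm (x j) \<le> (\<Sum>k<m. norm (x k))" using that by (intro member_le_sum) auto
        moreover have "norm (snd u j - x j) < 1" using elim(2) that by simp
        ultimately show ?thesis using norm_triangle_sub[of "snd u j" "x j"] by linarith
      qed
      have "config_comb m (fst u) (snd u) c = lattice_vec (fst u) n + (snd u k - snd u l)"
        using config_comb_root[OF kl] by (simp add: n_def)
      then have "norm (lattice_vec (fst u) n) \<le> R + norm (snd u k - snd u l)"
        using le norm_triangle_ineq4[of "config_comb m (fst u) (snd u) c" "snd u k - snd u l"] by simp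
      also have "\<dots> \<le> R + S"
        using pb[OF kl(1)] pb[OF kl(2)] norm_triangle_ineq4[of "snd u k" "snd u l"] by (simp add: S_def)
      finally have 1: "norm (lattice_vec (fst u) n) \<le> R + S" .
      have "norm (lattice_vec (fst u) n - lattice_vec v n) \<le> e / 2 * norm r"
      proof -
        have "lattice_vec (fst u) n - lattice_vec v n = (\<Sum>i\<in>UNIV. real_of_int (n i) *\<^sub>R (fst u $ i - v $ i))"
          by (simp add: lattice_vec_def sum_subtractf scaleR_diff_right)
        then have "norm (lattice_vec (fst u) n - lattice_vec v n) \<le> (\<Sum>i\<in>UNIV. norm (real_of_int (n i) *\<^sub>R (fst u $ i - v $ i)))"
          by (simp only: norm_sum)
        also have "\<dots> \<le> (\<Sum>i\<in>(UNIV::3 set). norm r * (e / 6))"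
        proof (rule sum_mono)
          fix i :: 3
          have "\<bar>real_of_int (n i)\<bar> \<le> norm r" using component_le_norm_cart[of r i] by (simp add: r_def)
          then show "norm (real_of_int (n i) *\<^sub>R (fst u $ i - v $ i)) \<le> norm r * (e / 6)"
            using elim(1) by (simp only: norm_scaleR) (intro mult_mono; simp add: less_imp_le)
        qed
        also have "\<dots> = e / 2 * norm r" by simp
        finally show ?thesis .
      qed
      moreover have "e * norm r \<le> norm (lattice_vec v n)" using e(2)[of r] by (simp add: lattice_vec_eq r_def)
      moreover have "norm (lattice_vec v n) \<le> norm (lattice_vec (fst u) n) + norm (lattice_vec (fst u) n - lattice_vec v n)"
        using norm_triangle_ineq4[of "lattice_vec (fst u) n" "lattice_vec (fst u) n - lattice_vec v n"] by simp
      ultimately have "e / 2 * norm r \<le> R + S" using 1 by (simp add: field_simps)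
      then have nr: "norm r \<le> 2 * (R + S) / e" using e(1) by (simp add: field_simps)
      have "\<bar>n i\<bar> \<le> N" for i
      proof -
        have "\<bar>real_of_int (n i)\<bar> \<le> norm r" using component_le_norm_cart[of r i] by (simp add: r_def)
        then show ?thesis using nr unfolding N_def by linarith
      qed
      then show "(\<lambda>i. c (Inl i)) \<in> {n. \<forall>i. \<bar>n i\<bar> \<le> N}" by (simp add: n_def)
    qed
  qed
  then show ?thesis using finite_int_box by blast
qed

text \<open>Only finitely many coefficient vectors can have length near \<open>d\<close> anywhere in
  a small neighbourhood. Those whose length at \<open>(v, x)\<close> is not \<open>d\<close> miss it
  by at least \<open>Min G\<close>, which is split evenly between the movement of the length and the
  window around \<open>d\<close>.\<close>

lemma length_isolated:
  assumes p: "(v, x) \<in> config_tuples m"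
  shows "\<exists>\<epsilon>>0. eventually (\<lambda>u. \<forall>c. difference_coeffs m c \<and>
     \<bar>norm (config_comb m (fst u) (snd u) c) - d\<bar> < \<epsilon> \<longrightarrow> norm (config_comb m v x c) = d) (nhdsin (config_topology m) (v, x))"
proof -
  obtain F where F: "finite F" "eventually (\<lambda>u. \<forall>c. difference_coeffs m c \<and>
     norm (config_comb m (fst u) (snd u) c) \<le> d + 1 \<longrightarrow> (\<lambda>i. c (Inl i)) \<in> F) (nhdsin (config_topology m) (v, x))"
    using lattice_coeffs_locally_finite[OF p] by blast
  define T :: "(3 + nat \<Rightarrow> int) set" where
    "T = (\<lambda>(n, k, l). case_sum n (root_vec k l)) ` (F \<times> {..<m} \<times> {..<m})"
  have T: "finite T" using F(1) by (simp add: T_def)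
  define G where "G = insert 1 ((\<lambda>c. \<bar>norm (config_comb m v x c) - d\<bar>) ` {c \<in> T. norm (config_comb m v x c) \<noteq> d})"
  have G: "finite G" using T by (simp add: G_def)
  define \<epsilon> where "\<epsilon> = Min G / 2"
  have "Min G > 0" using Min_in[OF G] by (auto simp: G_def)
  then have \<epsilon>: "\<epsilon> > 0" by (simp add: \<epsilon>_def)
  have "Min G \<le> 1" by (rule Min_le[OF G]) (simp add: G_def)
  have pt: "(v, x) \<in> topspace (config_topology m)" using p by (simp add: config_topspace)
  have "eventually (\<lambda>u. \<forall>c\<in>T. \<bar>norm (config_comb m (fst u) (snd u) c) - norm (config_comb m v x c)\<bar> < \<epsilon>) (nhdsin (config_topology m) (v, x))"
    using eventually_nhdsin_norm_diff[OF config_continuous_comb pt \<epsilon>]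
    by (intro eventually_ball_finite T) simp
  with F(2) have "eventually (\<lambda>u. \<forall>c. difference_coeffs m c \<and>
     \<bar>norm (config_comb m (fst u) (snd u) c) - d\<bar> < \<epsilon> \<longrightarrow> norm (config_comb m v x c) = d) (nhdsin (config_topology m) (v, x))"
  proof eventually_elim
    case (elim u)
    show ?case
    proof (intro allI impI, elim conjE)
      fix c assume c: "difference_coeffs m c" and near: "\<bar>norm (config_comb m (fst u) (snd u) c) - d\<bar> < \<epsilon>"
      obtain k l where kl: "k < m" "l < m" "\<forall>a<m. c (Inr a) = root_vec k l a"
        using c by (auto simp: difference_coeffs_def)
      have "norm (config_comb m (fst u) (snd u) c) \<le> d + 1"
        using near \<open>Min G \<le> 1\<close> unfolding \<epsilon>_def by linarith
      then have "(\<lambda>i. c (Inl i)) \<in> F" using elim(1) c by blast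
      \<comment> \<open>Values of \<open>c\<close> beyond the index set are arbitrary; the
        normalised vector \<open>c'\<close> gives the same combination and lies in the finite set
        \<open>T\<close>.\<close>
      define c' :: "3 + nat \<Rightarrow> int" where "c' = case_sum (\<lambda>i. c (Inl i)) (root_vec k l)"
      have c'T: "c' \<in> T"
        unfolding T_def c'_def using \<open>(\<lambda>i. c (Inl i)) \<in> F\<close> kl
        by (intro image_eqI[of _ _ "(\<lambda>i. c (Inl i), k, l)"]) auto
      have same: "config_comb m v' x' c = config_comb m v' x' c'" for v' x'
        by (rule int_comb_cong) (use kl in \<open>auto simp: config_index_def c'_def\<close>)
      have "\<bar>norm (config_comb m (fst u) (snd u) c') - norm (config_comb m v x c')\<bar> < \<epsilon>"
        using elim(2) c'T by blast
      then have "\<bar>norm (config_comb m v x c') - d\<bar> < Min G"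
        using near unfolding same \<epsilon>_def by linarith
      then have "\<bar>norm (config_comb m v x c') - d\<bar> \<notin> G" using Min_le[OF G] by force
      then show "norm (config_comb m v x c) = d" using c'T unfolding same G_def by blast
    qed
  qed
  then show ?thesis using \<epsilon> by blast
qed

text \<open>Near \<open>(w, y)\<close> the length of \<open>J\<close> stays near the common value
  and is attained at \<open>u\<close> by some \<open>c\<close>. By isolation \<open>c\<close> has
  that value also at \<open>(v, x)\<close>, where independence makes it \<open>K\<close> up to sign,
  and \<open>K\<close> and \<open>- K\<close> have equal lengths at \<open>u\<close> too. So the
  equation persists although \<open>u\<close> need not be generic.\<close>

lemma norm_config_comb_eventually_eq:
  assumes p: "(v, x) \<in> config_tuples m" and q: "(w, y) \<in> config_tuples n"
    and gi: "gram_independent (config_index m) (config_vec v x)"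
    and K: "difference_coeffs m K" and J: "difference_coeffs n J"
    and eq: "norm (config_comb n w y J) = norm (config_comb m v x K)"
  shows "\<exists>U V. openin (config_topology m) U \<and> (v, x) \<in> U \<and> openin (config_topology n) V \<and> (w, y) \<in> V \<and>
     (\<forall>u\<in>U. \<forall>a\<in>V. point_distances (config_set n (fst a) (snd a)) \<subseteq> point_distances (config_set m (fst u) (snd u)) \<longrightarrow>
       norm (config_comb n (fst a) (snd a) J) = norm (config_comb m (fst u) (snd u) K))"
proof -
  have pt: "(v, x) \<in> topspace (config_topology m)" "(w, y) \<in> topspace (config_topology n)"
    using p q by (simp_all add: config_topspace)
  define d where "d = norm (config_comb m v x K)"
  obtain \<epsilon> where \<epsilon>: "\<epsilon> > 0" "eventually (\<lambda>u. \<forall>c. difference_coeffs m c \<and>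
     \<bar>norm (config_comb m (fst u) (snd u) c) - d\<bar> < \<epsilon> \<longrightarrow> norm (config_comb m v x c) = d) (nhdsin (config_topology m) (v, x))"
    using length_isolated[OF p] by blast
  obtain U where U: "openin (config_topology m) U" "(v, x) \<in> U"
    "\<And>u c. u \<in> U \<Longrightarrow> difference_coeffs m c \<Longrightarrow> \<bar>norm (config_comb m (fst u) (snd u) c) - d\<bar> < \<epsilon> \<Longrightarrow> norm (config_comb m v x c) = d"
    using \<epsilon>(2) pt(1) unfolding eventually_nhdsin by auto
  obtain V where V: "openin (config_topology n) V" "(w, y) \<in> V"
    "\<And>a. a \<in> V \<Longrightarrow> \<bar>norm (config_comb n (fst a) (snd a) J) - d\<bar> < \<epsilon>"
    using eventually_nhdsin_norm_diff[OF config_continuous_comb[of n J] pt(2) \<epsilon>(1)] pt(2) eq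
    unfolding eventually_nhdsin d_def by auto
  have "norm (config_comb n (fst a) (snd a) J) = norm (config_comb m (fst u) (snd u) K)"
    if u: "u \<in> U" and a: "a \<in> V"
      and sub: "point_distances (config_set n (fst a) (snd a)) \<subseteq> point_distances (config_set m (fst u) (snd u))" for u a
  proof -
    have "norm (config_comb n (fst a) (snd a) J) \<in> point_distances (config_set m (fst u) (snd u))"
      using sub J unfolding point_distances_config[where m = n] by blast
    then obtain c where c: "difference_coeffs m c" "norm (config_comb n (fst a) (snd a) J) = norm (config_comb m (fst u) (snd u) c)"
      unfolding point_distances_config by blast
    then have "norm (config_comb m v x c) = norm (config_comb m v x K)"
      using U(3)[OF u c(1)] V(3)[OF a] by (simp add: d_def)
    from gram_independent_norm_eq[OF gi this]
    have "config_comb m (fst u) (snd u) c = config_comb m (fst u) (snd u) K \<or>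
          config_comb m (fst u) (snd u) c = - config_comb m (fst u) (snd u) K"
    proof
      assume "\<forall>a\<in>config_index m. c a = K a"
      then show ?thesis by (intro disjI1 int_comb_cong) blast
    next
      assume "\<forall>a\<in>config_index m. c a = - K a"
      then show ?thesis by (intro disjI2) (simp add: int_comb_minus[symmetric] cong: int_comb_cong)
    qed
    then show ?thesis using c(2) by auto
  qed
  then show ?thesis using U(1,2) V(1,2) by blast
qed

section \<open>Length equations of a matching and local rigidity\<close>

lemma inner_eq_if_norms_eq:
  fixes a b :: "'a::real_inner" and a' b' :: "'b::real_inner"
  assumes "norm a = norm a'" "norm b = norm b'" "norm (a + b) = norm (a' + b')"
  shows "a \<bullet> b = a' \<bullet> b'"
  using assms by (simp add: dot_norm)

lemma norm_add_eq_if_inner_eq: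
  fixes a b :: "'a::real_inner" and a' b' :: "'b::real_inner"
  assumes "norm a = norm a'" "norm b = norm b'" "a \<bullet> b = a' \<bullet> b'"
  shows "norm (a + b) = norm (a' + b')"
proof -
  have "(norm (a + b))\<^sup>2 = (norm (a' + b'))\<^sup>2"
    using assms by (simp add: dot_norm)
  then show ?thesis by simp
qed

definition basis_coeffs :: "3 \<Rightarrow> 3 + nat \<Rightarrow> int" where
  "basis_coeffs i = case_sum (\<lambda>i'. if i' = i then 1 else 0) (\<lambda>_. 0)"

definition point_coeffs :: "nat \<Rightarrow> 3 + nat \<Rightarrow> int" where
  "point_coeffs j = case_sum (\<lambda>_. 0) (root_vec j 0)"

lemma config_comb_basis_coeffs: "config_comb n w y (basis_coeffs i) = w $ i"
  by (simp add: config_comb_eq basis_coeffs_def lattice_vec_basis[symmetric])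

lemma config_comb_point_coeffs:
  assumes "j < n" shows "config_comb n w y (point_coeffs j) = y j - y 0"
proof -
  have "config_comb n w y (point_coeffs j) = lattice_vec w (\<lambda>i. point_coeffs j (Inl i)) + of_int 1 *\<^sub>R (y j - y 0)"
    using assms by (intro config_comb_root) (auto simp: point_coeffs_def)
  then show ?thesis by (simp add: point_coeffs_def lattice_vec_def)
qed

text \<open>Finitely many length equations express \<^const>\<open>matching_isometric\<close>.\<close>

definition matching_pairs ::
  "nat \<Rightarrow> (3 \<Rightarrow> 3 + nat \<Rightarrow> int) \<Rightarrow> (nat \<Rightarrow> 3 + nat \<Rightarrow> int) \<Rightarrow> ((3 + nat \<Rightarrow> int) \<times> (3 + nat \<Rightarrow> int)) set" where
  "matching_pairs n B c =
     (\<lambda>i. (basis_coeffs i, B i)) ` UNIV \<union>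
     (\<lambda>(i, j). (\<lambda>a. basis_coeffs i a + basis_coeffs j a, \<lambda>a. B i a + B j a)) ` UNIV \<union>
     (\<lambda>j. (point_coeffs j, c j)) ` {..<n} \<union>
     (\<lambda>(j, i). (\<lambda>a. point_coeffs j a + basis_coeffs i a, \<lambda>a. c j a + B i a)) ` ({..<n} \<times> UNIV)"

lemma finite_matching_pairs: "finite (matching_pairs n B c)"
  by (simp add: matching_pairs_def)

lemma matching_pairs_cases:
  assumes "(J, K) \<in> matching_pairs n B c"
  obtains i where "J = basis_coeffs i" "K = B i"
    | i j where "J = (\<lambda>a. basis_coeffs i a + basis_coeffs j a)" "K = (\<lambda>a. B i a + B j a)"
    | j where "j < n" "J = point_coeffs j" "K = c j"
    | j i where "j < n" "J = (\<lambda>a. point_coeffs j a + basis_coeffs i a)" "K = (\<lambda>a. c j a + B i a)"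
  using assms unfolding matching_pairs_def by (elim UnE imageE) auto

lemma matching_pairs_norm_eq:
  assumes iso: "matching_isometric m n B c v x w y"
    and nrm: "\<forall>j<n. norm (y j - y 0) = norm (config_comb m v x (c j))"
    and JK: "(J, K) \<in> matching_pairs n B c"
  shows "norm (config_comb n w y J) = norm (config_comb m v x K)"
proof -
  have g: "w $ i \<bullet> w $ j = config_comb m v x (B i) \<bullet> config_comb m v x (B j)" for i j
    using iso by (simp add: matching_isometric_def)
  have w: "norm (w $ i) = norm (config_comb m v x (B i))" for i
    using g[of i i] by (simp add: norm_eq_sqrt_inner)
  have yw: "(y j - y 0) \<bullet> w $ i = config_comb m v x (c j) \<bullet> config_comb m v x (B i)" if "j < n" for i j
    using iso that by (simp add: matching_isometric_def)
  consider i where "J = basis_coeffs i" "K = B i"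
    | i j where "J = (\<lambda>a. basis_coeffs i a + basis_coeffs j a)" "K = (\<lambda>a. B i a + B j a)"
    | j where "j < n" "J = point_coeffs j" "K = c j"
    | j i where "j < n" "J = (\<lambda>a. point_coeffs j a + basis_coeffs i a)" "K = (\<lambda>a. c j a + B i a)"
    using JK by (rule matching_pairs_cases)
  then show ?thesis
  proof cases
    case 1
    then show ?thesis by (simp add: config_comb_basis_coeffs w)
  next
    case 2
    then show ?thesis unfolding 2 int_comb_add config_comb_basis_coeffs
      by (intro norm_add_eq_if_inner_eq w g)
  next
    case 3
    then show ?thesis using nrm by (simp add: config_comb_point_coeffs)
  next
    case 4
    show ?thesis unfolding 4(2,3) int_comb_add config_comb_basis_coeffs config_comb_point_coeffs[OF 4(1)]
      using nrm 4(1) by (intro norm_add_eq_if_inner_eq w yw) auto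
  qed
qed

lemma matching_isometric_if_norm_eq:
  assumes nrm: "\<And>J K. (J, K) \<in> matching_pairs n B c \<Longrightarrow> norm (config_comb n w y J) = norm (config_comb m v x K)"
  shows "matching_isometric m n B c v x w y"
proof -
  have w: "norm (w $ i) = norm (config_comb m v x (B i))" for i
  proof -
    have "(basis_coeffs i, B i) \<in> matching_pairs n B c" unfolding matching_pairs_def by blast
    from nrm[OF this] show ?thesis by (simp add: config_comb_basis_coeffs)
  qed
  have ww: "norm (w $ i + w $ j) = norm (config_comb m v x (B i) + config_comb m v x (B j))" for i j
  proof -
    have "(\<lambda>a. basis_coeffs i a + basis_coeffs j a, \<lambda>a. B i a + B j a) \<in> matching_pairs n B c"
      unfolding matching_pairs_def by (rule UnI1, rule UnI1, rule UnI2, rule image_eqI[of _ _ "(i, j)"]) auto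
    from nrm[OF this] show ?thesis by (simp add: int_comb_add config_comb_basis_coeffs)
  qed
  have yy: "norm (y j - y 0) = norm (config_comb m v x (c j))" if "j < n" for j
  proof -
    have "(point_coeffs j, c j) \<in> matching_pairs n B c" unfolding matching_pairs_def using that by blast
    from nrm[OF this] show ?thesis by (simp add: config_comb_point_coeffs[OF that])
  qed
  have yw: "norm ((y j - y 0) + w $ i) = norm (config_comb m v x (c j) + config_comb m v x (B i))" if "j < n" for i j
  proof -
    have "(\<lambda>a. point_coeffs j a + basis_coeffs i a, \<lambda>a. c j a + B i a) \<in> matching_pairs n B c"
      unfolding matching_pairs_def using that by (intro UnI2 image_eqI[of _ _ "(j, i)"]) auto
    from nrm[OF this] show ?thesis
      by (simp add: int_comb_add config_comb_basis_coeffs config_comb_point_coeffs[OF that])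
  qed
  show ?thesis unfolding matching_isometric_def
    using inner_eq_if_norms_eq[OF w w ww] inner_eq_if_norms_eq[OF yy w yw] by blast
qed

text \<open>Only lengths of differences of points are visible in the fingerprint. Adding lattice
  coefficients leaves the motif part of a difference unchanged, and for \<open>s = -1\<close> head
  and tail of the root are exchanged.\<close>

lemma matching_pairs_difference_coeffs:
  assumes m: "0 < m" and n: "0 < n" and mt: "matching m n B c" and JK: "(J, K) \<in> matching_pairs n B c"
  shows "difference_coeffs n J" "difference_coeffs m K"
proof -
  have zero: "difference_coeffs k d" if "0 < k" "\<And>a. a < k \<Longrightarrow> d (Inr a) = 0" for k d
    unfolding difference_coeffs_def using that by (intro exI[of _ 0] conjI) (simp_all add: root_vec_self)
  obtain k0 s where k0: "k0 < m" and s: "s = 1 \<or> s = (-1::int)"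
    and c: "\<And>j. j < n \<Longrightarrow> \<exists>k<m. \<forall>a<m. c j (Inr a) = s * root_vec k k0 a"
    using mt by (auto simp: matching_def)
  have B0: "\<And>i a. a < m \<Longrightarrow> B i (Inr a) = 0" using mt by (auto simp: matching_def)
  have star: "difference_coeffs m d" if d: "j < n" "\<And>a. a < m \<Longrightarrow> d (Inr a) = c j (Inr a)" for j d
  proof -
    obtain k where k: "k < m" "\<forall>a<m. c j (Inr a) = s * root_vec k k0 a" using c[OF d(1)] by blast
    show ?thesis
    proof (cases "s = 1")
      case True
      then have "\<forall>a<m. d (Inr a) = root_vec k k0 a" using k d by simp
      then show ?thesis unfolding difference_coeffs_def using k(1) k0 by blast
    next
      case False
      then have "\<forall>a<m. d (Inr a) = root_vec k0 k a" using k d s by (simp add: root_vec_def)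
      then show ?thesis unfolding difference_coeffs_def using k(1) k0 by blast
    qed
  qed
  have pt: "difference_coeffs n d" if "j < n" "\<And>a. d (Inr a) = root_vec j 0 a" for j d
    unfolding difference_coeffs_def using that n by blast
  consider i where "J = basis_coeffs i" "K = B i"
    | i j where "J = (\<lambda>a. basis_coeffs i a + basis_coeffs j a)" "K = (\<lambda>a. B i a + B j a)"
    | j where "j < n" "J = point_coeffs j" "K = c j"
    | j i where "j < n" "J = (\<lambda>a. point_coeffs j a + basis_coeffs i a)" "K = (\<lambda>a. c j a + B i a)"
    using JK by (rule matching_pairs_cases)
  then have "difference_coeffs n J \<and> difference_coeffs m K"
  proof cases
    case 1
    then show ?thesis using zero[OF n] zero[OF m] B0 by (simp add: basis_coeffs_def)
  next
    case 2
    then show ?thesis using zero[OF n] zero[OF m] B0 by (simp add: basis_coeffs_def)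
  next
    case 3
    then show ?thesis using pt[OF 3(1)] star[OF 3(1)] by (simp add: point_coeffs_def)
  next
    case 4
    then show ?thesis using pt[OF 4(1)] star[OF 4(1)] B0 by (simp add: point_coeffs_def basis_coeffs_def)
  qed
  then show "difference_coeffs n J" "difference_coeffs m K" by blast+
qed

lemma common_neighbourhoods:
  assumes "finite P" "p \<in> topspace X" "q \<in> topspace Y"
    and "\<And>j. j \<in> P \<Longrightarrow> \<exists>U V. openin X U \<and> p \<in> U \<and> openin Y V \<and> q \<in> V \<and> (\<forall>u\<in>U. \<forall>a\<in>V. \<Phi> j u a)"
  shows "\<exists>U V. openin X U \<and> p \<in> U \<and> openin Y V \<and> q \<in> V \<and> (\<forall>u\<in>U. \<forall>a\<in>V. \<forall>j\<in>P. \<Phi> j u a)"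
  using assms(1,4)
proof (induction P)
  case empty
  show ?case
    by (intro exI[of _ "topspace X"] exI[of _ "topspace Y"]) (use assms(2,3) in simp)
next
  case (insert j P)
  obtain U V where 1: "openin X U" "p \<in> U" "openin Y V" "q \<in> V" "\<forall>u\<in>U. \<forall>a\<in>V. \<forall>j\<in>P. \<Phi> j u a"
    using insert.IH[OF insert.prems[OF insertI2]] by blast
  obtain U' V' where 2: "openin X U'" "p \<in> U'" "openin Y V'" "q \<in> V'" "\<forall>u\<in>U'. \<forall>a\<in>V'. \<Phi> j u a"
    using insert.prems[OF insertI1] by blast
  show ?case
  proof (intro exI[of _ "U \<inter> U'"] exI[of _ "V \<inter> V'"] conjI ballI)
    show "openin X (U \<inter> U')" "openin Y (V \<inter> V')" using 1 2 by (simp_all add: openin_Int)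
    show "\<Phi> i u a" if "u \<in> U \<inter> U'" "a \<in> V \<inter> V'" "i \<in> insert j P" for u a i
      using that 1(5) 2(5) by blast
  qed (use 1 2 in blast)+
qed

text \<open>If some distance at \<open>(w, y)\<close> is missing at \<open>(v, x)\<close>, it stays
  missing nearby by \<open>length_isolated\<close>, and no fingerprints agree there. Otherwise a
  matching exists, and nearby pairs with equal fingerprints satisfy the same finitely many length
  equations, so the same matching works for them.\<close>

lemma local_rigidity:
  assumes p: "(v, x) \<in> config_tuples m" "m \<ge> 1" and q: "(w, y) \<in> config_tuples n" "n \<ge> 1"
    and gi: "gram_independent (config_index m) (config_vec v x)"
  shows "\<exists>U V. openin (config_topology m) U \<and> (v, x) \<in> U \<and> openin (config_topology n) V \<and> (w, y) \<in> V \<and>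
     (\<forall>u\<in>U. \<forall>a\<in>V. density_fingerprint (config_set n (fst a) (snd a)) = density_fingerprint (config_set m (fst u) (snd u)) \<longrightarrow>
       isometric_sets (config_set n (fst a) (snd a)) (config_set m (fst u) (snd u)))"
proof -
  have pt: "(v, x) \<in> topspace (config_topology m)" "(w, y) \<in> topspace (config_topology n)"
    using p q by (simp_all add: config_topspace)
  have pd: "point_distances (config_set n (fst a) (snd a)) = point_distances (config_set m (fst u) (snd u))"
    if "u \<in> topspace (config_topology m)" "a \<in> topspace (config_topology n)"
      "density_fingerprint (config_set n (fst a) (snd a)) = density_fingerprint (config_set m (fst u) (snd u))" for u a
    using that p(2) q(2) unfolding config_topspace
    by (intro point_distances_eq_if_fingerprint_eq[OF represents_config represents_config]) auto
  show ?thesis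
  proof (cases "point_distances (config_set n w y) \<subseteq> point_distances (config_set m v x)")
    case False
    then obtain J where J: "difference_coeffs n J" "norm (config_comb n w y J) \<notin> point_distances (config_set m v x)"
      unfolding point_distances_config[where m = n] by blast
    define d where "d = norm (config_comb n w y J)"
    obtain \<epsilon> where \<epsilon>: "\<epsilon> > 0" "eventually (\<lambda>u. \<forall>c. difference_coeffs m c \<and>
       \<bar>norm (config_comb m (fst u) (snd u) c) - d\<bar> < \<epsilon> \<longrightarrow> norm (config_comb m v x c) = d) (nhdsin (config_topology m) (v, x))"
      using length_isolated[OF p(1)] by blast
    obtain U where U: "openin (config_topology m) U" "(v, x) \<in> U"
      "\<And>u c. u \<in> U \<Longrightarrow> difference_coeffs m c \<Longrightarrow> \<bar>norm (config_comb m (fst u) (snd u) c) - d\<bar> < \<epsilon> \<Longrightarrow> norm (config_comb m v x c) = d"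
      using \<epsilon>(2) pt(1) unfolding eventually_nhdsin by auto
    obtain V where V: "openin (config_topology n) V" "(w, y) \<in> V"
      "\<And>a. a \<in> V \<Longrightarrow> \<bar>norm (config_comb n (fst a) (snd a) J) - d\<bar> < \<epsilon>"
      using eventually_nhdsin_norm_diff[OF config_continuous_comb[of n J] pt(2) \<epsilon>(1)] pt(2)
      unfolding eventually_nhdsin d_def by auto
    have "density_fingerprint (config_set n (fst a) (snd a)) \<noteq> density_fingerprint (config_set m (fst u) (snd u))"
      if u: "u \<in> U" and a: "a \<in> V" for u a
    proof
      assume "density_fingerprint (config_set n (fst a) (snd a)) = density_fingerprint (config_set m (fst u) (snd u))"
      then have "point_distances (config_set n (fst a) (snd a)) = point_distances (config_set m (fst u) (snd u))"
        using u a openin_subset[OF U(1)] openin_subset[OF V(1)] by (intro pd) auto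
      then have "norm (config_comb n (fst a) (snd a) J) \<in> point_distances (config_set m (fst u) (snd u))"
        using J(1) unfolding point_distances_config[where m = n] by blast
      then obtain c where c: "difference_coeffs m c" "norm (config_comb n (fst a) (snd a) J) = norm (config_comb m (fst u) (snd u) c)"
        unfolding point_distances_config by blast
      then have "norm (config_comb m v x c) = d" using U(3)[OF u c(1)] V(3)[OF a] by simp
      then have "d \<in> point_distances (config_set m v x)"
        using c(1) unfolding point_distances_config by blast
      then show False using J(2) by (simp add: d_def)
    qed
    then show ?thesis using U(1,2) V(1,2) by blast
  next
    case True
    have w: "is_basis w" using q(1) by (simp add: config_tuples_def)
    have m0: "0 < m" and n0: "0 < n" using p(2) q(2) by simp_all
    obtain B c where mt: "matching m n B c" and iso: "matching_isometric m n B c v x w y"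
      and nrm: "\<forall>j<n. norm (y j - y 0) = norm (config_comb m v x (c j))"
      using matching_exists[OF m0 gi w n0 True] by blast
    define P where "P = matching_pairs n B c"
    have "\<exists>U V. openin (config_topology m) U \<and> (v, x) \<in> U \<and> openin (config_topology n) V \<and> (w, y) \<in> V \<and>
      (\<forall>u\<in>U. \<forall>a\<in>V. point_distances (config_set n (fst a) (snd a)) \<subseteq> point_distances (config_set m (fst u) (snd u)) \<longrightarrow>
       norm (config_comb n (fst a) (snd a) (fst jk)) = norm (config_comb m (fst u) (snd u) (snd jk)))"
      if "jk \<in> P" for jk
    proof -
      obtain J K where jk: "jk = (J, K)" by (cases jk)
      have JK: "(J, K) \<in> matching_pairs n B c" using that by (simp add: jk P_def)
      show ?thesis unfolding jk fst_conv snd_conv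
        by (rule norm_config_comb_eventually_eq[OF p(1) q(1) gi matching_pairs_difference_coeffs(2)[OF m0 n0 mt JK]
            matching_pairs_difference_coeffs(1)[OF m0 n0 mt JK] matching_pairs_norm_eq[OF iso nrm JK]])
    qed
    then obtain U V where oU: "openin (config_topology m) U" "openin (config_topology n) V"
      and pU: "(v, x) \<in> U" "(w, y) \<in> V"
      and UV: "\<forall>u\<in>U. \<forall>a\<in>V. \<forall>jk\<in>P.
        point_distances (config_set n (fst a) (snd a)) \<subseteq> point_distances (config_set m (fst u) (snd u)) \<longrightarrow>
       norm (config_comb n (fst a) (snd a) (fst jk)) = norm (config_comb m (fst u) (snd u) (snd jk))"
      using common_neighbourhoods[where \<Phi> = "\<lambda>jk u a.
        point_distances (config_set n (fst a) (snd a)) \<subseteq> point_distances (config_set m (fst u) (snd u)) \<longrightarrow>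
       norm (config_comb n (fst a) (snd a) (fst jk)) = norm (config_comb m (fst u) (snd u) (snd jk))",
          OF finite_matching_pairs[of n B c, folded P_def] pt] by blast
    have "isometric_sets (config_set n (fst a) (snd a)) (config_set m (fst u) (snd u))"
      if u: "u \<in> U" and a: "a \<in> V"
        and eq: "density_fingerprint (config_set n (fst a) (snd a)) = density_fingerprint (config_set m (fst u) (snd u))" for u a
    proof -
      have ut: "u \<in> topspace (config_topology m)" and at: "a \<in> topspace (config_topology n)"
        using u a openin_subset[OF oU(1)] openin_subset[OF oU(2)] by blast+
      have "norm (config_comb n (fst a) (snd a) J) = norm (config_comb m (fst u) (snd u) K)"
        if "(J, K) \<in> matching_pairs n B c" for J K
        using UV[rule_format, OF u a, of "(J, K)"] pd[OF ut at eq] that by (simp add: P_def)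
      then have "matching_isometric m n B c (fst u) (snd u) (fst a) (snd a)"
        by (rule matching_isometric_if_norm_eq)
      then show ?thesis
        using isometric_if_matching[of "fst u" "snd u" m "fst a" "snd a" n B c] ut at p(2) q(2) mt eq
        by (simp add: config_topspace)
    qed
    then show ?thesis using oU pU by blast
  qed
qed

section \<open>Density of generic configurations\<close>

text \<open>The smaller exponent is the exact power of 3 in the sum, since \<open>1 + 3 ^ d\<close>
  is never divisible by 3.\<close>

lemma three_power_sum_eq:
  fixes i j k l :: nat
  assumes "i \<le> j" "k \<le> l" "(3::nat) ^ i + 3 ^ j = 3 ^ k + 3 ^ l"
  shows "i = k \<and> j = l"
proof -
  have nd: "\<not> 3 dvd (1 + 3 ^ d :: nat)" for d
    by (cases d) (simp_all add: dvd_def, presburger+)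
  have 1: "(3::nat) ^ i + 3 ^ j = 3 ^ i * (1 + 3 ^ (j - i))" if "i \<le> j" for i j :: nat
    using that by (simp add: power_add[symmetric] distrib_left)
  have eq: "(3::nat) ^ i * (1 + 3 ^ (j - i)) = 3 ^ k * (1 + 3 ^ (l - k))"
    using assms 1 by simp
  have le: "a \<le> b" if "(3::nat) ^ a * (1 + 3 ^ p) = 3 ^ b * (1 + 3 ^ q)" for a b p q
  proof (rule ccontr)
    assume "\<not> a \<le> b"
    then have "(3::nat) ^ a = 3 ^ b * 3 ^ (a - b)" by (simp add: power_add[symmetric])
    then have "(3::nat) ^ b * (3 ^ (a - b) * (1 + 3 ^ p)) = 3 ^ b * (1 + 3 ^ q)" using that by (simp only: mult.assoc)
    then have "3 ^ (a - b) * (1 + 3 ^ p) = (1 + 3 ^ q :: nat) \<or> (3::nat) ^ b = 0" by (simp only: mult_cancel1)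
    then have "3 ^ (a - b) * (1 + 3 ^ p) = (1 + 3 ^ q :: nat)" by simp
    moreover have "3 dvd (3::nat) ^ (a - b)" using \<open>\<not> a \<le> b\<close> by (simp add: dvd_power)
    ultimately have "3 dvd (1 + 3 ^ q :: nat)" by (metis dvd_mult2)
    then show False using nd by blast
  qed
  have ik: "i = k" using le[OF eq] le[OF eq[symmetric]] by simp
  then have "(3::nat) ^ j = 3 ^ l" using assms(3) by simp
  then show ?thesis using ik by (simp add: power_inject_exp)
qed

lemma three_power_sum_eq':
  fixes i j k l :: nat
  assumes "(3::nat) ^ i + 3 ^ j = 3 ^ k + 3 ^ l"
  shows "(i = k \<and> j = l) \<or> (i = l \<and> j = k)"
proof -
  have *: "\<exists>i' j'. i' \<le> j' \<and> ((i' = i \<and> j' = j) \<or> (i' = j \<and> j' = i)) \<and> (3::nat) ^ i' + 3 ^ j' = 3 ^ i + 3 ^ j" for i j :: nat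
  proof (cases "i \<le> j")
    case True
    then show ?thesis by blast
  next
    case False
    then show ?thesis by (intro exI[of _ j] exI[of _ i]) auto
  qed
  obtain i' j' where 1: "i' \<le> j'" "(i' = i \<and> j' = j) \<or> (i' = j \<and> j' = i)" "(3::nat) ^ i' + 3 ^ j' = 3 ^ i + 3 ^ j"
    using *[of i j] by blast
  obtain k' l' where 2: "k' \<le> l'" "(k' = k \<and> l' = l) \<or> (k' = l \<and> l' = k)" "(3::nat) ^ k' + 3 ^ l' = 3 ^ k + 3 ^ l"
    using *[of k l] by blast
  have "i' = k' \<and> j' = l'" using 1 2 assms by (intro three_power_sum_eq) auto
  then show ?thesis using 1(2) 2(2) by blast
qed

text \<open>The nontrivial relations to be avoided; extensionality outside the finite index set
  makes them countably many.\<close>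

definition int_matrices :: "'i set \<Rightarrow> ('i \<Rightarrow> 'i \<Rightarrow> int) set" where
  "int_matrices I = {M \<in> I \<rightarrow>\<^sub>E (I \<rightarrow>\<^sub>E UNIV). (\<forall>a\<in>I. \<forall>b\<in>I. M a b = M b a) \<and> (\<exists>a\<in>I. \<exists>b\<in>I. M a b \<noteq> 0)}"

lemma countable_int_matrices: "finite I \<Longrightarrow> countable (int_matrices I)"
  by (rule countable_subset[of _ "I \<rightarrow>\<^sub>E (I \<rightarrow>\<^sub>E UNIV)"]) (auto simp: int_matrices_def intro!: countable_PiE)

lemma not_gram_independent_iff:
  "\<not> gram_independent I h \<longleftrightarrow> (\<exists>M\<in>int_matrices I. (\<Sum>a\<in>I. \<Sum>b\<in>I. of_int (M a b) * (h a \<bullet> h b)) = 0)"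
proof
  assume "\<not> gram_independent I h"
  then obtain M a b where M: "\<forall>a\<in>I. \<forall>b\<in>I. M a b = M b a" "(\<Sum>a\<in>I. \<Sum>b\<in>I. of_int (M a b) * (h a \<bullet> h b)) = 0"
    "a \<in> I" "b \<in> I" "M a b \<noteq> 0" unfolding gram_independent_def by blast
  define N where "N = (\<lambda>a\<in>I. \<lambda>b\<in>I. M a b)"
  have "N \<in> int_matrices I" using M by (auto simp: int_matrices_def N_def)
  moreover have "(\<Sum>a\<in>I. \<Sum>b\<in>I. of_int (N a b) * (h a \<bullet> h b)) = (\<Sum>a\<in>I. \<Sum>b\<in>I. of_int (M a b) * (h a \<bullet> h b))"
    by (intro sum.cong refl) (simp add: N_def)
  ultimately show "\<exists>M\<in>int_matrices I. (\<Sum>a\<in>I. \<Sum>b\<in>I. of_int (M a b) * (h a \<bullet> h b)) = 0" using M(2) by auto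
next
  assume "\<exists>M\<in>int_matrices I. (\<Sum>a\<in>I. \<Sum>b\<in>I. of_int (M a b) * (h a \<bullet> h b)) = 0"
  then obtain M where M: "M \<in> int_matrices I" "(\<Sum>a\<in>I. \<Sum>b\<in>I. of_int (M a b) * (h a \<bullet> h b)) = 0" by blast
  then have "\<forall>a\<in>I. \<forall>b\<in>I. M a b = M b a" "\<exists>a\<in>I. \<exists>b\<in>I. M a b \<noteq> 0" by (auto simp: int_matrices_def)
  then show "\<not> gram_independent I h" using M(2) unfolding gram_independent_def by blast
qed

lemma exists_outside_countable:
  assumes "countable S" "e > 0" shows "\<exists>t::real. \<bar>t\<bar> < e \<and> t \<notin> S"
proof (rule ccontr)
  assume "\<not> ?thesis"
  then have "{-e<..<e} \<subseteq> S" by (auto simp: abs_less_iff)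
  then have "countable {-e<..<e}" using assms(1) countable_subset by blast
  then show False using assms(2) uncountable_open_interval[of "-e" e] by simp
qed

text \<open>The vectors \<open>\<theta> ^ (3 ^ i)\<close> on a line, for transcendental \<open>\<theta>\<close>: their products have pairwise
  different exponents.\<close>

lemma gram_independent_exists:
  fixes idx :: "'i \<Rightarrow> nat"
  assumes fin: "finite I" and inj: "inj_on idx I"
  shows "\<exists>h :: 'i \<Rightarrow> real^3. gram_independent I h"
proof -
  define p where "p = (\<lambda>M :: 'i \<Rightarrow> 'i \<Rightarrow> int. \<Sum>a\<in>I. \<Sum>b\<in>I. monom (real_of_int (M a b)) (3 ^ idx a + 3 ^ idx b))"
  have nz: "p M \<noteq> 0" if M: "M \<in> int_matrices I" for M
  proof -
    obtain a b where ab: "a \<in> I" "b \<in> I" "M a b \<noteq> 0" using M by (auto simp: int_matrices_def)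
    have sym: "M b a = M a b" using M ab by (auto simp: int_matrices_def)
    \<comment> \<open>Only the entries at \<open>(a, b)\<close> and \<open>(b, a)\<close> have this
      exponent, so the coefficient is \<open>M a b\<close>, counted once or twice according to
      whether \<open>a = b\<close>.\<close>
    define E where "E = (3::nat) ^ idx a + 3 ^ idx b"
    have "coeff (p M) E = (\<Sum>c\<in>I. \<Sum>d\<in>I. if 3 ^ idx c + 3 ^ idx d = E then real_of_int (M c d) else 0)"
      by (simp add: p_def coeff_sum coeff_monom)
    also have "\<dots> = (\<Sum>c\<in>I. \<Sum>d\<in>I. if (c, d) \<in> {(a, b), (b, a)} then real_of_int (M a b) else 0)"
    proof (intro sum.cong refl)
      fix c d assume cd: "c \<in> I" "d \<in> I"
      have "3 ^ idx c + 3 ^ idx d = E \<longleftrightarrow> (c, d) \<in> {(a, b), (b, a)}"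
        using three_power_sum_eq'[of "idx c" "idx d" "idx a" "idx b"] inj_onD[OF inj] ab cd by (auto simp: E_def)
      then show "(if 3 ^ idx c + 3 ^ idx d = E then real_of_int (M c d) else 0) =
          (if (c, d) \<in> {(a, b), (b, a)} then real_of_int (M a b) else 0)"
        using sym by auto
    qed
    also have "\<dots> = (\<Sum>q\<in>I \<times> I. if q \<in> {(a, b), (b, a)} then real_of_int (M a b) else 0)"
      unfolding sum.cartesian_product
    proof (rule sum.cong[OF refl])
      fix q :: "'i \<times> 'i"
      show "(case q of (c, d) \<Rightarrow> if (c, d) \<in> {(a, b), (b, a)} then real_of_int (M a b) else 0) =
        (if q \<in> {(a, b), (b, a)} then real_of_int (M a b) else 0)" by (cases q) simp
    qed
    also have "\<dots> = (\<Sum>q\<in>(I \<times> I) \<inter> {(a, b), (b, a)}. real_of_int (M a b))"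
      using fin by (subst sum.inter_restrict) auto
    also have "(I \<times> I) \<inter> {(a, b), (b, a)} = {(a, b), (b, a)}" using ab by auto
    finally have "coeff (p M) E = real (card {(a, b), (b, a)}) * real_of_int (M a b)" by simp
    moreover have "card {(a, b), (b, a)} \<noteq> 0" by simp
    ultimately have "coeff (p M) E \<noteq> 0" using ab(3) by (metis mult_eq_0_iff of_int_eq_0_iff of_nat_eq_0_iff)
    then show ?thesis by auto
  qed
  have "countable (\<Union>M\<in>int_matrices I. {\<theta>. poly (p M) \<theta> = 0})"
    using nz by (intro countable_UN countable_int_matrices fin countable_finite poly_roots_finite) auto
  from exists_outside_countable[OF this zero_less_one]
  obtain \<theta> where \<theta>: "\<And>M. M \<in> int_matrices I \<Longrightarrow> poly (p M) \<theta> \<noteq> 0" by blast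
  define h :: "'i \<Rightarrow> real^3" where "h = (\<lambda>a. \<theta> ^ (3 ^ idx a) *\<^sub>R axis 1 1)"
  have "(\<Sum>a\<in>I. \<Sum>b\<in>I. of_int (M a b) * (h a \<bullet> h b)) = poly (p M) \<theta>" for M
    by (simp add: p_def h_def poly_sum poly_monom power_add inner_axis_axis mult_ac)
  then have "gram_independent I h"
    using not_gram_independent_iff[of I h] \<theta> by metis
  then show ?thesis by blast
qed

text \<open>Along the line each relation is a polynomial in \<open>t\<close> whose coefficient at
  the square is the relation at \<open>h\<close>, which is nonzero. Countably many relations
  therefore exclude only countably many \<open>t\<close>.\<close>

lemma gram_independent_line:
  fixes h u :: "'i \<Rightarrow> 'v::real_inner"
  assumes fin: "finite I" and gi: "gram_independent I h" and e: "e > 0"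
  shows "\<exists>t. \<bar>t\<bar> < e \<and> gram_independent I (\<lambda>a. u a + t *\<^sub>R h a)"
proof -
  define q where "q = (\<lambda>(M :: 'i \<Rightarrow> 'i \<Rightarrow> int) (k :: 'i \<Rightarrow> 'v) (l :: 'i \<Rightarrow> 'v). \<Sum>a\<in>I. \<Sum>b\<in>I. of_int (M a b) * (k a \<bullet> l b) :: real)"
  define p where "p = (\<lambda>M. [:q M u u, q M u h + q M h u, q M h h:])"
  have nz: "p M \<noteq> 0" if "M \<in> int_matrices I" for M
    using not_gram_independent_iff[of I h] gi that by (auto simp: p_def q_def)
  have val: "(\<Sum>a\<in>I. \<Sum>b\<in>I. of_int (M a b) * ((u a + t *\<^sub>R h a) \<bullet> (u b + t *\<^sub>R h b))) = poly (p M) t" for M t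
  proof -
    have "poly (p M) t = q M u u + t * (q M u h + q M h u) + t * t * q M h h"
      by (simp add: p_def algebra_simps)
    also have "\<dots> = (\<Sum>a\<in>I. \<Sum>b\<in>I. of_int (M a b) * ((u a + t *\<^sub>R h a) \<bullet> (u b + t *\<^sub>R h b)))"
      unfolding q_def sum_distrib_left sum.distrib[symmetric]
      by (intro sum.cong refl) (simp add: inner_add_left inner_add_right algebra_simps)
    finally show ?thesis by simp
  qed
  have "countable (\<Union>M\<in>int_matrices I. {t. poly (p M) t = 0})"
    using nz by (intro countable_UN countable_int_matrices fin countable_finite poly_roots_finite) auto
  from exists_outside_countable[OF this e]
  obtain t where t: "\<bar>t\<bar> < e" "\<And>M. M \<in> int_matrices I \<Longrightarrow> poly (p M) t \<noteq> 0"
    by blast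
  have "gram_independent I (\<lambda>a. u a + t *\<^sub>R h a)"
    using not_gram_independent_iff[of I "\<lambda>a. u a + t *\<^sub>R h a"] t(2) val by metis
  then show ?thesis using t(1) by blast
qed

section \<open>Moving configurations into generic position\<close>

lemma config_index_enumeration: "\<exists>idx :: 3 + nat \<Rightarrow> nat. inj idx"
proof -
  obtain f :: "3 \<Rightarrow> nat" where f: "inj f"
    using finite_imp_inj_to_nat_seg[OF finite[of "UNIV :: 3 set"]] by blast
  have "inj (case_sum (\<lambda>i. 2 * f i) (\<lambda>k. 2 * k + 1))"
  proof (rule injI)
    fix a b :: "3 + nat"
    assume eq: "case_sum (\<lambda>i. 2 * f i) (\<lambda>k. 2 * k + 1) a = case_sum (\<lambda>i. 2 * f i) (\<lambda>k. 2 * k + 1) b"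
    show "a = b"
      using eq by (cases a; cases b) (auto dest: injD[OF f], presburger+)
  qed
  then show ?thesis by blast
qed

lemma config_tuples_subset_topspace: "config_tuples m \<subseteq> topspace (config_space m)"
  by (auto simp: config_tuples_def)

text \<open>Configurations may have points on the closed faces of the half-open cell, so they need
  not form an open set of the ambient product. Those with all points in the open cell do, and
  inherit its compact neighbourhoods.\<close>

definition inner_configs :: "nat \<Rightarrow> ((real^3^3) \<times> (nat \<Rightarrow> real^3)) set" where
  "inner_configs m = {(v, x) \<in> config_tuples m. \<forall>k<m. \<forall>i. 0 < coords v (x k) $ i}"

text \<open>With three basis vectors the combination of \<open>r\<close> moves by at most
  \<open>3 * \<eta> * norm r\<close>, so half of the lower bound \<open>e\<close> survives. Applied
  to the difference of the coordinate vectors this gives the estimate.\<close>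

lemma coords_perturbation:
  assumes v: "is_basis v" and e: "e > 0" "\<And>r. norm (basis_comb v r) \<ge> e * norm r"
    and \<eta>: "0 \<le> \<eta>" "\<eta> \<le> e / 6" and near: "\<And>i. norm (v' $ i - v $ i) \<le> \<eta>"
  shows "is_basis v'"
    and "norm (z' - z) \<le> \<eta> \<Longrightarrow> norm (coords v' z' - coords v z) \<le> 2 * \<eta> * (1 + 3 * norm (coords v z)) / e"
proof -
  have diff: "norm (basis_comb v' r - basis_comb v r) \<le> 3 * \<eta> * norm r" for r
  proof -
    have "basis_comb v' r - basis_comb v r = (\<Sum>i\<in>UNIV. r $ i *\<^sub>R (v' $ i - v $ i))"
      by (simp add: basis_comb_def sum_subtractf scaleR_diff_right)
    then have "norm (basis_comb v' r - basis_comb v r) \<le> (\<Sum>i\<in>UNIV. norm (r $ i *\<^sub>R (v' $ i - v $ i)))"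
      by (simp only: norm_sum)
    also have "\<dots> \<le> (\<Sum>i\<in>(UNIV::3 set). norm r * \<eta>)"
    proof (rule sum_mono)
      fix i :: 3
      show "norm (r $ i *\<^sub>R (v' $ i - v $ i)) \<le> norm r * \<eta>"
        using component_le_norm_cart[of r i] near[of i] \<eta>(1)
        by (simp only: norm_scaleR) (intro mult_mono; simp)
    qed
    also have "\<dots> = 3 * \<eta> * norm r" by simp
    finally show ?thesis .
  qed
  have lower: "e / 2 * norm r \<le> norm (basis_comb v' r)" for r
  proof -
    have "norm (basis_comb v r) \<le> norm (basis_comb v' r) + norm (basis_comb v' r - basis_comb v r)"
      using norm_triangle_ineq4[of "basis_comb v' r" "basis_comb v' r - basis_comb v r"] by simp
    moreover have "3 * \<eta> * norm r \<le> e / 2 * norm r" using \<eta>(2) by (intro mult_right_mono) auto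
    ultimately show ?thesis using e(2)[of r] diff[of r] by (simp add: field_simps)
  qed
  show v': "is_basis v'"
  proof (rule is_basis_if_inj)
    show "inj (basis_comb v')" unfolding linear_injective_0[OF linear_basis_comb]
    proof (intro allI impI)
      fix r assume "basis_comb v' r = 0"
      then have "e / 2 * norm r \<le> 0" using lower[of r] by simp
      then show "r = 0" using e(1) by (simp add: mult_le_0_iff)
    qed
  qed
  assume z: "norm (z' - z) \<le> \<eta>"
  define r where "r = coords v z"
  define r' where "r' = coords v' z'"
  have "basis_comb v' (r' - r) = (z' - z) - (basis_comb v' r - basis_comb v r)"
    using basis_comb_coords[OF v, of z] basis_comb_coords[OF v', of z']
    by (simp add: linear_diff[OF linear_basis_comb] r_def r'_def)
  then have "norm (basis_comb v' (r' - r)) \<le> \<eta> + 3 * \<eta> * norm r"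
    using norm_triangle_ineq4[of "z' - z" "basis_comb v' r - basis_comb v r"] z diff[of r] by simp
  then have "e / 2 * norm (r' - r) \<le> \<eta> * (1 + 3 * norm r)"
    using lower[of "r' - r"] by (simp add: algebra_simps)
  then show "norm (coords v' z' - coords v z) \<le> 2 * \<eta> * (1 + 3 * norm (coords v z)) / e"
    using e(1) by (simp add: r_def r'_def field_simps)
qed

lemma openin_inner_configs: "openin (config_space m) (inner_configs m)"
  unfolding openin_subopen[of _ "inner_configs m"]
proof
  fix p assume p: "p \<in> inner_configs m"
  obtain v x where vx: "p = (v, x)" by (cases p)
  have pt: "p \<in> topspace (config_space m)"
    using p config_tuples_subset_topspace by (auto simp: inner_configs_def)
  have v: "is_basis v" and inj: "inj_on x {..<m}" and cell: "\<And>k. k < m \<Longrightarrow> x k \<in> unit_cell v"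
    and pos: "\<And>k i. k < m \<Longrightarrow> 0 < coords v (x k) $ i"
    using p by (auto simp: inner_configs_def config_tuples_def vx)
  have less1: "coords v (x k) $ i < 1" if "k < m" for k i
    using cell[OF that] unfolding unit_cell_eq[OF v] by blast
  obtain e where e: "e > 0" "\<And>r. norm (basis_comb v r) \<ge> e * norm r"
    using basis_comb_lower_bound[OF v] by blast
  have evb: "eventually (\<lambda>u. \<forall>i\<in>UNIV. norm (fst u $ i - v $ i) < \<eta>) (nhdsin (config_space m) p)" if "\<eta> > 0" for \<eta>
    using eventually_nhdsin_norm_diff[OF config_space_continuous_basis pt that]
    by (intro eventually_ball_finite) (auto simp: vx)
  have evx: "eventually (\<lambda>u. norm (snd u k - x k) < \<eta>) (nhdsin (config_space m) p)" if "\<eta> > 0" "k < m" for \<eta> k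
    using eventually_nhdsin_norm_diff[OF config_space_continuous_point[OF that(2)] pt that(1)] by (simp add: vx)
  have ev1: "eventually (\<lambda>u. is_basis (fst u)) (nhdsin (config_space m) p)"
  proof -
    have "e / 6 > 0" using e(1) by simp
    from evb[OF this] show ?thesis
    proof eventually_elim
      case (elim u)
      then show ?case using e(1) by (intro coords_perturbation(1)[OF v e, of "e / 6"]) (auto simp: less_imp_le)
    qed
  qed
  have ev2: "eventually (\<lambda>u. 0 < coords (fst u) (snd u k) $ i \<and> coords (fst u) (snd u k) $ i < 1) (nhdsin (config_space m) p)"
    if k: "k < m" for k i
  proof -
    define \<epsilon> where "\<epsilon> = min (coords v (x k) $ i) (1 - coords v (x k) $ i)"
    have \<epsilon>: "\<epsilon> > 0" using pos[OF k] less1[OF k] by (simp add: \<epsilon>_def)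
    define D where "D = 1 + 3 * norm (coords v (x k))"
    have D: "D > 0" by (simp add: D_def add_pos_nonneg)
    \<comment> \<open>With this choice the perturbation bound is at most
      \<open>\<epsilon> / 2\<close>, while \<open>\<epsilon>\<close> is the distance of the
      coordinate from 0 and 1.\<close>
    define \<eta> where "\<eta> = min (e / 6) (\<epsilon> * e / (4 * D))"
    have \<eta>: "\<eta> > 0" "\<eta> \<le> e / 6" "\<eta> \<le> \<epsilon> * e / (4 * D)" using e(1) \<epsilon> D by (simp_all add: \<eta>_def)
    have small: "2 * \<eta> * D / e < \<epsilon>"
    proof -
      have "2 * \<eta> * D / e \<le> 2 * (\<epsilon> * e / (4 * D)) * D / e"
        using \<eta>(3) D e(1) by (intro divide_right_mono mult_right_mono mult_left_mono) auto
      also have "\<dots> = \<epsilon> / 2" using D e(1) by (simp add: field_simps)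
      finally show ?thesis using \<epsilon> by simp
    qed
    from evb[OF \<eta>(1)] evx[OF \<eta>(1) k] show ?thesis
    proof eventually_elim
      case (elim u)
      have "norm (coords (fst u) (snd u k) - coords v (x k)) \<le> 2 * \<eta> * (1 + 3 * norm (coords v (x k))) / e"
        using elim \<eta> by (intro coords_perturbation(2)[OF v e]) (auto simp: less_imp_le)
      then have "norm (coords (fst u) (snd u k) - coords v (x k)) < \<epsilon>" using small unfolding D_def by linarith
      then have "\<bar>coords (fst u) (snd u k) $ i - coords v (x k) $ i\<bar> < \<epsilon>"
        using component_le_norm_cart[of "coords (fst u) (snd u k) - coords v (x k)" i] by simp
      then show ?case unfolding \<epsilon>_def by linarith
    qed
  qed
  have ev2': "eventually (\<lambda>u. \<forall>k\<in>{..<m}. \<forall>i\<in>UNIV. 0 < coords (fst u) (snd u k) $ i \<and> coords (fst u) (snd u k) $ i < 1) (nhdsin (config_space m) p)"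
    using ev2 by (intro eventually_ball_finite ballI) auto
  have ev3: "eventually (\<lambda>u. snd u k \<noteq> snd u l) (nhdsin (config_space m) p)" if kl: "k < m" "l < m" "k \<noteq> l" for k l
  proof -
    have "x k \<noteq> x l" using inj kl by (auto dest: inj_onD)
    then have d: "norm (x k - x l) / 2 > 0" by simp
    from evx[OF d kl(1)] evx[OF d kl(2)] show ?thesis
    proof eventually_elim
      case (elim u)
      show ?case
      proof
        assume eq: "snd u k = snd u l"
        have "norm (x k - x l) \<le> norm (snd u k - x k) + norm (snd u l - x l)"
          using norm_triangle_ineq4[of "snd u l - x l" "snd u k - x k"] eq by simp
        then show False using elim by linarith
      qed
    qed
  qed
  have ev3': "eventually (\<lambda>u. \<forall>kl\<in>{(k, l). k < m \<and> l < m \<and> k \<noteq> l}. snd u (fst kl) \<noteq> snd u (snd kl)) (nhdsin (config_space m) p)"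
  proof (rule eventually_ball_finite)
    show "finite {(k, l). k < m \<and> l < m \<and> k \<noteq> l}"
      by (rule finite_subset[of _ "{..<m} \<times> {..<m}"]) auto
  qed (use ev3 in auto)
  have ev4: "eventually (\<lambda>u. u \<in> topspace (config_space m)) (nhdsin (config_space m) p)"
    unfolding eventually_nhdsin using pt openin_topspace by blast
  from ev1 ev2' ev3' ev4 have "eventually (\<lambda>u. u \<in> inner_configs m) (nhdsin (config_space m) p)"
  proof eventually_elim
    case (elim u)
    obtain v' x' where u: "u = (v', x')" by (cases u)
    have v': "is_basis v'" using elim(1) u by simp
    have "x' k \<in> unit_cell v'" if "k < m" for k
      unfolding unit_cell_eq[OF v'] using elim(2) that u by (auto intro: less_imp_le)
    moreover have "x' \<in> {..<m} \<rightarrow>\<^sub>E UNIV" using elim(4) u by auto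
    ultimately have "x' \<in> {..<m} \<rightarrow>\<^sub>E unit_cell v'" by (auto simp: PiE_iff)
    moreover have "inj_on x' {..<m}" using elim(3) u by (auto simp: inj_on_def)
    ultimately show ?case using elim(2) u v' by (auto simp: inner_configs_def config_tuples_def)
  qed
  then show "\<exists>T. openin (config_space m) T \<and> p \<in> T \<and> T \<subseteq> inner_configs m"
    unfolding eventually_nhdsin using pt by blast
qed

lemma inner_configs_subset: "inner_configs m \<subseteq> config_tuples m"
  by (auto simp: inner_configs_def)

definition config_path :: "nat \<Rightarrow> ((real^3^3) \<times> (nat \<Rightarrow> real^3)) \<Rightarrow> (3 + nat \<Rightarrow> real^3) \<Rightarrow> real \<Rightarrow> (real^3^3) \<times> (nat \<Rightarrow> real^3)" where
  "config_path m p h t =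
     ((\<chi> i. fst p $ i + t *\<^sub>R h (Inl i)), (\<lambda>k\<in>{..<m}. snd p k + t *\<^sub>R h (Inr k)))"

lemma continuous_config_path: "continuous_map euclideanreal (config_space m) (config_path m p h)"
proof -
  have 1: "continuous_map euclideanreal euclidean (\<lambda>t. \<chi> i. fst p $ i + t *\<^sub>R h (Inl i))"
    by (auto intro!: continuous_intros)
  have 2: "continuous_map euclideanreal (product_topology (\<lambda>_. euclidean) {..<m}) (\<lambda>t. \<lambda>k\<in>{..<m}. snd p k + t *\<^sub>R h (Inr k))"
    unfolding continuous_map_componentwise by (auto intro!: continuous_intros)
  show ?thesis
    unfolding continuous_map_pairwise config_path_def using 1 2 by (simp add: o_def)
qed

lemma config_path_0: "p \<in> topspace (config_space m) \<Longrightarrow> config_path m p h 0 = p"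
  by (cases p) (auto simp: config_path_def vec_eq_iff PiE_def extensional_def restrict_def fun_eq_iff)

definition generic_configs :: "nat \<Rightarrow> ((real^3^3) \<times> (nat \<Rightarrow> real^3)) set" where
  "generic_configs m = {(v, x) \<in> inner_configs m. gram_independent (config_index m) (config_vec v x)}"

lemma path_in_open:
  assumes "openin (config_space m) W" "p \<in> W"
  shows "\<exists>e>0. \<forall>t. \<bar>t\<bar> < e \<longrightarrow> config_path m p h t \<in> W"
proof -
  have "open {t. config_path m p h t \<in> W}"
    using openin_continuous_map_preimage[OF continuous_config_path assms(1), of p h] by simp
  moreover have "0 \<in> {t. config_path m p h t \<in> W}"
    using assms(2) config_path_0[of p m h] openin_subset[OF assms(1)] by auto
  ultimately obtain e where "e > 0" "ball 0 e \<subseteq> {t. config_path m p h t \<in> W}"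
    by (rule openE)
  then show ?thesis by (auto simp: subset_eq dist_norm)
qed

text \<open>A common contraction of the motif towards the centre of the cell moves all coordinates
  strictly between 0 and 1 and keeps the points distinct.\<close>

lemma inner_configs_dense:
  assumes W: "openin (config_space m) W" and p: "p \<in> W" "p \<in> config_tuples m"
  shows "\<exists>q\<in>W. q \<in> inner_configs m"
proof -
  obtain v x where vx: "p = (v, x)" by (cases p)
  have v: "is_basis v" and inj: "inj_on x {..<m}" and cell: "\<And>k. k < m \<Longrightarrow> x k \<in> unit_cell v" and ext: "x \<in> extensional {..<m}"
    using p(2) by (auto simp: config_tuples_def vx PiE_def)
  define b where "b = basis_comb v (\<chi> i. 1 / 2)"
  define h :: "3 + nat \<Rightarrow> real^3" where "h = case_sum (\<lambda>_. 0) (\<lambda>k. b - x k)"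
  obtain e where e: "e > 0" "\<And>t. \<bar>t\<bar> < e \<Longrightarrow> config_path m p h t \<in> W"
    using path_in_open[OF W p(1), of h] by blast
  define t where "t = min (e / 2) (1 / 2)"
  have t: "0 < t" "t < 1" "\<bar>t\<bar> < e" using e(1) by (auto simp: t_def)
  define x' where "x' = (\<lambda>k\<in>{..<m}. x k + t *\<^sub>R (b - x k))"
  have path: "config_path m p h t = (v, x')"
    by (simp add: config_path_def h_def vx x'_def vec_eq_iff)
  have c: "coords v (x' k) $ i = (1 - t) * coords v (x k) $ i + t / 2" if "k < m" for k i
  proof -
    have "coords v (x' k) = coords v (x k) + t *\<^sub>R ((\<chi> i. 1 / 2) - coords v (x k))"
      using that v by (simp add: x'_def b_def linear_add[OF linear_coords] linear_scale[OF linear_coords] linear_diff[OF linear_coords])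
    then have "coords v (x' k) $ i = coords v (x k) $ i + t * (1 / 2 - coords v (x k) $ i)" by simp
    then show ?thesis by (simp add: algebra_simps)
  qed
  have in01: "0 < coords v (x' k) $ i \<and> coords v (x' k) $ i < 1" if "k < m" for k i
  proof -
    have "0 \<le> coords v (x k) $ i" "coords v (x k) $ i < 1"
      using cell[OF that] unfolding unit_cell_eq[OF v] by blast+
    then have "0 \<le> (1 - t) * coords v (x k) $ i" "(1 - t) * coords v (x k) $ i \<le> (1 - t) * 1"
      using t by (intro mult_nonneg_nonneg mult_left_mono; simp)+
    moreover define s where "s = (1 - t) * coords v (x k) $ i"
    ultimately have "0 \<le> s" "s \<le> 1 - t" by simp_all
    then have "0 < s + t / 2" "s + t / 2 < 1" using t by linarith+
    then show ?thesis unfolding c[OF that] s_def by blast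
  qed
  have "x' \<in> {..<m} \<rightarrow>\<^sub>E unit_cell v"
  proof (rule PiE_I)
    fix k assume "k \<in> {..<m}"
    then show "x' k \<in> unit_cell v" unfolding unit_cell_eq[OF v] using in01 by (auto intro: less_imp_le)
  qed (simp add: x'_def)
  moreover have "inj_on x' {..<m}"
  proof (rule inj_onI)
    fix k l assume kl: "k \<in> {..<m}" "l \<in> {..<m}" "x' k = x' l"
    then have "(1 - t) *\<^sub>R x k = (1 - t) *\<^sub>R x l" by (simp add: x'_def algebra_simps)
    then have "x k = x l" using t by simp
    then show "k = l" using inj kl by (auto dest: inj_onD)
  qed
  ultimately have "(v, x') \<in> inner_configs m"
    using v in01 by (auto simp: inner_configs_def config_tuples_def)
  then show ?thesis using e(2)[OF t(3)] path by auto
qed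

lemma generic_configs_dense:
  assumes W: "openin (config_topology m) W" and ne: "W \<noteq> {}"
  shows "\<exists>q\<in>W. q \<in> generic_configs m"
proof -
  obtain W' where W': "openin (config_space m) W'" "W = W' \<inter> config_tuples m"
    using W unfolding config_topology_eq openin_subtopology by blast
  obtain p where "p \<in> W'" "p \<in> config_tuples m" using ne W'(2) by blast
  from inner_configs_dense[OF W'(1) this]
  obtain q where q: "q \<in> W'" "q \<in> inner_configs m" by blast
  have op: "openin (config_space m) (W' \<inter> inner_configs m)"
    by (intro openin_Int W'(1) openin_inner_configs)
  obtain h :: "3 + nat \<Rightarrow> real^3" where h: "gram_independent (config_index m) h"
    using gram_independent_exists[OF finite_config_index] config_index_enumeration by (metis inj_on_subset subset_UNIV)
  obtain e where e: "e > 0" "\<And>t. \<bar>t\<bar> < e \<Longrightarrow> config_path m q h t \<in> W' \<inter> inner_configs m"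
    using path_in_open[OF op, of q h] q by blast
  obtain t where t: "\<bar>t\<bar> < e" "gram_independent (config_index m) (\<lambda>a. config_vec (fst q) (snd q) a + t *\<^sub>R h a)"
    using gram_independent_line[OF finite_config_index h e(1)] by blast
  have eq: "config_vec (fst (config_path m q h t)) (snd (config_path m q h t)) a = config_vec (fst q) (snd q) a + t *\<^sub>R h a"
    if "a \<in> config_index m" for a
    using that by (auto simp: config_index_def config_vec_def config_path_def)
  have "gram_independent (config_index m) (config_vec (fst (config_path m q h t)) (snd (config_path m q h t)))"
    using t(2) unfolding gram_independent_def by (simp add: eq cong: sum.cong)
  then have "config_path m q h t \<in> generic_configs m"
    using e(2)[OF t(1)] by (auto simp: generic_configs_def case_prod_beta)
  moreover have "config_path m q h t \<in> W"
    using e(2)[OF t(1)] W'(2) inner_configs_subset by blast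
  ultimately show ?thesis by blast
qed

lemma countable_dense_generic_configs:
  "\<exists>D. countable D \<and> D \<subseteq> generic_configs m \<and> (\<forall>W. openin (config_topology m) W \<and> W \<noteq> {} \<longrightarrow> W \<inter> D \<noteq> {})"
proof -
  obtain D where D: "countable D" "D \<subseteq> generic_configs m" "generic_configs m \<subseteq> closure D"
    using separable[of "generic_configs m"] by blast
  \<comment> \<open>Separability is available for the topology of the full function type. The
    restriction map is continuous into the ambient product and fixes configurations, so it transfers
    density.\<close>
  define f where "f = (\<lambda>p :: (real^3^3) \<times> (nat \<Rightarrow> real^3). (fst p, restrict (snd p) {..<m}))"
  have f: "continuous_map euclidean (config_space m) f"
  proof -
    have 1: "continuous_map euclidean euclidean (fst :: (real^3^3) \<times> (nat \<Rightarrow> real^3) \<Rightarrow> _)"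
      by (auto intro!: continuous_intros)
    have c: "continuous_on UNIV (\<lambda>p :: (real^3^3) \<times> (nat \<Rightarrow> real^3). snd p k)" for k
    proof -
      have "continuous_on UNIV (\<lambda>p :: (real^3^3) \<times> (nat \<Rightarrow> real^3). snd p)" by (intro continuous_intros)
      then show ?thesis by (rule continuous_on_product_then_coordinatewise)
    qed
    have 2: "continuous_map euclidean (product_topology (\<lambda>_. euclidean) {..<m})
        (\<lambda>p :: (real^3^3) \<times> (nat \<Rightarrow> real^3). restrict (snd p) {..<m})"
      unfolding continuous_map_componentwise using c by auto
    show ?thesis unfolding continuous_map_pairwise f_def using 1 2 by (simp add: o_def)
  qed
  have fid: "f p = p" if "p \<in> config_tuples m" for p
    using that by (cases p) (auto simp: f_def config_tuples_def PiE_def extensional_def restrict_def fun_eq_iff)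
  have gen: "generic_configs m \<subseteq> config_tuples m"
    using inner_configs_subset by (auto simp: generic_configs_def)
  have "W \<inter> D \<noteq> {}" if W: "openin (config_topology m) W" "W \<noteq> {}" for W
  proof -
    obtain W' where W': "openin (config_space m) W'" "W = W' \<inter> config_tuples m"
      using W(1) unfolding config_topology_eq openin_subtopology by blast
    obtain q where q: "q \<in> W" "q \<in> generic_configs m" using generic_configs_dense[OF W] by blast
    have "open {p. f p \<in> W'}" using openin_continuous_map_preimage[OF f W'(1)] by simp
    moreover have "q \<in> {p. f p \<in> W'}" using fid[of q] q W' gen by auto
    moreover have "q \<in> closure D" using D(3) q(2) by blast
    ultimately have "{p. f p \<in> W'} \<inter> D \<noteq> {}" using open_Int_closure_eq_empty by blast
    then obtain d where "d \<in> D" "f d \<in> W'" by blast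
    moreover have "d \<in> config_tuples m" using \<open>d \<in> D\<close> D(2) gen by blast
    ultimately show ?thesis using fid[of d] W'(2) by auto
  qed
  then show ?thesis using D(1,2) by blast
qed

section \<open>Compact neighbourhoods along a dense sequence\<close>

lemma compact_neighbourhood_inner:
  assumes W: "openin (config_space m) W" and p: "p \<in> W"
  shows "\<exists>U K. openin (config_space m) U \<and> compactin (config_space m) K \<and> p \<in> U \<and> U \<subseteq> K \<and> K \<subseteq> W"
proof -
  have "locally_compact_space (config_space m)"
    by (simp add: locally_compact_space_prod_topology locally_compact_space_product_topology locally_compact_space_euclidean)
  moreover have "Hausdorff_space (config_space m)"
    by (simp add: Hausdorff_space_prod_topology Hausdorff_space_product_topology)
  ultimately have "neighbourhood_base_of (compactin (config_space m)) (config_space m)"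
    using locally_compact_space_neighbourhood_base by blast
  then show ?thesis unfolding neighbourhood_base_of using W p by blast
qed


text \<open>Choosing the neighbourhoods \<open>K\<close> of a dense sequence one after the other, each one small with
  respect to the previous ones, extends a local relation to all pairs.\<close>

lemma compact_uniform_neighbourhood:
  assumes loc: "\<And>a. a \<in> topspace X \<Longrightarrow> \<exists>U V. openin X U \<and> p \<in> U \<and> openin X V \<and> a \<in> V \<and> (\<forall>u\<in>U. \<forall>b\<in>V. E u b)"
    and p: "p \<in> topspace X" and K: "compactin X K"
  shows "\<exists>U. openin X U \<and> p \<in> U \<and> (\<forall>u\<in>U. \<forall>b\<in>K. E u b)"
proof -
  define \<V> where "\<V> = {V. openin X V \<and> (\<exists>U. openin X U \<and> p \<in> U \<and> (\<forall>u\<in>U. \<forall>b\<in>V. E u b))}"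
  have "K \<subseteq> \<Union>\<V>"
  proof
    fix a assume "a \<in> K"
    then have "a \<in> topspace X" using compactin_subset_topspace[OF K] by blast
    from loc[OF this] show "a \<in> \<Union>\<V>" unfolding \<V>_def by blast
  qed
  moreover have "\<And>V. V \<in> \<V> \<Longrightarrow> openin X V" by (simp add: \<V>_def)
  ultimately obtain \<F> where \<F>: "finite \<F>" "\<F> \<subseteq> \<V>" "K \<subseteq> \<Union>\<F>"
    using K unfolding compactin_def by meson
  have "\<exists>U. openin X U \<and> p \<in> U \<and> (\<forall>V\<in>\<F>. \<forall>u\<in>U. \<forall>b\<in>V. E u b)"
    using \<F>(1,2)
  proof (induction \<F>)
    case empty
    show ?case by (intro exI[of _ "topspace X"]) (simp add: p)
  next
    case (insert V \<F>)
    then obtain U where U: "openin X U" "p \<in> U" "\<forall>V\<in>\<F>. \<forall>u\<in>U. \<forall>b\<in>V. E u b" by blast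
    obtain U' where U': "openin X U'" "p \<in> U'" "\<forall>u\<in>U'. \<forall>b\<in>V. E u b"
      using insert.prems by (auto simp: \<V>_def)
    show ?case by (intro exI[of _ "U \<inter> U'"]) (use U U' in \<open>auto intro: openin_Int\<close>)
  qed
  then show ?thesis using \<F>(3) by blast
qed

lemma dense_open_relation:
  fixes d :: "nat \<Rightarrow> 'a"
  assumes d: "\<And>i. d i \<in> topspace X"
    and dense: "\<And>W. openin X W \<Longrightarrow> W \<noteq> {} \<Longrightarrow> \<exists>i. d i \<in> W"
    and loc: "\<And>i a. a \<in> topspace X \<Longrightarrow> \<exists>U V. openin X U \<and> d i \<in> U \<and> openin X V \<and> a \<in> V \<and> (\<forall>u\<in>U. \<forall>b\<in>V. E u b)"
    and cpt: "\<And>i W. openin X W \<Longrightarrow> d i \<in> W \<Longrightarrow> \<exists>U K. openin X U \<and> compactin X K \<and> d i \<in> U \<and> U \<subseteq> K \<and> K \<subseteq> W"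
    and sym: "\<And>a b. E a b \<Longrightarrow> E b a"
  shows "\<exists>G. openin X G \<and> X closure_of G = topspace X \<and> (\<forall>a\<in>G. \<forall>b\<in>G. E a b)"
proof -
  \<comment> \<open>The relation is recorded on the compact set of each pair, not just on its open
    set, since later steps must cover that set by finitely many neighbourhoods.\<close>
  define P where "P = (\<lambda>(f :: nat \<Rightarrow> 'a set \<times> 'a set) i UK. openin X (fst UK) \<and> compactin X (snd UK) \<and>
     d i \<in> fst UK \<and> fst UK \<subseteq> snd UK \<and> (\<forall>a\<in>snd UK. \<forall>b\<in>snd UK. E a b) \<and>
     (\<forall>j<i. \<forall>a\<in>snd UK. \<forall>b\<in>snd (f j). E a b))"
  have "\<exists>f. \<forall>i. P f i (f i)"
  proof (rule dependent_wellorder_choice)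
    fix UK and f g :: "nat \<Rightarrow> 'a set \<times> 'a set" and i :: nat
    assume "\<And>j. j < i \<Longrightarrow> f j = g j"
    then show "P f i UK = P g i UK" unfolding P_def by simp
  next
    fix i :: nat and f :: "nat \<Rightarrow> 'a set \<times> 'a set" assume prev: "\<And>j. j < i \<Longrightarrow> P f j (f j)"
    obtain U V where UV: "openin X U" "d i \<in> U" "openin X V" "d i \<in> V" "\<forall>u\<in>U. \<forall>b\<in>V. E u b"
      using loc[OF d[of i], of i] by blast
    have "\<exists>W. openin X W \<and> d i \<in> W \<and> (\<forall>j<k. \<forall>u\<in>W. \<forall>b\<in>snd (f j). E u b)" if "k \<le> i" for k
      using that
    proof (induction k)
      case 0
      show ?case using d[of i] openin_topspace[of X] by blast
    next
      case (Suc k)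
      then obtain W where W: "openin X W" "d i \<in> W" "\<forall>j<k. \<forall>u\<in>W. \<forall>b\<in>snd (f j). E u b" by auto
      have "compactin X (snd (f k))" using prev[of k] Suc.prems by (simp add: P_def)
      from compact_uniform_neighbourhood[of X "d i" E, OF loc d this]
      obtain W' where W': "openin X W'" "d i \<in> W'" "\<forall>u\<in>W'. \<forall>b\<in>snd (f k). E u b" by blast
      show ?case
      proof (intro exI[of _ "W \<inter> W'"] conjI)
        show "\<forall>j<Suc k. \<forall>u\<in>W \<inter> W'. \<forall>b\<in>snd (f j). E u b"
          using W(3) W'(3) by (simp add: less_Suc_eq)
      qed (use W W' in \<open>auto intro: openin_Int\<close>)
    qed
    from this[OF order_refl] obtain W where W: "openin X W" "d i \<in> W" "\<forall>j<i. \<forall>u\<in>W. \<forall>b\<in>snd (f j). E u b" by blast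
    have "openin X (W \<inter> (U \<inter> V))" "d i \<in> W \<inter> (U \<inter> V)" using W UV by (auto intro: openin_Int)
    from cpt[OF this] obtain U' K where K: "openin X U'" "compactin X K" "d i \<in> U'" "U' \<subseteq> K" "K \<subseteq> W \<inter> (U \<inter> V)"
      by blast
    have "P f i (U', K)"
      unfolding P_def fst_conv snd_conv
    proof (intro conjI)
      show "\<forall>a\<in>K. \<forall>b\<in>K. E a b" using UV(5) K(5) by blast
      show "\<forall>j<i. \<forall>a\<in>K. \<forall>b\<in>snd (f j). E a b" using W(3) K(5) by blast
    qed (use K in auto)
    then show "\<exists>UK. P f i UK" by blast
  qed
  then obtain f where f: "\<And>i. P f i (f i)" by blast
  define G where "G = (\<Union>i. fst (f i))"
  have "openin X G" unfolding G_def using f by (intro openin_Union) (auto simp: P_def)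
  moreover have "X closure_of G = topspace X"
    unfolding dense_intersects_open
  proof (intro allI impI)
    fix W assume "openin X W \<and> W \<noteq> {}"
    then obtain i where "d i \<in> W" using dense by blast
    moreover have "d i \<in> G" using f[of i] by (auto simp: G_def P_def)
    ultimately show "G \<inter> W \<noteq> {}" by blast
  qed
  moreover have "E a b" if ab: "a \<in> G" "b \<in> G" for a b
  proof -
    obtain i j where i: "a \<in> fst (f i)" and j: "b \<in> fst (f j)" using ab by (auto simp: G_def)
    have a: "a \<in> snd (f i)" and b: "b \<in> snd (f j)" using f[of i] f[of j] i j by (auto simp: P_def)
    consider "i = j" | "i < j" | "j < i" by linarith
    then show ?thesis
    proof cases
      case 1
      then show ?thesis using f[of i] a b by (auto simp: P_def)
    next
      case 2
      then have "E b a" using f[of j] a b by (auto simp: P_def)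
      then show ?thesis by (rule sym)
    next
      case 3
      then show ?thesis using f[of i] a b by (auto simp: P_def)
    qed
  qed
  ultimately show ?thesis by blast
qed

lemma isometric_sets_sym:
  assumes "isometric_sets A Q" shows "isometric_sets Q A"
proof -
  obtain \<iota> where \<iota>: "is_isometry \<iota>" "Q = \<iota> ` A" using assms by (auto simp: isometric_sets_def)
  then have "A = inv \<iota> ` Q" by (simp add: image_inv_f_f is_isometry_inj)
  then show ?thesis unfolding isometric_sets_def using is_isometry_inv[OF \<iota>(1)] by blast
qed

lemma openin_periodic_space_slice:
  "m \<ge> 1 \<Longrightarrow> openin (config_topology m) U \<Longrightarrow> openin periodic_space ((\<lambda>u. (m, u)) ` U)"
  unfolding periodic_space_def using open_map_component_injection[of m "{1..}" config_topology]
  by (auto simp: open_map_def)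

lemma set_of_config_eq: "set_of_config (m, u) = config_set m (fst u) (snd u)"
  by (simp add: set_of_config_def case_prod_beta)

theorem generic_completeness:
  "\<exists>G. openin periodic_space G \<and> periodic_space closure_of G = topspace periodic_space \<and>
     (\<forall>p\<in>G. \<forall>q\<in>G.
        density_fingerprint (set_of_config p) = density_fingerprint (set_of_config q) \<longrightarrow>
        isometric_sets (set_of_config p) (set_of_config q))"
proof -
  obtain D where D: "\<And>m. countable (D m)" "\<And>m. D m \<subseteq> generic_configs m"
    "\<And>m W. openin (config_topology m) W \<Longrightarrow> W \<noteq> {} \<Longrightarrow> W \<inter> D m \<noteq> {}"
    using countable_dense_generic_configs by metis
  \<comment> \<open>All numbers of motif points are treated in one sequence, as the relation must
    also hold between different components.\<close>
  define T where "T = Sigma {1..} D"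
  have top: "topspace periodic_space = Sigma {1..} config_tuples"
    by (simp add: periodic_space_def config_topspace o_def)
  have gen: "generic_configs m \<subseteq> inner_configs m" for m by (auto simp: generic_configs_def)
  have slice: "\<exists>t\<in>T. t \<in> W" if W: "openin periodic_space W" "W \<noteq> {}" for W
  proof -
    obtain m u where mu: "(m, u) \<in> W" using W(2) by (metis ex_in_conv surj_pair)
    then have m: "m \<in> {1..}" using openin_subset[OF W(1)] unfolding top by blast
    then have "openin (config_topology m) {x. (m, x) \<in> W}"
      using W(1) unfolding periodic_space_def openin_sum_topology by blast
    then have "{x. (m, x) \<in> W} \<inter> D m \<noteq> {}" using D(3) mu by blast
    then show ?thesis using m by (auto simp: T_def)
  qed
  have "T \<noteq> {}"
  proof -
    \<comment> \<open>The cubic lattice with a single point at the origin shows that there is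
      something to enumerate.\<close>
    have "is_basis (mat 1 :: real^3^3)"
    proof (rule is_basis_if_inj)
      have "basis_comb (mat 1) r = r" for r
        by (simp add: basis_comb_def mat_def vec_eq_iff if_distrib cong: if_cong)
      then show "inj (basis_comb (mat 1))" by (simp add: inj_on_def)
    qed
    moreover have "(0 :: real^3) \<in> unit_cell (mat 1)"
      unfolding unit_cell_def by (intro CollectI exI[of _ "\<lambda>_. 0"]) simp
    ultimately have "(mat 1, \<lambda>k\<in>{..<1}. 0) \<in> config_tuples 1"
      by (auto simp: config_tuples_def inj_on_def)
    then have "topspace periodic_space \<noteq> {}" unfolding top by force
    then show ?thesis using slice[OF openin_topspace] by blast
  qed
  moreover have "countable T" unfolding T_def using D(1) by (intro countable_SIGMA) auto
  ultimately obtain d :: "nat \<Rightarrow> _" where d: "range d = T" by (metis uncountable_def)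
  have dT: "d i \<in> T" for i using d by blast
  define E where "E = (\<lambda>p q. density_fingerprint (set_of_config p) = density_fingerprint (set_of_config q) \<longrightarrow>
        isometric_sets (set_of_config p) (set_of_config q))"
  have "\<exists>G. openin periodic_space G \<and> periodic_space closure_of G = topspace periodic_space \<and> (\<forall>a\<in>G. \<forall>b\<in>G. E a b)"
  proof (rule dense_open_relation[of d])
    show "d i \<in> topspace periodic_space" for i
    proof -
      obtain m p where di: "d i = (m, p)" by (cases "d i")
      then have "m \<in> {1..}" "p \<in> D m" using dT[of i] by (simp_all add: T_def)
      moreover have "p \<in> config_tuples m"
        using \<open>p \<in> D m\<close> D(2)[of m] gen[of m] inner_configs_subset[of m] by blast
      ultimately show ?thesis unfolding top di by blast
    qed
    show "\<exists>i. d i \<in> W" if "openin periodic_space W" "W \<noteq> {}" for W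
      using slice[OF that] d by blast
    show "E b a" if "E a b" for a b
      using that isometric_sets_sym by (auto simp: E_def)
    show "\<exists>U V. openin periodic_space U \<and> d i \<in> U \<and> openin periodic_space V \<and> a \<in> V \<and> (\<forall>u\<in>U. \<forall>b\<in>V. E u b)"
      if a: "a \<in> topspace periodic_space" for i a
    proof -
      obtain m v x where di: "d i = (m, (v, x))" by (metis surj_pair)
      obtain n w y where an: "a = (n, (w, y))" by (metis surj_pair)
      have m: "m \<ge> 1" "(v, x) \<in> generic_configs m" using dT[of i] D(2) unfolding di T_def by auto
      have vx: "(v, x) \<in> config_tuples m" "gram_independent (config_index m) (config_vec v x)"
        using m(2) inner_configs_subset by (auto simp: generic_configs_def)
      have n: "n \<ge> 1" "(w, y) \<in> config_tuples n" using a unfolding top an by auto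
      obtain U V where UV: "openin (config_topology m) U" "(v, x) \<in> U" "openin (config_topology n) V" "(w, y) \<in> V"
        "\<forall>u\<in>U. \<forall>a\<in>V. density_fingerprint (config_set n (fst a) (snd a)) = density_fingerprint (config_set m (fst u) (snd u)) \<longrightarrow>
          isometric_sets (config_set n (fst a) (snd a)) (config_set m (fst u) (snd u))"
        using local_rigidity[OF vx(1) m(1) n(2,1) vx(2)] by blast
      have "E (m, u) (n, b)" if "u \<in> U" "b \<in> V" for u b
        using UV(5)[rule_format, OF that] isometric_sets_sym unfolding E_def set_of_config_eq by metis
      then show ?thesis
        using openin_periodic_space_slice[OF m(1) UV(1)] openin_periodic_space_slice[OF n(1) UV(3)] UV(2,4)
        unfolding di an by (intro exI[of _ "(\<lambda>u. (m, u)) ` U"] exI[of _ "(\<lambda>u. (n, u)) ` V"]) auto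
    qed
    show "\<exists>U K. openin periodic_space U \<and> compactin periodic_space K \<and> d i \<in> U \<and> U \<subseteq> K \<and> K \<subseteq> W"
      if W: "openin periodic_space W" "d i \<in> W" for i W
    proof -
      obtain m p where di: "d i = (m, p)" by (cases "d i")
      have m: "m \<ge> 1" "p \<in> inner_configs m" using dT[of i] D(2) gen unfolding di T_def by auto
      have "openin (config_topology m) {x. (m, x) \<in> W}"
        using W(1) m(1) unfolding periodic_space_def openin_sum_topology by simp
      then obtain W' where W': "openin (config_space m) W'" "{x. (m, x) \<in> W} = W' \<inter> config_tuples m"
        unfolding config_topology_eq openin_subtopology by blast
      \<comment> \<open>Inside the inner configurations the compact neighbourhood comes from the
        ambient product; it consists of configurations, so it stays compact in the subspace and in
        the disjoint union.\<close>
      have opn: "openin (config_space m) (W' \<inter> inner_configs m)" by (intro openin_Int W'(1) openin_inner_configs)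
      have op: "p \<in> W' \<inter> inner_configs m" using W(2) m(2) W'(2) inner_configs_subset unfolding di by blast
      obtain U K where UK: "openin (config_space m) U" "compactin (config_space m) K" "p \<in> U" "U \<subseteq> K" "K \<subseteq> W' \<inter> inner_configs m"
        using compact_neighbourhood_inner[OF opn op] by blast
      have K: "K \<subseteq> config_tuples m" using UK(5) inner_configs_subset by blast
      have "compactin (config_topology m) K"
        unfolding config_topology_eq compactin_subtopology using UK(2) K by blast
      moreover have "continuous_map (config_topology m) periodic_space (\<lambda>u. (m, u))"
        unfolding periodic_space_def using m(1) by (intro continuous_map_component_injection) simp
      ultimately have 1: "compactin periodic_space ((\<lambda>u. (m, u)) ` K)" by (rule image_compactin)
      have "openin (config_topology m) (U \<inter> config_tuples m)"
        unfolding config_topology_eq using UK(1) by (rule openin_subtopology_Int)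
      moreover have "U \<inter> config_tuples m = U" using UK(4) K by blast
      ultimately have 2: "openin periodic_space ((\<lambda>u. (m, u)) ` U)"
        using openin_periodic_space_slice[OF m(1)] by simp
      have "(\<lambda>u. (m, u)) ` K \<subseteq> W" using UK(5) K W'(2) by blast
      then show ?thesis using 1 2 UK(3,4) unfolding di by blast
    qed
  qed
  then show ?thesis unfolding E_def .
qed

theorem mainTheorem1:
  shows
    "(\<forall>A \<iota>. periodic_set A \<and> is_isometry \<iota> \<longrightarrow>
        density_fingerprint A = density_fingerprint (\<iota> ` A))
     \<and>
     (\<exists>\<epsilon> C :: real \<Rightarrow> real \<Rightarrow> real. \<forall>A. periodic_set A \<longrightarrow>
        \<epsilon> (packing_radius A) (covering_radius A) > 0 \<and>
        C (packing_radius A) (covering_radius A) > 0 \<and>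
        (\<forall>Q. periodic_set Q \<and>
             bottleneck_dist A Q < ennreal (\<epsilon> (packing_radius A) (covering_radius A)) \<longrightarrow>
             fingerprint_dist (density_fingerprint A) (density_fingerprint Q)
               \<le> ennreal (C (packing_radius A) (covering_radius A)) * bottleneck_dist A Q))
     \<and>
     (\<exists>G. openin periodic_space G \<and>
          periodic_space closure_of G = topspace periodic_space \<and>
          (\<forall>p\<in>G. \<forall>q\<in>G.
             density_fingerprint (set_of_config p) = density_fingerprint (set_of_config q) \<longrightarrow>
             isometric_sets (set_of_config p) (set_of_config q)))"
proof (intro conjI)
  show "\<forall>A \<iota>. periodic_set A \<and> is_isometry \<iota> \<longrightarrow> density_fingerprint A = density_fingerprint (\<iota> ` A)"
    using density_fingerprint_isometry by simp
  show "\<exists>\<epsilon> C :: real \<Rightarrow> real \<Rightarrow> real. \<forall>A. periodic_set A \<longrightarrow>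
        \<epsilon> (packing_radius A) (covering_radius A) > 0 \<and>
        C (packing_radius A) (covering_radius A) > 0 \<and>
        (\<forall>Q. periodic_set Q \<and>
             bottleneck_dist A Q < ennreal (\<epsilon> (packing_radius A) (covering_radius A)) \<longrightarrow>
             fingerprint_dist (density_fingerprint A) (density_fingerprint Q)
               \<le> ennreal (C (packing_radius A) (covering_radius A)) * bottleneck_dist A Q)"
    \<comment> \<open>The threshold can be the constant 1, as the increments were estimated for all
      \<open>\<delta> \<le> 1\<close>.\<close>
    by (intro exI[of _ "\<lambda>_ _. 1"] exI[of _ lipschitz_const])
       (simp add: lipschitz_const_pos fingerprint_dist_le_bottleneck)
qed (rule generic_completeness)

end
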